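(* Let $\mathcal{A}$ be an abelian category. Then $D^b(\mathcal{A}) = \langle \mathcal{A} \rangle_2$. Furthermore, if $\mathcal{A} = \mathrm{add}\, M$ for some object $M \in \mathcal{A}$, then $\dim D^b(\mathcal{A}) \leq 1$.
   Context: Let $\mathcal{T}$ be a triangulated category with shift functor $[1]$, and let $\mathcal{I}$ and $\mathcal{J}$ be full subcategories of $\mathcal{T}$. - $\langle \mathcal{I} \rangle$ denotes the smallest full subcategory of $\mathcal{T}$ containing $\mathcal{I}$ and closed under shifts, finite direct sums and direct summands. - $\mathcal{I} \ast \mathcal{J}$ denotes the full subcategory of $\mathcal{T}$ consisting of all objects $M \in \mathcal{T}$ for which there exists a triangle $I \rightarrow M \rightarrow J \rightarrow I[1]$ with $I \in \mathcal{I}$ and $J \in \mathcal{J}$. - $\mathcal{I} \diamond \mathcal{J} := \langle \mathcal{I} \ast \mathcal{J} \rangle$. - Inductively, $\langle \mathcal{I} \rangle_0 := \{0\}$ and $\langle \mathcal{I} \rangle_n := \langle \mathcal{I} \rangle_{n-1} \diamond \langle \mathcal{I} \rangle$ for $n \geq 1$. - For an object $M \in \mathcal{T}$, $\langle M \rangle_n$ means $\langle \mathcal{I} \rangle_n$ where $\mathcal{I}$ is the full subcategory with the single object $M$. - The dimension of $\mathcal{T}$ is $\dim \mathcal{T} := \min\{d \geq 0 \mid \text{there exists } M \in \mathcal{T} \text{ with } \mathcal{T} = \langle M \rangle_{d+1}\}$, or $\infty$ if there is no such $M$ for any $d$. For an abelian category $\mathcal{A}$, $D^b(\mathcal{A})$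 is the derived category of bounded complexes over $\mathcal{A}$, a triangulated category. $\mathcal{A}$ is regarded as a full subcategory of $D^b(\mathcal{A})$ by viewing objects as complexes concentrated in degree $0$. For an object $M \in \mathcal{A}$, $\mathrm{add}\, M$ is the full subcategory of $\mathcal{A}$ consisting of direct summands of direct sums of finitely many copies of $M$. *)

theory Defs
  imports Main "HOL-Algebra.Group" "HOL-Library.Extended_Nat"
begin

section \<open>Categories\<close>

text \<open>Full subcategories are represented throughout by their sets of objects.\<close>

record ('o, 'm) cat =
  Obj :: "'o set"
  Arr :: "'m set"
  Dom :: "'m \<Rightarrow> 'o"
  Cod :: "'m \<Rightarrow> 'o"
  Ident :: "'o \<Rightarrow> 'm"
  Comp :: "'m \<Rightarrow> 'm \<Rightarrow> 'm" (infixr "\<cdot>\<index>" 70)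

definition Hom :: "('o, 'm, 'x) cat_scheme \<Rightarrow> 'o \<Rightarrow> 'o \<Rightarrow> 'm set" where
  "Hom C X Y = {f \<in> Arr C. Dom C f = X \<and> Cod C f = Y}"

locale category =
  fixes C :: "('o, 'm, 'x) cat_scheme" (structure)
  assumes dom_obj: "f \<in> Arr C \<Longrightarrow> Dom C f \<in> Obj C"
    and cod_obj: "f \<in> Arr C \<Longrightarrow> Cod C f \<in> Obj C"
    and ident_hom: "X \<in> Obj C \<Longrightarrow> Ident C X \<in> Hom C X X"
    and comp_hom: "\<lbrakk>f \<in> Hom C X Y; g \<in> Hom C Y Z\<rbrakk> \<Longrightarrow> g \<cdot> f \<in> Hom C X Z"
    and comp_assoc: "\<lbrakk>f \<in> Hom C X Y; g \<in> Hom C Y Z; h \<in> Hom C Z W\<rbrakk> \<Longrightarrow> (h \<cdot> g) \<cdot> f = h \<cdot> (g \<cdot> f)"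
    and comp_ident_right: "f \<in> Hom C X Y \<Longrightarrow> f \<cdot> Ident C X = f"
    and comp_ident_left: "f \<in> Hom C X Y \<Longrightarrow> Ident C Y \<cdot> f = f"

definition is_iso :: "('o, 'm, 'x) cat_scheme \<Rightarrow> 'm \<Rightarrow> bool" where
  "is_iso C f \<longleftrightarrow> f \<in> Arr C \<and>
     (\<exists>g \<in> Hom C (Cod C f) (Dom C f).
        g \<cdot>\<^bsub>C\<^esub> f = Ident C (Dom C f) \<and> f \<cdot>\<^bsub>C\<^esub> g = Ident C (Cod C f))"

definition is_mono :: "('o, 'm, 'x) cat_scheme \<Rightarrow> 'm \<Rightarrow> bool" where
  "is_mono C f \<longleftrightarrow> f \<in> Arr C \<and>
     (\<forall>T \<in> Obj C. \<forall>g \<in> Hom C T (Dom C f). \<forall>h \<in> Hom C T (Dom C f).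
        f \<cdot>\<^bsub>C\<^esub> g = f \<cdot>\<^bsub>C\<^esub> h \<longrightarrow> g = h)"

definition is_epi :: "('o, 'm, 'x) cat_scheme \<Rightarrow> 'm \<Rightarrow> bool" where
  "is_epi C f \<longleftrightarrow> f \<in> Arr C \<and>
     (\<forall>T \<in> Obj C. \<forall>g \<in> Hom C (Cod C f) T. \<forall>h \<in> Hom C (Cod C f) T.
        g \<cdot>\<^bsub>C\<^esub> f = h \<cdot>\<^bsub>C\<^esub> f \<longrightarrow> g = h)"

definition is_zero_obj :: "('o, 'm, 'x) cat_scheme \<Rightarrow> 'o \<Rightarrow> bool" where
  "is_zero_obj C Z \<longleftrightarrow> Z \<in> Obj C \<and>
     (\<forall>X \<in> Obj C. (\<exists>!f. f \<in> Hom C X Z) \<and> (\<exists>!f. f \<in> Hom C Z X))"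

text \<open>Direct sums are categorical coproducts; in an additive category these are the biproducts.
  The direct sum of the empty list is a zero object.\<close>

definition is_direct_sum :: "('o, 'm, 'x) cat_scheme \<Rightarrow> 'o list \<Rightarrow> 'o \<Rightarrow> bool" where
  "is_direct_sum C Xs S \<longleftrightarrow> set Xs \<subseteq> Obj C \<and> S \<in> Obj C \<and>
     (\<exists>\<iota>. (\<forall>k < length Xs. \<iota> k \<in> Hom C (Xs ! k) S) \<and>
        (\<forall>T \<in> Obj C. \<forall>f. (\<forall>k < length Xs. f k \<in> Hom C (Xs ! k) T) \<longrightarrow>
           (\<exists>!h. h \<in> Hom C S T \<and> (\<forall>k < length Xs. h \<cdot>\<^bsub>C\<^esub> \<iota> k = f k))))"

definition is_direct_summand :: "('o, 'm, 'x) cat_scheme \<Rightarrow> 'o \<Rightarrow> 'o \<Rightarrow> bool" where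
  "is_direct_summand C X S \<longleftrightarrow> (\<exists>Y. is_direct_sum C [X, Y] S)"

definition add_closure :: "('o, 'm, 'x) cat_scheme \<Rightarrow> 'o \<Rightarrow> 'o set" where
  "add_closure C M = {X. \<exists>n S. is_direct_sum C (replicate n M) S \<and> is_direct_summand C X S}"


section \<open>Abelian categories\<close>

record ('o, 'm) preadd_cat = "('o, 'm) cat" +
  HPlus :: "'m \<Rightarrow> 'm \<Rightarrow> 'm" (infixl "\<oplus>\<^sub>h\<index>" 65)
  HZero :: "'o \<Rightarrow> 'o \<Rightarrow> 'm"

definition hom_group :: "('o, 'm, 'x) preadd_cat_scheme \<Rightarrow> 'o \<Rightarrow> 'o \<Rightarrow> 'm monoid" where
  "hom_group A X Y =
     \<lparr>carrier = Hom A X Y, monoid.mult = HPlus A, monoid.one = HZero A X Y\<rparr>"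

definition hneg :: "('o, 'm, 'x) preadd_cat_scheme \<Rightarrow> 'm \<Rightarrow> 'm" where
  "hneg A f = m_inv (hom_group A (Dom A f) (Cod A f)) f"

definition is_kernel :: "('o, 'm, 'x) preadd_cat_scheme \<Rightarrow> 'm \<Rightarrow> 'm \<Rightarrow> bool" where
  "is_kernel A f k \<longleftrightarrow> f \<in> Arr A \<and> k \<in> Arr A \<and> Cod A k = Dom A f \<and>
     f \<cdot>\<^bsub>A\<^esub> k = HZero A (Dom A k) (Cod A f) \<and>
     (\<forall>T \<in> Obj A. \<forall>g \<in> Hom A T (Dom A f). f \<cdot>\<^bsub>A\<^esub> g = HZero A T (Cod A f) \<longrightarrow>
        (\<exists>!h. h \<in> Hom A T (Dom A k) \<and> k \<cdot>\<^bsub>A\<^esub> h = g))"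

definition is_cokernel :: "('o, 'm, 'x) preadd_cat_scheme \<Rightarrow> 'm \<Rightarrow> 'm \<Rightarrow> bool" where
  "is_cokernel A f q \<longleftrightarrow> f \<in> Arr A \<and> q \<in> Arr A \<and> Dom A q = Cod A f \<and>
     q \<cdot>\<^bsub>A\<^esub> f = HZero A (Dom A f) (Cod A q) \<and>
     (\<forall>T \<in> Obj A. \<forall>g \<in> Hom A (Cod A f) T. g \<cdot>\<^bsub>A\<^esub> f = HZero A (Dom A f) T \<longrightarrow>
        (\<exists>!h. h \<in> Hom A (Cod A q) T \<and> h \<cdot>\<^bsub>A\<^esub> q = g))"

definition is_biproduct ::
  "('o, 'm, 'x) preadd_cat_scheme \<Rightarrow> 'o \<Rightarrow> 'o \<Rightarrow> 'o \<times> 'm \<times> 'm \<times> 'm \<times> 'm \<Rightarrow> bool" where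
  "is_biproduct A X Y = (\<lambda>(S, i1, i2, p1, p2).
     S \<in> Obj A \<and> i1 \<in> Hom A X S \<and> i2 \<in> Hom A Y S \<and> p1 \<in> Hom A S X \<and> p2 \<in> Hom A S Y \<and>
     p1 \<cdot>\<^bsub>A\<^esub> i1 = Ident A X \<and> p2 \<cdot>\<^bsub>A\<^esub> i2 = Ident A Y \<and>
     p1 \<cdot>\<^bsub>A\<^esub> i2 = HZero A Y X \<and> p2 \<cdot>\<^bsub>A\<^esub> i1 = HZero A X Y \<and>
     (i1 \<cdot>\<^bsub>A\<^esub> p1) \<oplus>\<^sub>h\<^bsub>A\<^esub> (i2 \<cdot>\<^bsub>A\<^esub> p2) = Ident A S)"

locale abelian_category = category A
  for A :: "('o, 'm, 'x) preadd_cat_scheme" (structure) +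
  assumes hom_comm_group: "\<lbrakk>X \<in> Obj A; Y \<in> Obj A\<rbrakk> \<Longrightarrow> comm_group (hom_group A X Y)"
    and comp_add_left: "\<lbrakk>f \<in> Hom A X Y; g \<in> Hom A Y Z; g' \<in> Hom A Y Z\<rbrakk> \<Longrightarrow>
          (g \<oplus>\<^sub>h g') \<cdot> f = (g \<cdot> f) \<oplus>\<^sub>h (g' \<cdot> f)"
    and comp_add_right: "\<lbrakk>f \<in> Hom A X Y; f' \<in> Hom A X Y; g \<in> Hom A Y Z\<rbrakk> \<Longrightarrow>
          g \<cdot> (f \<oplus>\<^sub>h f') = (g \<cdot> f) \<oplus>\<^sub>h (g \<cdot> f')"
    and zero_obj_exists: "\<exists>Z. is_zero_obj A Z"
    and biproduct_exists: "\<lbrakk>X \<in> Obj A; Y \<in> Obj A\<rbrakk> \<Longrightarrow> \<exists>B. is_biproduct A X Y B"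
    and kernel_exists: "f \<in> Arr A \<Longrightarrow> \<exists>k. is_kernel A f k"
    and cokernel_exists: "f \<in> Arr A \<Longrightarrow> \<exists>q. is_cokernel A f q"
    and mono_is_kernel: "is_mono A f \<Longrightarrow> \<exists>g. is_kernel A g f"
    and epi_is_cokernel: "is_epi A f \<Longrightarrow> \<exists>g. is_cokernel A g f"

definition zero_obj :: "('o, 'm, 'x) preadd_cat_scheme \<Rightarrow> 'o" where
  "zero_obj A = (SOME Z. is_zero_obj A Z)"

definition biprod ::
  "('o, 'm, 'x) preadd_cat_scheme \<Rightarrow> 'o \<Rightarrow> 'o \<Rightarrow> 'o \<times> 'm \<times> 'm \<times> 'm \<times> 'm" where
  "biprod A X Y = (SOME B. is_biproduct A X Y B)"

definition bsum :: "('o, 'm, 'x) preadd_cat_scheme \<Rightarrow> 'o \<Rightarrow> 'o \<Rightarrow> 'o" where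
  "bsum A X Y = (case biprod A X Y of (S, i1, i2, p1, p2) \<Rightarrow> S)"

definition binj1 :: "('o, 'm, 'x) preadd_cat_scheme \<Rightarrow> 'o \<Rightarrow> 'o \<Rightarrow> 'm" where
  "binj1 A X Y = (case biprod A X Y of (S, i1, i2, p1, p2) \<Rightarrow> i1)"

definition binj2 :: "('o, 'm, 'x) preadd_cat_scheme \<Rightarrow> 'o \<Rightarrow> 'o \<Rightarrow> 'm" where
  "binj2 A X Y = (case biprod A X Y of (S, i1, i2, p1, p2) \<Rightarrow> i2)"

definition bproj1 :: "('o, 'm, 'x) preadd_cat_scheme \<Rightarrow> 'o \<Rightarrow> 'o \<Rightarrow> 'm" where
  "bproj1 A X Y = (case biprod A X Y of (S, i1, i2, p1, p2) \<Rightarrow> p1)"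

definition bproj2 :: "('o, 'm, 'x) preadd_cat_scheme \<Rightarrow> 'o \<Rightarrow> 'o \<Rightarrow> 'm" where
  "bproj2 A X Y = (case biprod A X Y of (S, i1, i2, p1, p2) \<Rightarrow> p2)"


section \<open>Bounded complexes\<close>

text \<open>Cohomological grading: the differential \<open>cdiff X n\<close> goes from degree \<open>n\<close> to degree \<open>n + 1\<close>.\<close>

record ('o, 'm) cplx =
  cobj :: "int \<Rightarrow> 'o"
  cdiff :: "int \<Rightarrow> 'm"

record ('o, 'm) chmap =
  csrc :: "('o, 'm) cplx"
  ctgt :: "('o, 'm) cplx"
  cmap :: "int \<Rightarrow> 'm"

definition is_complex :: "('o, 'm, 'x) preadd_cat_scheme \<Rightarrow> ('o, 'm) cplx \<Rightarrow> bool" where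
  "is_complex A X \<longleftrightarrow> (\<forall>n. cobj X n \<in> Obj A \<and> cdiff X n \<in> Hom A (cobj X n) (cobj X (n + 1)) \<and>
     cdiff X (n + 1) \<cdot>\<^bsub>A\<^esub> cdiff X n = HZero A (cobj X n) (cobj X (n + 2)))"

definition is_bounded :: "('o, 'm, 'x) preadd_cat_scheme \<Rightarrow> ('o, 'm) cplx \<Rightarrow> bool" where
  "is_bounded A X \<longleftrightarrow> (\<exists>N. \<forall>n. \<bar>n\<bar> > N \<longrightarrow> is_zero_obj A (cobj X n))"

definition is_chain_map :: "('o, 'm, 'x) preadd_cat_scheme \<Rightarrow> ('o, 'm) chmap \<Rightarrow> bool" where
  "is_chain_map A f \<longleftrightarrow> (\<forall>n. cmap f n \<in> Hom A (cobj (csrc f) n) (cobj (ctgt f) n) \<and>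
     cmap f (n + 1) \<cdot>\<^bsub>A\<^esub> cdiff (csrc f) n = cdiff (ctgt f) n \<cdot>\<^bsub>A\<^esub> cmap f n)"

definition Cb :: "('o, 'm, 'x) preadd_cat_scheme \<Rightarrow> (('o, 'm) cplx, ('o, 'm) chmap) cat" where
  "Cb A =
     \<lparr>Obj = {X. is_complex A X \<and> is_bounded A X},
      Arr = {f. is_complex A (csrc f) \<and> is_bounded A (csrc f) \<and>
                is_complex A (ctgt f) \<and> is_bounded A (ctgt f) \<and> is_chain_map A f},
      Dom = csrc, Cod = ctgt,
      Ident = (\<lambda>X. \<lparr>csrc = X, ctgt = X, cmap = (\<lambda>n. Ident A (cobj X n))\<rparr>),
      Comp = (\<lambda>g f. \<lparr>csrc = csrc f, ctgt = ctgt g, cmap = (\<lambda>n. cmap g n \<cdot>\<^bsub>A\<^esub> cmap f n)\<rparr>)\<rparr>"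

definition stalk :: "('o, 'm, 'x) preadd_cat_scheme \<Rightarrow> 'o \<Rightarrow> ('o, 'm) cplx" where
  "stalk A X = (let ob = (\<lambda>n::int. if n = 0 then X else zero_obj A) in
     \<lparr>cobj = ob, cdiff = (\<lambda>n. HZero A (ob n) (ob (n + 1)))\<rparr>)"

definition shift_cplx :: "('o, 'm, 'x) preadd_cat_scheme \<Rightarrow> ('o, 'm) cplx \<Rightarrow> ('o, 'm) cplx" where
  "shift_cplx A X = \<lparr>cobj = (\<lambda>n. cobj X (n + 1)), cdiff = (\<lambda>n. hneg A (cdiff X (n + 1)))\<rparr>"

definition shift_chmap :: "('o, 'm, 'x) preadd_cat_scheme \<Rightarrow> ('o, 'm) chmap \<Rightarrow> ('o, 'm) chmap" where
  "shift_chmap A f =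
     \<lparr>csrc = shift_cplx A (csrc f), ctgt = shift_cplx A (ctgt f), cmap = (\<lambda>n. cmap f (n + 1))\<rparr>"

text \<open>The cone of \<open>f : X \<rightarrow> Y\<close> is \<open>X[1] \<oplus> Y\<close> in each degree, with
  differential \<open>(x, y) \<mapsto> (- d x, f x + d y)\<close>.\<close>

definition cone :: "('o, 'm, 'x) preadd_cat_scheme \<Rightarrow> ('o, 'm) chmap \<Rightarrow> ('o, 'm) cplx" where
  "cone A f = (let X = csrc f; Y = ctgt f in
     \<lparr>cobj = (\<lambda>n. bsum A (cobj X (n + 1)) (cobj Y n)),
      cdiff = (\<lambda>n.
        let p1 = bproj1 A (cobj X (n + 1)) (cobj Y n);
            p2 = bproj2 A (cobj X (n + 1)) (cobj Y n);
            i1 = binj1 A (cobj X (n + 2)) (cobj Y (n + 1));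
            i2 = binj2 A (cobj X (n + 2)) (cobj Y (n + 1))
        in (i1 \<cdot>\<^bsub>A\<^esub> hneg A (cdiff X (n + 1)) \<cdot>\<^bsub>A\<^esub> p1)
           \<oplus>\<^sub>h\<^bsub>A\<^esub> (i2 \<cdot>\<^bsub>A\<^esub> cmap f (n + 1) \<cdot>\<^bsub>A\<^esub> p1)
           \<oplus>\<^sub>h\<^bsub>A\<^esub> (i2 \<cdot>\<^bsub>A\<^esub> cdiff Y n \<cdot>\<^bsub>A\<^esub> p2))\<rparr>)"

definition cone_in :: "('o, 'm, 'x) preadd_cat_scheme \<Rightarrow> ('o, 'm) chmap \<Rightarrow> ('o, 'm) chmap" where
  "cone_in A f = \<lparr>csrc = ctgt f, ctgt = cone A f,
     cmap = (\<lambda>n. binj2 A (cobj (csrc f) (n + 1)) (cobj (ctgt f) n))\<rparr>"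

definition cone_out :: "('o, 'm, 'x) preadd_cat_scheme \<Rightarrow> ('o, 'm) chmap \<Rightarrow> ('o, 'm) chmap" where
  "cone_out A f = \<lparr>csrc = cone A f, ctgt = shift_cplx A (csrc f),
     cmap = (\<lambda>n. bproj1 A (cobj (csrc f) (n + 1)) (cobj (ctgt f) n))\<rparr>"


subsection \<open>Cohomology and quasi-isomorphisms\<close>

text \<open>\<open>cocyc A X n : Z\<^sup>n \<rightarrow> X\<^sup>n\<close> is a kernel of the differential, \<open>cobd A X n : X\<^sup>n\<^sup>-\<^sup>1 \<rightarrow> Z\<^sup>n\<close> is
  the factorisation of the previous differential through it, and
  \<open>coh_proj A X n : Z\<^sup>n \<rightarrow> H\<^sup>n\<close> is a cokernel of the latter.\<close>

definition cocyc :: "('o, 'm, 'x) preadd_cat_scheme \<Rightarrow> ('o, 'm) cplx \<Rightarrow> int \<Rightarrow> 'm" where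
  "cocyc A X n = (SOME k. is_kernel A (cdiff X n) k)"

definition cobd :: "('o, 'm, 'x) preadd_cat_scheme \<Rightarrow> ('o, 'm) cplx \<Rightarrow> int \<Rightarrow> 'm" where
  "cobd A X n = (THE e. e \<in> Hom A (cobj X (n - 1)) (Dom A (cocyc A X n)) \<and>
     cocyc A X n \<cdot>\<^bsub>A\<^esub> e = cdiff X (n - 1))"

definition coh_proj :: "('o, 'm, 'x) preadd_cat_scheme \<Rightarrow> ('o, 'm) cplx \<Rightarrow> int \<Rightarrow> 'm" where
  "coh_proj A X n = (SOME q. is_cokernel A (cobd A X n) q)"

definition cohomology :: "('o, 'm, 'x) preadd_cat_scheme \<Rightarrow> ('o, 'm) cplx \<Rightarrow> int \<Rightarrow> 'o" where
  "cohomology A X n = Cod A (coh_proj A X n)"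

definition cocyc_map :: "('o, 'm, 'x) preadd_cat_scheme \<Rightarrow> ('o, 'm) chmap \<Rightarrow> int \<Rightarrow> 'm" where
  "cocyc_map A f n =
     (THE z. z \<in> Hom A (Dom A (cocyc A (csrc f) n)) (Dom A (cocyc A (ctgt f) n)) \<and>
        cocyc A (ctgt f) n \<cdot>\<^bsub>A\<^esub> z = cmap f n \<cdot>\<^bsub>A\<^esub> cocyc A (csrc f) n)"

definition coh_map :: "('o, 'm, 'x) preadd_cat_scheme \<Rightarrow> ('o, 'm) chmap \<Rightarrow> int \<Rightarrow> 'm" where
  "coh_map A f n =
     (THE h. h \<in> Hom A (cohomology A (csrc f) n) (cohomology A (ctgt f) n) \<and>
        h \<cdot>\<^bsub>A\<^esub> coh_proj A (csrc f) n = coh_proj A (ctgt f) n \<cdot>\<^bsub>A\<^esub> cocyc_map A f n)"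

definition quasi_isos :: "('o, 'm, 'x) preadd_cat_scheme \<Rightarrow> ('o, 'm) chmap set" where
  "quasi_isos A = {f \<in> Arr (Cb A). \<forall>n. is_iso A (coh_map A f n)}"


section \<open>Localization of a category\<close>

text \<open>The Gabriel--Zisman construction: arrows are zigzags, written in diagrammatic order, in which
  arrows of \<open>W\<close> may also be traversed backwards, modulo the congruence generated by the
  composition and identities of \<open>C\<close> and by cancelling an arrow of \<open>W\<close> against its formal inverse.\<close>

datatype 'm zstep = Fwd 'm | Bwd 'm

fun zigzag :: "('o, 'm, 'x) cat_scheme \<Rightarrow> 'm set \<Rightarrow> 'o \<Rightarrow> 'o \<Rightarrow> 'm zstep list \<Rightarrow> bool" where
  "zigzag C W X Y [] \<longleftrightarrow> X \<in> Obj C \<and> X = Y"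
| "zigzag C W X Y (Fwd f # p) \<longleftrightarrow> f \<in> Arr C \<and> Dom C f = X \<and> zigzag C W (Cod C f) Y p"
| "zigzag C W X Y (Bwd w # p) \<longleftrightarrow> w \<in> Arr C \<inter> W \<and> Cod C w = X \<and> zigzag C W (Dom C w) Y p"

inductive zz_rel :: "('o, 'm, 'x) cat_scheme \<Rightarrow> 'm set \<Rightarrow> 'm zstep list \<Rightarrow> 'm zstep list \<Rightarrow> bool"
  for C W where
  ident: "X \<in> Obj C \<Longrightarrow> zz_rel C W [Fwd (Ident C X)] []"
| comp: "\<lbrakk>f \<in> Hom C X Y; g \<in> Hom C Y Z\<rbrakk> \<Longrightarrow> zz_rel C W [Fwd f, Fwd g] [Fwd (g \<cdot>\<^bsub>C\<^esub> f)]"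
| cancel_right: "w \<in> Arr C \<inter> W \<Longrightarrow> zz_rel C W [Fwd w, Bwd w] []"
| cancel_left: "w \<in> Arr C \<inter> W \<Longrightarrow> zz_rel C W [Bwd w, Fwd w] []"

inductive zz_eq ::
  "('o, 'm, 'x) cat_scheme \<Rightarrow> 'm set \<Rightarrow> 'o \<Rightarrow> 'o \<Rightarrow> 'm zstep list \<Rightarrow> 'm zstep list \<Rightarrow> bool"
  for C W X Y where
  rel: "\<lbrakk>zz_rel C W l r; zigzag C W X Y (a @ l @ b); zigzag C W X Y (a @ r @ b)\<rbrakk>
        \<Longrightarrow> zz_eq C W X Y (a @ l @ b) (a @ r @ b)"
| refl: "zigzag C W X Y p \<Longrightarrow> zz_eq C W X Y p p"
| sym: "zz_eq C W X Y p q \<Longrightarrow> zz_eq C W X Y q p"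
| trans: "\<lbrakk>zz_eq C W X Y p q; zz_eq C W X Y q r\<rbrakk> \<Longrightarrow> zz_eq C W X Y p r"

type_synonym ('o, 'm) loc_arr = "'o \<times> 'o \<times> 'm zstep list set"

definition zz_class ::
  "('o, 'm, 'x) cat_scheme \<Rightarrow> 'm set \<Rightarrow> 'o \<Rightarrow> 'o \<Rightarrow> 'm zstep list \<Rightarrow> ('o, 'm) loc_arr" where
  "zz_class C W X Y p = (X, Y, {q. zz_eq C W X Y p q})"

definition localization ::
  "('o, 'm, 'x) cat_scheme \<Rightarrow> 'm set \<Rightarrow> ('o, ('o, 'm) loc_arr) cat" where
  "localization C W =
     \<lparr>Obj = Obj C,
      Arr = {zz_class C W X Y p | X Y p. zigzag C W X Y p},
      Dom = (\<lambda>(X, Y, P). X), Cod = (\<lambda>(X, Y, P). Y),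
      Ident = (\<lambda>X. zz_class C W X X []),
      Comp = (\<lambda>(Y', Z, Q) (X, Y, P). (X, Z, {r. \<exists>p \<in> P. \<exists>q \<in> Q. zz_eq C W X Z (p @ q) r}))\<rparr>"

definition loc_functor ::
  "('o, 'm, 'x) cat_scheme \<Rightarrow> 'm set \<Rightarrow> 'm \<Rightarrow> ('o, 'm) loc_arr" where
  "loc_functor C W f = zz_class C W (Dom C f) (Cod C f) [Fwd f]"


section \<open>Generation and dimension in triangulated categories\<close>

text \<open>The data of a triangulated category used below: the underlying category, the shift functor on
  objects and arrows, and the distinguished triangles \<open>(u, v, w)\<close>.  The notions of generation and
  dimension refer only to these data, so the triangulated axioms are not recorded.  The additive
  structure is likewise not a separate field, as zero objects and direct sums are determined by the
  underlying category.\<close>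

record ('o, 'm) tri_cat = "('o, 'm) cat" +
  Sh_obj :: "'o \<Rightarrow> 'o"
  Sh_arr :: "'m \<Rightarrow> 'm"
  Tri :: "('m \<times> 'm \<times> 'm) set"

text \<open>The equivalence in the second clause expresses closure under both \<open>[1]\<close> and \<open>[-1]\<close>.\<close>

definition sum_closed :: "('o, 'm, 'x) tri_cat_scheme \<Rightarrow> 'o set \<Rightarrow> bool" where
  "sum_closed T S \<longleftrightarrow> S \<subseteq> Obj T \<and>
     (\<forall>X \<in> Obj T. Sh_obj T X \<in> S \<longleftrightarrow> X \<in> S) \<and>
     (\<forall>Xs D. set Xs \<subseteq> S \<and> is_direct_sum T Xs D \<longrightarrow> D \<in> S) \<and>
     (\<forall>X D. D \<in> S \<and> is_direct_summand T X D \<longrightarrow> X \<in> S)"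

definition gen :: "('o, 'm, 'x) tri_cat_scheme \<Rightarrow> 'o set \<Rightarrow> 'o set" where
  "gen T I = \<Inter> {S. I \<subseteq> S \<and> sum_closed T S}"

definition star :: "('o, 'm, 'x) tri_cat_scheme \<Rightarrow> 'o set \<Rightarrow> 'o set \<Rightarrow> 'o set" where
  "star T I J = {M \<in> Obj T. \<exists>X \<in> I. \<exists>Y \<in> J. \<exists>u v w. (u, v, w) \<in> Tri T \<and>
     u \<in> Hom T X M \<and> v \<in> Hom T M Y \<and> w \<in> Hom T Y (Sh_obj T X)}"

definition diamond :: "('o, 'm, 'x) tri_cat_scheme \<Rightarrow> 'o set \<Rightarrow> 'o set \<Rightarrow> 'o set" where
  "diamond T I J = gen T (star T I J)"

primrec gen_level :: "('o, 'm, 'x) tri_cat_scheme \<Rightarrow> 'o set \<Rightarrow> nat \<Rightarrow> 'o set" where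
  "gen_level T I 0 = {Z. is_zero_obj T Z}"
| "gen_level T I (Suc n) = diamond T (gen_level T I n) (gen T I)"

text \<open>The infimum of the empty set in \<open>enat\<close> is \<open>\<infinity>\<close>.\<close>

definition tri_dim :: "('o, 'm, 'x) tri_cat_scheme \<Rightarrow> enat" where
  "tri_dim T = Inf {enat d | d. \<exists>M \<in> Obj T. Obj T = gen_level T {M} (d + 1)}"


section \<open>The bounded derived category\<close>

definition Db_cat ::
  "('o, 'm, 'x) preadd_cat_scheme \<Rightarrow> (('o, 'm) cplx, (('o, 'm) cplx, ('o, 'm) chmap) loc_arr) cat"
  where
  "Db_cat A = localization (Cb A) (quasi_isos A)"

definition Db_functor ::
  "('o, 'm, 'x) preadd_cat_scheme \<Rightarrow> ('o, 'm) chmap \<Rightarrow> (('o, 'm) cplx, ('o, 'm) chmap) loc_arr"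
  where
  "Db_functor A f = loc_functor (Cb A) (quasi_isos A) f"

definition Db_shift_arr ::
  "('o, 'm, 'x) preadd_cat_scheme \<Rightarrow> (('o, 'm) cplx, ('o, 'm) chmap) loc_arr \<Rightarrow>
     (('o, 'm) cplx, ('o, 'm) chmap) loc_arr" where
  "Db_shift_arr A = (\<lambda>(X, Y, P). (shift_cplx A X, shift_cplx A Y,
     {r. \<exists>p \<in> P. zz_eq (Cb A) (quasi_isos A) (shift_cplx A X) (shift_cplx A Y)
           (map (map_zstep (shift_chmap A)) p) r}))"

text \<open>A triangle is distinguished when it is isomorphic in the derived category to
  \<open>X \<rightarrow> Y \<rightarrow> cone f \<rightarrow> X[1]\<close> for some chain map \<open>f : X \<rightarrow> Y\<close>.\<close>

definition Db_triangles ::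
  "('o, 'm, 'x) preadd_cat_scheme \<Rightarrow>
     ((('o, 'm) cplx, ('o, 'm) chmap) loc_arr \<times> (('o, 'm) cplx, ('o, 'm) chmap) loc_arr \<times>
      (('o, 'm) cplx, ('o, 'm) chmap) loc_arr) set" where
  "Db_triangles A = (let D = Db_cat A in
     {(u, v, w). \<exists>X Y Z f a b c.
        u \<in> Hom D X Y \<and> v \<in> Hom D Y Z \<and> w \<in> Hom D Z (shift_cplx A X) \<and>
        f \<in> Arr (Cb A) \<and>
        a \<in> Hom D X (csrc f) \<and> b \<in> Hom D Y (ctgt f) \<and> c \<in> Hom D Z (cone A f) \<and>
        is_iso D a \<and> is_iso D b \<and> is_iso D c \<and>
        b \<cdot>\<^bsub>D\<^esub> u = Db_functor A f \<cdot>\<^bsub>D\<^esub> a \<and>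
        c \<cdot>\<^bsub>D\<^esub> v = Db_functor A (cone_in A f) \<cdot>\<^bsub>D\<^esub> b \<and>
        Db_shift_arr A a \<cdot>\<^bsub>D\<^esub> w = Db_functor A (cone_out A f) \<cdot>\<^bsub>D\<^esub> c})"

definition Db ::
  "('o, 'm, 'x) preadd_cat_scheme \<Rightarrow>
     (('o, 'm) cplx, (('o, 'm) cplx, ('o, 'm) chmap) loc_arr) tri_cat" where
  "Db A = cat.extend (Db_cat A)
     \<lparr>Sh_obj = shift_cplx A, Sh_arr = Db_shift_arr A, Tri = Db_triangles A\<rparr>"

end

theory Submission imports Defs begin

text \<open>
  Let \<open>X\<close> be a bounded complex over an abelian category, \<open>Z\<close> the complex of its cocycles and \<open>i : Z \<rightarrow> X\<close> the
  inclusion.  The differential of \<open>X\<close> takes values in \<open>Z\<close> and vanishes on \<open>Z\<close>, so both \<open>Z\<close> and the quotient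
  \<open>X/Z\<close> have zero differential.  A bounded complex with zero differential is a finite direct sum of shifts of
  objects of the abelian category, so it belongs to the closure \<open>gen\<close> of the stalks.  The triangle
  \<open>Z \<rightarrow> X \<rightarrow> X/Z \<rightarrow> Z[1]\<close> then exhibits \<open>X\<close> as an extension of two objects of \<open>gen\<close>, which is membership in the
  second level.

  In terms of mapping cones the triangle requires that \<open>X/Z\<close> be quasi-isomorphic to the cone of \<open>i\<close>; this is
  \<open>cone_to_coim_quasi_iso\<close>, where the cohomology of the cone is computed from an explicit kernel of its
  differential.  As the definition of quasi-isomorphism rests on chosen kernels and cokernels, \<open>coh_iso_at_iff\<close>
  first shows that any presentation of cohomology may be used.

  Direct sums in the derived category are coproducts of the localized category, with zigzags as arrows.  That
  the localization keeps the coproducts of complexes is \<open>localization_coproduct\<close>: for a class of arrows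
  containing identities and closed under coproducts, the bifunctor \<open>\<squnion>\<close> descends to zigzags, and an arrow \<open>h\<close> out of \<open>X \<squnion> Y\<close> is recovered from its
  restrictions as \<open>\<nabla> \<circ> (h j\<^sub>1 \<squnion> h j\<^sub>2)\<close> by naturality of the codiagonal.  The hypothesis on quasi-isomorphisms
  holds because kernels and cokernels are compatible with biproducts.

  If every object is a direct summand of a finite sum of copies of \<open>M\<close>, the closure \<open>gen\<close> of the single stalk of
  \<open>M\<close> already contains all stalks, as stalks preserve finite direct sums.  So the same argument, carried out in
  \<open>Db_eq_gen_level_2\<close> for any class whose closure contains the stalks, shows that this one object generates the
  derived category in two steps, and the dimension is at most one.
\<close>

section \<open>Categories and direct sums\<close>

context category
begin

declare Hom_def [simp] dom_obj [simp] cod_obj [simp]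

lemma comp_Arr [simp]:
  assumes "f \<in> Arr C" "g \<in> Arr C" "Cod C f = Dom C g"
  shows "g \<cdot> f \<in> Arr C" "Dom C (g \<cdot> f) = Dom C f" "Cod C (g \<cdot> f) = Cod C g"
  using comp_hom[of f "Dom C f" "Dom C g" g "Cod C g"] assms by auto

lemma assoc [simp]:
  assumes "f \<in> Arr C" "g \<in> Arr C" "h \<in> Arr C" "Cod C f = Dom C g" "Cod C g = Dom C h"
  shows "(h \<cdot> g) \<cdot> f = h \<cdot> (g \<cdot> f)"
  using comp_assoc[of f "Dom C f" "Dom C g" g "Dom C h" h "Cod C h"] assms by auto

lemma Ident_Arr [simp]:
  assumes "X \<in> Obj C"
  shows "Ident C X \<in> Arr C" "Dom C (Ident C X) = X" "Cod C (Ident C X) = X"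
  using ident_hom[OF assms] by auto

lemma comp_Ident [simp]:
  "f \<in> Arr C \<Longrightarrow> Dom C f = X \<Longrightarrow> f \<cdot> Ident C X = f"
  "f \<in> Arr C \<Longrightarrow> Cod C f = X \<Longrightarrow> Ident C X \<cdot> f = f"
  using comp_ident_right comp_ident_left by auto

text \<open>The simplifier normalises composites to the right, so a known value of \<open>g \<cdot> f\<close> no longer applies
  inside \<open>g \<cdot> (f \<cdot> x)\<close>; this rule restores it.\<close>

lemma comp_extend:
  assumes "g \<cdot> f = h" "f \<in> Arr C" "g \<in> Arr C" "x \<in> Arr C" "Cod C f = Dom C g" "Cod C x = Dom C f"
  shows "g \<cdot> (f \<cdot> x) = h \<cdot> x"
  using assms by (metis assoc)

lemma is_isoI:
  assumes "f \<in> Hom C X Y" "g \<in> Hom C Y X" "g \<cdot> f = Ident C X" "f \<cdot> g = Ident C Y"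
  shows "is_iso C f"
  unfolding is_iso_def using assms by auto

lemma is_isoE:
  assumes "is_iso C f" "f \<in> Hom C X Y"
  obtains g where "g \<in> Hom C Y X" "g \<cdot> f = Ident C X" "f \<cdot> g = Ident C Y"
  using assms unfolding is_iso_def by auto

lemma is_iso_comp:
  assumes "is_iso C f" "is_iso C g" "f \<in> Hom C X Y" "g \<in> Hom C Y Z"
  shows "is_iso C (g \<cdot> f)"
proof -
  obtain f' where f': "f' \<in> Hom C Y X" "f' \<cdot> f = Ident C X" "f \<cdot> f' = Ident C Y"
    using is_isoE[OF assms(1,3)] .
  obtain g' where g': "g' \<in> Hom C Z Y" "g' \<cdot> g = Ident C Y" "g \<cdot> g' = Ident C Z"
    using is_isoE[OF assms(2,4)] .
  show ?thesis
    by (rule is_isoI[where X = X and Y = Z and g = "f' \<cdot> g'"])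
       (use assms(3,4) f' g' comp_extend[OF g'(2)] comp_extend[OF f'(3)] dom_obj cod_obj in auto)
qed

lemma is_iso_Ident: "X \<in> Obj C \<Longrightarrow> is_iso C (Ident C X)"
  by (rule is_isoI[of _ X X "Ident C X"]) auto

end

definition isomorphic :: "('o, 'm, 'x) cat_scheme \<Rightarrow> 'o \<Rightarrow> 'o \<Rightarrow> bool" where
  "isomorphic C X Y \<longleftrightarrow> (\<exists>f \<in> Hom C X Y. is_iso C f)"

context category
begin

lemma isomorphicI:
  assumes "f \<in> Hom C X Y" "g \<in> Hom C Y X" "g \<cdot> f = Ident C X" "f \<cdot> g = Ident C Y"
  shows "isomorphic C X Y"
  unfolding isomorphic_def using assms is_isoI[OF assms] by blast

lemma isomorphic_sym: "isomorphic C X Y \<Longrightarrow> isomorphic C Y X"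
  unfolding isomorphic_def by (metis is_isoE is_isoI)

lemma isomorphic_trans: "isomorphic C X Y \<Longrightarrow> isomorphic C Y Z \<Longrightarrow> isomorphic C X Z"
  unfolding isomorphic_def by (metis is_iso_comp comp_hom)

lemma isomorphic_refl: "X \<in> Obj C \<Longrightarrow> isomorphic C X X"
  unfolding isomorphic_def using is_iso_Ident ident_hom by blast

text \<open>The universal property split into existence and joint epimorphy of the injections, which are easier
  to apply separately than the combined unique existence.\<close>

lemma direct_sumE:
  assumes "is_direct_sum C Xs S"
  obtains \<iota> where "\<And>k. k < length Xs \<Longrightarrow> \<iota> k \<in> Hom C (Xs ! k) S"
    and "\<And>T f. T \<in> Obj C \<Longrightarrow> (\<And>k. k < length Xs \<Longrightarrow> f k \<in> Hom C (Xs ! k) T) \<Longrightarrow>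
      \<exists>h \<in> Hom C S T. \<forall>k < length Xs. h \<cdot> \<iota> k = f k"
    and "\<And>T x y. x \<in> Hom C S T \<Longrightarrow> y \<in> Hom C S T \<Longrightarrow>
      (\<And>k. k < length Xs \<Longrightarrow> x \<cdot> \<iota> k = y \<cdot> \<iota> k) \<Longrightarrow> x = y"
proof -
  let ?n = "length Xs"
  obtain \<iota> where \<iota>: "\<forall>k < ?n. \<iota> k \<in> Hom C (Xs ! k) S"
    and u: "\<forall>T \<in> Obj C. \<forall>f. (\<forall>k < ?n. f k \<in> Hom C (Xs ! k) T) \<longrightarrow>
      (\<exists>!h. h \<in> Hom C S T \<and> (\<forall>k < ?n. h \<cdot> \<iota> k = f k))"
    using assms unfolding is_direct_sum_def by (elim conjE exE)
  show thesis
  proof (rule that[of \<iota>])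
    show "\<iota> k \<in> Hom C (Xs ! k) S" if "k < ?n" for k using \<iota> that by blast
    show "\<exists>h \<in> Hom C S T. \<forall>k < ?n. h \<cdot> \<iota> k = f k"
      if T: "T \<in> Obj C" and f: "\<And>k. k < ?n \<Longrightarrow> f k \<in> Hom C (Xs ! k) T" for T f
    proof -
      have "\<exists>!h. h \<in> Hom C S T \<and> (\<forall>k < ?n. h \<cdot> \<iota> k = f k)"
        using u T f by (elim ballE allE[of _ f]) blast+
      then show ?thesis by blast
    qed
    show "x = y" if x: "x \<in> Hom C S T" and y: "y \<in> Hom C S T"
      and e: "\<And>k. k < ?n \<Longrightarrow> x \<cdot> \<iota> k = y \<cdot> \<iota> k" for T x y
    proof -
      have T: "T \<in> Obj C" using x by auto
      have "\<forall>k < ?n. y \<cdot> \<iota> k \<in> Hom C (Xs ! k) T" using \<iota> by (intro allI impI comp_hom[OF _ y]) simp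
      then have "\<exists>!h. h \<in> Hom C S T \<and> (\<forall>k < ?n. h \<cdot> \<iota> k = y \<cdot> \<iota> k)"
        using u T by (elim ballE allE[of _ "\<lambda>k. y \<cdot> \<iota> k"]) blast+
      moreover have "x \<in> Hom C S T \<and> (\<forall>k < ?n. x \<cdot> \<iota> k = y \<cdot> \<iota> k)" using x e by blast
      moreover have "y \<in> Hom C S T \<and> (\<forall>k < ?n. y \<cdot> \<iota> k = y \<cdot> \<iota> k)" using y by blast
      ultimately show ?thesis by blast
    qed
  qed
qed

lemma direct_sum_unique:
  assumes S: "is_direct_sum C Xs S" and S': "is_direct_sum C Xs S'"
  shows "isomorphic C S S'"
proof -
  have o: "S \<in> Obj C" "S' \<in> Obj C" using S S' by (auto simp: is_direct_sum_def simp del: Hom_def)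
  obtain \<iota> where \<iota>: "\<And>k. k < length Xs \<Longrightarrow> \<iota> k \<in> Hom C (Xs ! k) S"
    and ex: "\<And>T f. T \<in> Obj C \<Longrightarrow> (\<And>k. k < length Xs \<Longrightarrow> f k \<in> Hom C (Xs ! k) T) \<Longrightarrow>
      \<exists>h \<in> Hom C S T. \<forall>k < length Xs. h \<cdot> \<iota> k = f k"
    and un: "\<And>T x y. x \<in> Hom C S T \<Longrightarrow> y \<in> Hom C S T \<Longrightarrow>
      (\<And>k. k < length Xs \<Longrightarrow> x \<cdot> \<iota> k = y \<cdot> \<iota> k) \<Longrightarrow> x = y"
    by (rule direct_sumE[OF S]) blast
  obtain \<iota>' where \<iota>': "\<And>k. k < length Xs \<Longrightarrow> \<iota>' k \<in> Hom C (Xs ! k) S'"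
    and ex': "\<And>T f. T \<in> Obj C \<Longrightarrow> (\<And>k. k < length Xs \<Longrightarrow> f k \<in> Hom C (Xs ! k) T) \<Longrightarrow>
      \<exists>h \<in> Hom C S' T. \<forall>k < length Xs. h \<cdot> \<iota>' k = f k"
    and un': "\<And>T x y. x \<in> Hom C S' T \<Longrightarrow> y \<in> Hom C S' T \<Longrightarrow>
      (\<And>k. k < length Xs \<Longrightarrow> x \<cdot> \<iota>' k = y \<cdot> \<iota>' k) \<Longrightarrow> x = y"
    by (rule direct_sumE[OF S']) blast
  obtain h where h: "h \<in> Hom C S S'" "\<forall>k < length Xs. h \<cdot> \<iota> k = \<iota>' k"
    using ex[OF o(2), of \<iota>'] \<iota>' by blast
  obtain h' where h': "h' \<in> Hom C S' S" "\<forall>k < length Xs. h' \<cdot> \<iota>' k = \<iota> k"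
    using ex'[OF o(1), of \<iota>] \<iota> by blast
  have "h' \<cdot> h = Ident C S"
  proof (rule un[OF comp_hom[OF h(1) h'(1)] ident_hom[OF o(1)]])
    show "(h' \<cdot> h) \<cdot> \<iota> k = Ident C S \<cdot> \<iota> k" if "k < length Xs" for k
      using h h' \<iota>[OF that] that by simp
  qed
  moreover have "h \<cdot> h' = Ident C S'"
  proof (rule un'[OF comp_hom[OF h'(1) h(1)] ident_hom[OF o(2)]])
    show "(h \<cdot> h') \<cdot> \<iota>' k = Ident C S' \<cdot> \<iota>' k" if "k < length Xs" for k
      using h h' \<iota>'[OF that] that by simp
  qed
  ultimately show ?thesis by (rule isomorphicI[OF h(1) h'(1)])
qed

lemma direct_sum_single:
  assumes "isomorphic C X Y"
  shows "is_direct_sum C [X] Y"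
proof -
  obtain f where f: "f \<in> Hom C X Y" "is_iso C f" using assms by (auto simp: isomorphic_def)
  then obtain g where g: "g \<in> Hom C Y X" "g \<cdot> f = Ident C X" "f \<cdot> g = Ident C Y" using is_isoE by metis
  have o: "X \<in> Obj C" "Y \<in> Obj C" using f by auto
  have ex: "\<exists>!h. h \<in> Hom C Y T \<and> h \<cdot> f = t" if "t \<in> Hom C X T" for t T
  proof (rule ex1I[of _ "t \<cdot> g"])
    show "t \<cdot> g \<in> Hom C Y T \<and> (t \<cdot> g) \<cdot> f = t" using f g that by simp
    show "h = t \<cdot> g" if "h \<in> Hom C Y T \<and> h \<cdot> f = t" for h
      using that f g assoc[of g f h] by auto
  qed
  then have "\<exists>!h. h \<in> Hom C Y T \<and> (\<forall>k < length [X]. h \<cdot> f = t k)"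
    if "\<forall>k < length [X]. t k \<in> Hom C ([X] ! k) T" for t T
    using that ex[of "t 0" T] by (simp del: Hom_def)
  then show ?thesis unfolding is_direct_sum_def using f(1) o
    by (intro conjI exI[of _ "\<lambda>k. f"] ballI allI impI) (simp_all del: Hom_def)
qed

end

section \<open>Arithmetic of morphisms in an abelian category\<close>

context abelian_category
begin

lemma hplus_Arr [simp]:
  assumes "f \<in> Arr A" "g \<in> Arr A" "Dom A f = Dom A g" "Cod A f = Cod A g"
  shows "f \<oplus>\<^sub>h g \<in> Arr A" "Dom A (f \<oplus>\<^sub>h g) = Dom A g" "Cod A (f \<oplus>\<^sub>h g) = Cod A g"
proof -
  interpret G: comm_group "hom_group A (Dom A g) (Cod A g)" using assms by (auto intro: hom_comm_group)
  show "f \<oplus>\<^sub>h g \<in> Arr A" "Dom A (f \<oplus>\<^sub>h g) = Dom A g" "Cod A (f \<oplus>\<^sub>h g) = Cod A g"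
    using G.m_closed[of f g] assms by (auto simp: hom_group_def)
qed

lemma hzero_Arr [simp]:
  assumes "X \<in> Obj A" "Y \<in> Obj A"
  shows "HZero A X Y \<in> Arr A" "Dom A (HZero A X Y) = X" "Cod A (HZero A X Y) = Y"
proof -
  interpret G: comm_group "hom_group A X Y" using assms by (auto intro: hom_comm_group)
  show "HZero A X Y \<in> Arr A" "Dom A (HZero A X Y) = X" "Cod A (HZero A X Y) = Y"
    using G.one_closed assms by (auto simp: hom_group_def)
qed

lemma hneg_Arr [simp]:
  assumes "f \<in> Arr A"
  shows "hneg A f \<in> Arr A" "Dom A (hneg A f) = Dom A f" "Cod A (hneg A f) = Cod A f"
proof -
  interpret G: comm_group "hom_group A (Dom A f) (Cod A f)" using assms by (auto intro: hom_comm_group)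
  have "hneg A f \<in> carrier (hom_group A (Dom A f) (Cod A f))"
    unfolding hneg_def using assms by (intro G.inv_closed) (auto simp: hom_group_def)
  then show "hneg A f \<in> Arr A" "Dom A (hneg A f) = Dom A f" "Cod A (hneg A f) = Cod A f"
    by (auto simp: hom_group_def)
qed

lemma hplus_assoc [simp]:
  assumes "f \<in> Arr A" "g \<in> Arr A" "h \<in> Arr A" "Dom A f = Dom A g" "Cod A f = Cod A g"
    "Dom A g = Dom A h" "Cod A g = Cod A h"
  shows "(f \<oplus>\<^sub>h g) \<oplus>\<^sub>h h = f \<oplus>\<^sub>h (g \<oplus>\<^sub>h h)"
proof -
  interpret G: comm_group "hom_group A (Dom A h) (Cod A h)" using assms by (auto intro: hom_comm_group)
  show ?thesis using G.m_assoc[of f g h] assms by (auto simp: hom_group_def)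
qed

lemma hplus_commute:
  assumes "f \<in> Arr A" "g \<in> Arr A" "Dom A f = Dom A g" "Cod A f = Cod A g"
  shows "f \<oplus>\<^sub>h g = g \<oplus>\<^sub>h f"
proof -
  interpret G: comm_group "hom_group A (Dom A g) (Cod A g)" using assms by (auto intro: hom_comm_group)
  show ?thesis using G.m_comm[of f g] assms by (auto simp: hom_group_def)
qed

text \<open>Stated with the domain and codomain as side conditions, so that it applies to a zero morphism whose
  indices are written differently from those of \<open>f\<close>.\<close>

lemma hplus_zero [simp]:
  assumes "f \<in> Arr A" "Dom A f = X" "Cod A f = Y"
  shows "f \<oplus>\<^sub>h HZero A X Y = f" "HZero A X Y \<oplus>\<^sub>h f = f"
proof -
  interpret G: comm_group "hom_group A X Y" using assms by (auto intro: hom_comm_group)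
  show "f \<oplus>\<^sub>h HZero A X Y = f" "HZero A X Y \<oplus>\<^sub>h f = f"
    using G.r_one[of f] G.l_one[of f] assms by (auto simp: hom_group_def)
qed

lemma hplus_neg [simp]:
  assumes "f \<in> Arr A"
  shows "f \<oplus>\<^sub>h hneg A f = HZero A (Dom A f) (Cod A f)" "hneg A f \<oplus>\<^sub>h f = HZero A (Dom A f) (Cod A f)"
proof -
  interpret G: comm_group "hom_group A (Dom A f) (Cod A f)" using assms by (auto intro: hom_comm_group)
  show "f \<oplus>\<^sub>h hneg A f = HZero A (Dom A f) (Cod A f)" "hneg A f \<oplus>\<^sub>h f = HZero A (Dom A f) (Cod A f)"
    using G.r_inv[of f] G.l_inv[of f] assms by (auto simp: hom_group_def hneg_def)
qed

lemma hplus_cancel_left: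
  assumes "f \<oplus>\<^sub>h g = f \<oplus>\<^sub>h h" "f \<in> Arr A" "g \<in> Arr A" "h \<in> Arr A"
    "Dom A f = Dom A g" "Cod A f = Cod A g" "Dom A h = Dom A g" "Cod A h = Cod A g"
  shows "g = h"
proof -
  interpret G: comm_group "hom_group A (Dom A g) (Cod A g)" using assms by (auto intro: hom_comm_group)
  show ?thesis using G.Units_l_cancel[of f g h] G.Units_eq assms by (auto simp: hom_group_def)
qed

lemma eq_hneg_iff:
  assumes "f \<in> Arr A" "g \<in> Arr A" "Dom A f = Dom A g" "Cod A f = Cod A g"
  shows "f = hneg A g \<longleftrightarrow> f \<oplus>\<^sub>h g = HZero A (Dom A g) (Cod A g)"
proof -
  have *: "f \<oplus>\<^sub>h g = g \<oplus>\<^sub>h f" using assms by (intro hplus_commute) auto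
  show ?thesis
  proof
    assume "f \<oplus>\<^sub>h g = HZero A (Dom A g) (Cod A g)"
    then have "g \<oplus>\<^sub>h f = g \<oplus>\<^sub>h hneg A g" using * assms(2) by simp
    then show "f = hneg A g" by (rule hplus_cancel_left) (use assms in auto)
  next
    assume "f = hneg A g"
    then show "f \<oplus>\<^sub>h g = HZero A (Dom A g) (Cod A g)" using assms(2) by simp
  qed
qed

lemma comp_hplus [simp]:
  assumes "f \<in> Arr A" "g \<in> Arr A" "h \<in> Arr A"
  shows "\<lbrakk>Cod A f = Dom A g; Dom A g = Dom A h; Cod A g = Cod A h\<rbrakk> \<Longrightarrow> (g \<oplus>\<^sub>h h) \<cdot> f = (g \<cdot> f) \<oplus>\<^sub>h (h \<cdot> f)"
    "\<lbrakk>Cod A f = Dom A h; Dom A f = Dom A g; Cod A f = Cod A g\<rbrakk> \<Longrightarrow> h \<cdot> (f \<oplus>\<^sub>h g) = (h \<cdot> f) \<oplus>\<^sub>h (h \<cdot> g)"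
  using comp_add_left[of f "Dom A f" "Dom A g" g "Cod A g" h]
    comp_add_right[of f "Dom A f" "Cod A f" g h "Cod A h"] assms by auto

lemma comp_zero [simp]:
  assumes "f \<in> Arr A" "Z \<in> Obj A"
  shows "Cod A f = Y \<Longrightarrow> HZero A Y Z \<cdot> f = HZero A (Dom A f) Z"
    "Dom A f = Y \<Longrightarrow> f \<cdot> HZero A Z Y = HZero A Z (Cod A f)"
proof -
  assume f: "Cod A f = Y"
  have Y: "Y \<in> Obj A" using assms f cod_obj[of f] by simp
  have "(HZero A Y Z \<cdot> f) \<oplus>\<^sub>h (HZero A Y Z \<cdot> f) = (HZero A Y Z \<oplus>\<^sub>h HZero A Y Z) \<cdot> f"
    using assms Y f by (simp del: hplus_zero)
  also have "\<dots> = (HZero A Y Z \<cdot> f) \<oplus>\<^sub>h HZero A (Dom A f) Z" using assms Y f by simp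
  finally show "HZero A Y Z \<cdot> f = HZero A (Dom A f) Z"
    by (rule hplus_cancel_left) (use assms Y f in auto)
next
  assume f: "Dom A f = Y"
  have Y: "Y \<in> Obj A" using assms f dom_obj[of f] by simp
  have "(f \<cdot> HZero A Z Y) \<oplus>\<^sub>h (f \<cdot> HZero A Z Y) = f \<cdot> (HZero A Z Y \<oplus>\<^sub>h HZero A Z Y)"
    using assms Y f by (simp del: hplus_zero)
  also have "\<dots> = (f \<cdot> HZero A Z Y) \<oplus>\<^sub>h HZero A Z (Cod A f)" using assms Y f by simp
  finally show "f \<cdot> HZero A Z Y = HZero A Z (Cod A f)"
    by (rule hplus_cancel_left) (use assms Y f in auto)
qed

lemma comp_hneg [simp]:
  assumes "f \<in> Arr A" "g \<in> Arr A" "Cod A f = Dom A g"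
  shows "hneg A g \<cdot> f = hneg A (g \<cdot> f)" "g \<cdot> hneg A f = hneg A (g \<cdot> f)"
  using assms comp_hplus(1)[of f "hneg A g" g] comp_hplus(2)[of "hneg A f" f g]
  by (simp_all add: eq_hneg_iff del: comp_hplus)

lemma hneg_hneg [simp]: "f \<in> Arr A \<Longrightarrow> hneg A (hneg A f) = f"
  using eq_hneg_iff[of f "hneg A f"] by simp

lemma hneg_zero [simp]: "X \<in> Obj A \<Longrightarrow> Y \<in> Obj A \<Longrightarrow> hneg A (HZero A X Y) = HZero A X Y"
  using eq_hneg_iff[of "HZero A X Y" "HZero A X Y"] by simp

lemma hneg_eq_zero_iff [simp]:
  assumes "f \<in> Arr A" "Dom A f = X" "Cod A f = Y"
  shows "hneg A f = HZero A X Y \<longleftrightarrow> f = HZero A X Y"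
  using assms by (metis hneg_hneg hneg_zero dom_obj cod_obj)

lemma zero_obj [simp]: "is_zero_obj A (zero_obj A)" "zero_obj A \<in> Obj A"
proof -
  show "is_zero_obj A (zero_obj A)"
    unfolding zero_obj_def using zero_obj_exists by (rule someI_ex)
  then show "zero_obj A \<in> Obj A" by (simp add: is_zero_obj_def)
qed

lemma zero_obj_iff: "is_zero_obj A Z \<longleftrightarrow> Z \<in> Obj A \<and> Ident A Z = HZero A Z Z"
proof
  assume Z: "is_zero_obj A Z"
  then have "Z \<in> Obj A" "\<exists>!f. f \<in> Hom A Z Z" by (auto simp: is_zero_obj_def simp del: Hom_def)
  moreover from this have "Ident A Z \<in> Hom A Z Z" "HZero A Z Z \<in> Hom A Z Z" by auto
  ultimately show "Z \<in> Obj A \<and> Ident A Z = HZero A Z Z" by blast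
next
  assume Z: "Z \<in> Obj A \<and> Ident A Z = HZero A Z Z"
  have "f = HZero A X Z" if "f \<in> Hom A X Z" for f X
    using Z that comp_Ident(2)[of f Z] comp_zero(1)[of f Z Z] by auto
  moreover have "f = HZero A Z X" if "f \<in> Hom A Z X" for f X
    using Z that comp_Ident(1)[of f Z] comp_zero(2)[of f Z Z] by auto
  moreover have "HZero A X Z \<in> Hom A X Z" "HZero A Z X \<in> Hom A Z X" if "X \<in> Obj A" for X
    using Z that by auto
  ultimately show "is_zero_obj A Z"
    unfolding is_zero_obj_def using Z by blast
qed

lemma zero_obj_Arr:
  assumes "f \<in> Arr A" "is_zero_obj A (Dom A f) \<or> is_zero_obj A (Cod A f)"
  shows "f = HZero A (Dom A f) (Cod A f)"
  using assms comp_Ident[of f] comp_zero(1)[of f "Cod A f"] comp_zero(2)[of f "Dom A f"]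
  by (metis zero_obj_iff)

lemma biprod_props:
  assumes "X \<in> Obj A" "Y \<in> Obj A"
  shows "is_biproduct A X Y (bsum A X Y, binj1 A X Y, binj2 A X Y, bproj1 A X Y, bproj2 A X Y)"
proof -
  have "is_biproduct A X Y (biprod A X Y)"
    unfolding biprod_def using biproduct_exists[OF assms] by (rule someI_ex)
  then show ?thesis
    unfolding bsum_def binj1_def binj2_def bproj1_def bproj2_def by (auto split: prod.splits)
qed

lemma bsum_simps [simp]:
  assumes "X \<in> Obj A" "Y \<in> Obj A"
  shows "bsum A X Y \<in> Obj A"
    "binj1 A X Y \<in> Arr A" "Dom A (binj1 A X Y) = X" "Cod A (binj1 A X Y) = bsum A X Y"
    "binj2 A X Y \<in> Arr A" "Dom A (binj2 A X Y) = Y" "Cod A (binj2 A X Y) = bsum A X Y"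
    "bproj1 A X Y \<in> Arr A" "Dom A (bproj1 A X Y) = bsum A X Y" "Cod A (bproj1 A X Y) = X"
    "bproj2 A X Y \<in> Arr A" "Dom A (bproj2 A X Y) = bsum A X Y" "Cod A (bproj2 A X Y) = Y"
    "bproj1 A X Y \<cdot> binj1 A X Y = Ident A X" "bproj2 A X Y \<cdot> binj2 A X Y = Ident A Y"
    "bproj1 A X Y \<cdot> binj2 A X Y = HZero A Y X" "bproj2 A X Y \<cdot> binj1 A X Y = HZero A X Y"
  using biprod_props[OF assms] by (auto simp: is_biproduct_def)

lemma bsum_reduce [simp]:
  assumes "X \<in> Obj A" "Y \<in> Obj A" "f \<in> Arr A"
  shows "Cod A f = X \<Longrightarrow> bproj1 A X Y \<cdot> binj1 A X Y \<cdot> f = f"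
    "Cod A f = Y \<Longrightarrow> bproj2 A X Y \<cdot> binj2 A X Y \<cdot> f = f"
    "Cod A f = Y \<Longrightarrow> bproj1 A X Y \<cdot> binj2 A X Y \<cdot> f = HZero A (Dom A f) X"
    "Cod A f = X \<Longrightarrow> bproj2 A X Y \<cdot> binj1 A X Y \<cdot> f = HZero A (Dom A f) Y"
  using assms assoc[of f "binj1 A X Y" "bproj1 A X Y", symmetric]
    assoc[of f "binj2 A X Y" "bproj2 A X Y", symmetric]
    assoc[of f "binj1 A X Y" "bproj2 A X Y", symmetric]
    assoc[of f "binj2 A X Y" "bproj1 A X Y", symmetric]
  by (simp_all del: assoc)

lemma bsum_ident [simp]:
  assumes "X \<in> Obj A" "Y \<in> Obj A"
  shows "(binj1 A X Y \<cdot> bproj1 A X Y) \<oplus>\<^sub>h (binj2 A X Y \<cdot> bproj2 A X Y) = Ident A (bsum A X Y)"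
  using biprod_props[OF assms] by (auto simp: is_biproduct_def)

lemma bsum_ext:
  assumes "X \<in> Obj A" "Y \<in> Obj A" "f \<in> Arr A" "g \<in> Arr A" "Cod A f = bsum A X Y" "Cod A g = bsum A X Y"
    "bproj1 A X Y \<cdot> f = bproj1 A X Y \<cdot> g" "bproj2 A X Y \<cdot> f = bproj2 A X Y \<cdot> g"
  shows "f = g"
proof -
  have "f = ((binj1 A X Y \<cdot> bproj1 A X Y) \<oplus>\<^sub>h (binj2 A X Y \<cdot> bproj2 A X Y)) \<cdot> f"
    using assms by (simp del: comp_hplus)
  also have "\<dots> = ((binj1 A X Y \<cdot> bproj1 A X Y) \<oplus>\<^sub>h (binj2 A X Y \<cdot> bproj2 A X Y)) \<cdot> g"
    using assms by (simp del: bsum_ident)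
  also have "\<dots> = g" using assms by (simp del: comp_hplus)
  finally show ?thesis .
qed

lemma bsum_coext:
  assumes "X \<in> Obj A" "Y \<in> Obj A" "f \<in> Arr A" "g \<in> Arr A" "Dom A f = bsum A X Y" "Dom A g = bsum A X Y"
    "f \<cdot> binj1 A X Y = g \<cdot> binj1 A X Y" "f \<cdot> binj2 A X Y = g \<cdot> binj2 A X Y"
  shows "f = g"
proof -
  have *: "h = ((h \<cdot> binj1 A X Y) \<cdot> bproj1 A X Y) \<oplus>\<^sub>h ((h \<cdot> binj2 A X Y) \<cdot> bproj2 A X Y)"
    if "h \<in> Arr A" "Dom A h = bsum A X Y" for h
  proof -
    have "h = h \<cdot> ((binj1 A X Y \<cdot> bproj1 A X Y) \<oplus>\<^sub>h (binj2 A X Y \<cdot> bproj2 A X Y))"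
      using assms(1,2) that by (simp del: comp_hplus)
    then show ?thesis using assms(1,2) that by (simp del: bsum_ident)
  qed
  show ?thesis using *[of f] *[of g] assms by metis
qed

lemma is_zero_bsum:
  assumes "is_zero_obj A X" "is_zero_obj A Y"
  shows "is_zero_obj A (bsum A X Y)"
proof -
  have [simp]: "X \<in> Obj A" "Y \<in> Obj A" using assms by (auto simp: zero_obj_iff)
  have "Ident A (bsum A X Y) = HZero A (bsum A X Y) (bsum A X Y)"
    by (rule bsum_ext[of X Y])
       (use assms zero_obj_Arr[of "bproj1 A X Y"] zero_obj_Arr[of "bproj2 A X Y"] in auto)
  then show ?thesis by (simp add: zero_obj_iff)
qed

section \<open>Kernels, cokernels and biproducts in abelian categories\<close>

lemma kernelD:
  assumes "is_kernel A f k"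
  shows "f \<in> Arr A" "k \<in> Arr A" "Cod A k = Dom A f" "f \<cdot> k = HZero A (Dom A k) (Cod A f)"
  using assms by (auto simp: is_kernel_def)

lemma kernel_lift:
  assumes "is_kernel A f k" "g \<in> Arr A" "Cod A g = Dom A f" "f \<cdot> g = HZero A (Dom A g) (Cod A f)"
  obtains h where "h \<in> Arr A" "Dom A h = Dom A g" "Cod A h = Dom A k" "k \<cdot> h = g"
proof -
  have "\<exists>!h. h \<in> Hom A (Dom A g) (Dom A k) \<and> k \<cdot> h = g"
    using assms dom_obj[OF assms(2)] unfolding is_kernel_def by simp
  then show thesis using that by auto
qed

lemma kernel_mono:
  assumes "is_kernel A f k" "k \<cdot> h = k \<cdot> h'" "h \<in> Arr A" "h' \<in> Arr A" "Cod A h = Dom A k" "Cod A h' = Dom A k"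
    "Dom A h = Dom A h'"
  shows "h = h'"
proof -
  note k = kernelD[OF assms(1)]
  have "f \<cdot> (k \<cdot> h') = HZero A (Dom A h') (Cod A f)"
    using comp_extend[OF k(4)] k assms by auto
  then have "\<exists>!x. x \<in> Hom A (Dom A h') (Dom A k) \<and> k \<cdot> x = k \<cdot> h'"
    using assms(1) k assms(2-) unfolding is_kernel_def by auto
  then show ?thesis using assms(2-) by auto
qed

lemma kernelI:
  assumes "f \<in> Arr A" "k \<in> Arr A" "Cod A k = Dom A f" "f \<cdot> k = HZero A (Dom A k) (Cod A f)"
    and "\<And>g. \<lbrakk>g \<in> Arr A; Cod A g = Dom A f; f \<cdot> g = HZero A (Dom A g) (Cod A f)\<rbrakk> \<Longrightarrow>
        \<exists>h. h \<in> Arr A \<and> Dom A h = Dom A g \<and> Cod A h = Dom A k \<and> k \<cdot> h = g"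
    and "\<And>h h'. \<lbrakk>k \<cdot> h = k \<cdot> h'; h \<in> Arr A; h' \<in> Arr A; Cod A h = Dom A k; Cod A h' = Dom A k;
        Dom A h = Dom A h'\<rbrakk> \<Longrightarrow> h = h'"
  shows "is_kernel A f k"
  unfolding is_kernel_def
proof (intro conjI ballI impI)
  fix T g assume "T \<in> Obj A" and "g \<in> Hom A T (Dom A f)" and 0: "f \<cdot> g = HZero A T (Cod A f)"
  then have g: "g \<in> Arr A" "Dom A g = T" "Cod A g = Dom A f" by simp_all
  obtain h where h: "h \<in> Arr A" "Dom A h = Dom A g" "Cod A h = Dom A k" "k \<cdot> h = g"
    using assms(5)[OF g(1,3)] 0 g(2) by blast
  show "\<exists>!h. h \<in> Hom A T (Dom A k) \<and> k \<cdot> h = g"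
  proof (rule ex1I[of _ h])
    show "h' = h" if "h' \<in> Hom A T (Dom A k) \<and> k \<cdot> h' = g" for h'
      by (rule assms(6)) (use that h g in simp_all)
  qed (use h g in simp)
qed (rule assms)+

lemma cokernelD:
  assumes "is_cokernel A f q"
  shows "f \<in> Arr A" "q \<in> Arr A" "Dom A q = Cod A f" "q \<cdot> f = HZero A (Dom A f) (Cod A q)"
  using assms by (auto simp: is_cokernel_def)

lemma cokernel_desc:
  assumes "is_cokernel A f q" "g \<in> Arr A" "Dom A g = Cod A f" "g \<cdot> f = HZero A (Dom A f) (Cod A g)"
  obtains h where "h \<in> Arr A" "Dom A h = Cod A q" "Cod A h = Cod A g" "h \<cdot> q = g"
proof -
  have "\<exists>!h. h \<in> Hom A (Cod A q) (Cod A g) \<and> h \<cdot> q = g"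
    using assms cod_obj[OF assms(2)] unfolding is_cokernel_def by simp
  then show thesis using that by auto
qed

lemma cokernel_epi:
  assumes "is_cokernel A f q" "h \<cdot> q = h' \<cdot> q" "h \<in> Arr A" "h' \<in> Arr A" "Dom A h = Cod A q" "Dom A h' = Cod A q"
    "Cod A h = Cod A h'"
  shows "h = h'"
proof -
  note q = cokernelD[OF assms(1)]
  have "(h' \<cdot> q) \<cdot> f = HZero A (Dom A f) (Cod A h')"
    using q assms by auto
  then have "\<exists>!x. x \<in> Hom A (Cod A q) (Cod A h') \<and> x \<cdot> q = h' \<cdot> q"
    using assms(1) q assms(2-) unfolding is_cokernel_def by (auto simp del: assoc)
  then show ?thesis using assms(2-) by auto
qed

lemma cokernelI:
  assumes "f \<in> Arr A" "q \<in> Arr A" "Dom A q = Cod A f" "q \<cdot> f = HZero A (Dom A f) (Cod A q)"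
    and "\<And>g. \<lbrakk>g \<in> Arr A; Dom A g = Cod A f; g \<cdot> f = HZero A (Dom A f) (Cod A g)\<rbrakk> \<Longrightarrow>
        \<exists>h. h \<in> Arr A \<and> Dom A h = Cod A q \<and> Cod A h = Cod A g \<and> h \<cdot> q = g"
    and "\<And>h h'. \<lbrakk>h \<cdot> q = h' \<cdot> q; h \<in> Arr A; h' \<in> Arr A; Dom A h = Cod A q; Dom A h' = Cod A q;
        Cod A h = Cod A h'\<rbrakk> \<Longrightarrow> h = h'"
  shows "is_cokernel A f q"
  unfolding is_cokernel_def
proof (intro conjI ballI impI)
  fix T g assume "T \<in> Obj A" and "g \<in> Hom A (Cod A f) T" and 0: "g \<cdot> f = HZero A (Dom A f) T"
  then have g: "g \<in> Arr A" "Cod A g = T" "Dom A g = Cod A f" by simp_all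
  obtain h where h: "h \<in> Arr A" "Dom A h = Cod A q" "Cod A h = Cod A g" "h \<cdot> q = g"
    using assms(5)[OF g(1,3)] 0 g(2) by blast
  show "\<exists>!h. h \<in> Hom A (Cod A q) T \<and> h \<cdot> q = g"
  proof (rule ex1I[of _ h])
    show "h' = h" if "h' \<in> Hom A (Cod A q) T \<and> h' \<cdot> q = g" for h'
      by (rule assms(6)) (use that h g in simp_all)
  qed (use h g in simp)
qed (rule assms)+

lemma kernel_zero_Ident: "X \<in> Obj A \<Longrightarrow> Y \<in> Obj A \<Longrightarrow> is_kernel A (HZero A X Y) (Ident A X)"
  by (rule kernelI) auto

lemma cokernel_zero_Ident: "X \<in> Obj A \<Longrightarrow> Y \<in> Obj A \<Longrightarrow> is_cokernel A (HZero A X Y) (Ident A Y)"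
  by (rule cokernelI) auto

lemma kernel_hneg: "is_kernel A f k \<Longrightarrow> is_kernel A (hneg A f) k"
  unfolding is_kernel_def by auto

lemma cokernel_hneg: "is_cokernel A f q \<Longrightarrow> is_cokernel A (hneg A f) q"
  unfolding is_cokernel_def by auto

text \<open>The matrix \<open>diag(f, g)\<close>, that is, the biproduct functor on arrows.\<close>

definition bmap :: "'m \<Rightarrow> 'm \<Rightarrow> 'm" where
  "bmap f g = (binj1 A (Cod A f) (Cod A g) \<cdot> f \<cdot> bproj1 A (Dom A f) (Dom A g)) \<oplus>\<^sub>h
     (binj2 A (Cod A f) (Cod A g) \<cdot> g \<cdot> bproj2 A (Dom A f) (Dom A g))"

lemma bmap_simps [simp]:
  assumes "f \<in> Arr A" "g \<in> Arr A"
  shows "bmap f g \<in> Arr A" "Dom A (bmap f g) = bsum A (Dom A f) (Dom A g)"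
    "Cod A (bmap f g) = bsum A (Cod A f) (Cod A g)"
    "Cod A f = X \<Longrightarrow> Cod A g = Y \<Longrightarrow> bproj1 A X Y \<cdot> bmap f g = f \<cdot> bproj1 A (Dom A f) (Dom A g)"
    "Cod A f = X \<Longrightarrow> Cod A g = Y \<Longrightarrow> bproj2 A X Y \<cdot> bmap f g = g \<cdot> bproj2 A (Dom A f) (Dom A g)"
    "Dom A f = X \<Longrightarrow> Dom A g = Y \<Longrightarrow> bmap f g \<cdot> binj1 A X Y = binj1 A (Cod A f) (Cod A g) \<cdot> f"
    "Dom A f = X \<Longrightarrow> Dom A g = Y \<Longrightarrow> bmap f g \<cdot> binj2 A X Y = binj2 A (Cod A f) (Cod A g) \<cdot> g"
proof -
  have o: "Dom A f \<in> Obj A" "Dom A g \<in> Obj A" "Cod A f \<in> Obj A" "Cod A g \<in> Obj A" using assms by auto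
  note r = bsum_reduce[OF o(1,2)] bsum_reduce[OF o(3,4)]
  show "bmap f g \<in> Arr A" "Dom A (bmap f g) = bsum A (Dom A f) (Dom A g)"
    "Cod A (bmap f g) = bsum A (Cod A f) (Cod A g)"
    unfolding bmap_def using assms by auto
  show "Cod A f = X \<Longrightarrow> Cod A g = Y \<Longrightarrow> bproj1 A X Y \<cdot> bmap f g = f \<cdot> bproj1 A (Dom A f) (Dom A g)"
    "Cod A f = X \<Longrightarrow> Cod A g = Y \<Longrightarrow> bproj2 A X Y \<cdot> bmap f g = g \<cdot> bproj2 A (Dom A f) (Dom A g)"
    "Dom A f = X \<Longrightarrow> Dom A g = Y \<Longrightarrow> bmap f g \<cdot> binj1 A X Y = binj1 A (Cod A f) (Cod A g) \<cdot> f"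
    "Dom A f = X \<Longrightarrow> Dom A g = Y \<Longrightarrow> bmap f g \<cdot> binj2 A X Y = binj2 A (Cod A f) (Cod A g) \<cdot> g"
    unfolding bmap_def using assms o by auto
qed

lemma bmap_reduce [simp]:
  assumes "f \<in> Arr A" "g \<in> Arr A" "x \<in> Arr A"
  shows "Cod A f = X \<Longrightarrow> Cod A g = Y \<Longrightarrow> Cod A x = bsum A (Dom A f) (Dom A g) \<Longrightarrow>
      bproj1 A X Y \<cdot> bmap f g \<cdot> x = f \<cdot> bproj1 A (Dom A f) (Dom A g) \<cdot> x"
    "Cod A f = X \<Longrightarrow> Cod A g = Y \<Longrightarrow> Cod A x = bsum A (Dom A f) (Dom A g) \<Longrightarrow>
      bproj2 A X Y \<cdot> bmap f g \<cdot> x = g \<cdot> bproj2 A (Dom A f) (Dom A g) \<cdot> x"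
    "Dom A f = X \<Longrightarrow> Dom A g = Y \<Longrightarrow> Cod A x = X \<Longrightarrow>
      bmap f g \<cdot> binj1 A X Y \<cdot> x = binj1 A (Cod A f) (Cod A g) \<cdot> f \<cdot> x"
    "Dom A f = X \<Longrightarrow> Dom A g = Y \<Longrightarrow> Cod A x = Y \<Longrightarrow>
      bmap f g \<cdot> binj2 A X Y \<cdot> x = binj2 A (Cod A f) (Cod A g) \<cdot> g \<cdot> x"
proof -
  have o: "Dom A f \<in> Obj A" "Dom A g \<in> Obj A" "Cod A f \<in> Obj A" "Cod A g \<in> Obj A" using assms by auto
  note b = bmap_simps[OF assms(1,2)]
  show "Cod A f = X \<Longrightarrow> Cod A g = Y \<Longrightarrow> Cod A x = bsum A (Dom A f) (Dom A g) \<Longrightarrow>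
      bproj1 A X Y \<cdot> bmap f g \<cdot> x = f \<cdot> bproj1 A (Dom A f) (Dom A g) \<cdot> x"
    by (subst comp_extend[OF b(4)]) (use assms o in auto)
  show "Cod A f = X \<Longrightarrow> Cod A g = Y \<Longrightarrow> Cod A x = bsum A (Dom A f) (Dom A g) \<Longrightarrow>
      bproj2 A X Y \<cdot> bmap f g \<cdot> x = g \<cdot> bproj2 A (Dom A f) (Dom A g) \<cdot> x"
    by (subst comp_extend[OF b(5)]) (use assms o in auto)
  show "Dom A f = X \<Longrightarrow> Dom A g = Y \<Longrightarrow> Cod A x = X \<Longrightarrow>
      bmap f g \<cdot> binj1 A X Y \<cdot> x = binj1 A (Cod A f) (Cod A g) \<cdot> f \<cdot> x"
    by (subst comp_extend[OF b(6)]) (use assms o in auto)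
  show "Dom A f = X \<Longrightarrow> Dom A g = Y \<Longrightarrow> Cod A x = Y \<Longrightarrow>
      bmap f g \<cdot> binj2 A X Y \<cdot> x = binj2 A (Cod A f) (Cod A g) \<cdot> g \<cdot> x"
    by (subst comp_extend[OF b(7)]) (use assms o in auto)
qed

lemma bmap_comp:
  assumes "f \<in> Arr A" "f' \<in> Arr A" "g \<in> Arr A" "g' \<in> Arr A" "Cod A f = Dom A f'" "Cod A g = Dom A g'"
  shows "bmap f' g' \<cdot> bmap f g = bmap (f' \<cdot> f) (g' \<cdot> g)"
  by (rule bsum_ext[of "Cod A f'" "Cod A g'"]) (use assms in auto)

lemma bmap_Ident: "X \<in> Obj A \<Longrightarrow> Y \<in> Obj A \<Longrightarrow> bmap (Ident A X) (Ident A Y) = Ident A (bsum A X Y)"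
  by (rule bsum_ext[of X Y]) auto

lemma bmap_zero:
  "\<lbrakk>X \<in> Obj A; X' \<in> Obj A; Y \<in> Obj A; Y' \<in> Obj A\<rbrakk> \<Longrightarrow>
    bmap (HZero A X X') (HZero A Y Y') = HZero A (bsum A X Y) (bsum A X' Y')"
  by (rule bsum_ext[of X' Y']) auto

lemma is_iso_bmap:
  assumes "is_iso A f" "is_iso A g"
  shows "is_iso A (bmap f g)"
proof -
  have a: "f \<in> Arr A" "g \<in> Arr A" using assms by (auto simp: is_iso_def)
  obtain f' where f': "f' \<in> Hom A (Cod A f) (Dom A f)" "f' \<cdot> f = Ident A (Dom A f)" "f \<cdot> f' = Ident A (Cod A f)"
    using is_isoE[OF assms(1), of "Dom A f" "Cod A f"] a by auto
  obtain g' where g': "g' \<in> Hom A (Cod A g) (Dom A g)" "g' \<cdot> g = Ident A (Dom A g)" "g \<cdot> g' = Ident A (Cod A g)"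
    using is_isoE[OF assms(2), of "Dom A g" "Cod A g"] a by auto
  show ?thesis
    by (rule is_isoI[of _ "bsum A (Dom A f) (Dom A g)" "bsum A (Cod A f) (Cod A g)" "bmap f' g'"])
       (use a f' g' in \<open>auto simp: bmap_comp bmap_Ident\<close>)
qed

text \<open>A morphism into a biproduct is killed by \<open>diag(f, f')\<close> exactly when its two components are
  killed by \<open>f\<close> and \<open>f'\<close>, so kernels, and dually cokernels, are computed componentwise.  This is what
  makes cohomology commute with direct sums of complexes.\<close>

lemma kernel_bmap:
  assumes "is_kernel A f k" "is_kernel A f' k'"
  shows "is_kernel A (bmap f f') (bmap k k')"
proof -
  note k = kernelD[OF assms(1)] and k' = kernelD[OF assms(2)]
  show ?thesis
  proof (rule kernelI)
    show "bmap f f' \<cdot> bmap k k' = HZero A (Dom A (bmap k k')) (Cod A (bmap f f'))"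
      using k k' by (simp add: bmap_comp bmap_zero)
  next
    fix g assume g: "g \<in> Arr A" "Cod A g = Dom A (bmap f f')"
      "bmap f f' \<cdot> g = HZero A (Dom A g) (Cod A (bmap f f'))"
    let ?p1 = "bproj1 A (Dom A f) (Dom A f')" and ?p2 = "bproj2 A (Dom A f) (Dom A f')"
    have "f \<cdot> ?p1 \<cdot> g = bproj1 A (Cod A f) (Cod A f') \<cdot> bmap f f' \<cdot> g"
      using g(1,2) k k' by simp
    also have "\<dots> = HZero A (Dom A g) (Cod A f)" unfolding g(3) using g(1) k k' by simp
    finally have "f \<cdot> ?p1 \<cdot> g = HZero A (Dom A (?p1 \<cdot> g)) (Cod A f)" using g(1,2) k k' by simp
    then obtain h where h: "h \<in> Arr A" "Dom A h = Dom A (?p1 \<cdot> g)" "Cod A h = Dom A k" "k \<cdot> h = ?p1 \<cdot> g"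
      using kernel_lift[OF assms(1), of "?p1 \<cdot> g"] g(1,2) k k' by auto
    have "f' \<cdot> ?p2 \<cdot> g = bproj2 A (Cod A f) (Cod A f') \<cdot> bmap f f' \<cdot> g"
      using g(1,2) k k' by simp
    also have "\<dots> = HZero A (Dom A g) (Cod A f')" unfolding g(3) using g(1) k k' by simp
    finally have "f' \<cdot> ?p2 \<cdot> g = HZero A (Dom A (?p2 \<cdot> g)) (Cod A f')" using g(1,2) k k' by simp
    then obtain h' where h': "h' \<in> Arr A" "Dom A h' = Dom A (?p2 \<cdot> g)" "Cod A h' = Dom A k'" "k' \<cdot> h' = ?p2 \<cdot> g"
      using kernel_lift[OF assms(2), of "?p2 \<cdot> g"] g(1,2) k k' by auto
    let ?h = "(binj1 A (Dom A k) (Dom A k') \<cdot> h) \<oplus>\<^sub>h (binj2 A (Dom A k) (Dom A k') \<cdot> h')"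
    have hh: "?h \<in> Arr A" "Dom A ?h = Dom A g" "Cod A ?h = Dom A (bmap k k')"
      using h h' g(1,2) k k' by auto
    have "bmap k k' \<cdot> ?h = g"
      by (rule bsum_ext[of "Dom A f" "Dom A f'"]) (use hh h h' g(1,2) k k' in auto)
    then show "\<exists>h. h \<in> Arr A \<and> Dom A h = Dom A g \<and> Cod A h = Dom A (bmap k k') \<and> bmap k k' \<cdot> h = g"
      using hh by blast
  next
    fix h h' assume h: "bmap k k' \<cdot> h = bmap k k' \<cdot> h'" "h \<in> Arr A" "h' \<in> Arr A"
      "Cod A h = Dom A (bmap k k')" "Cod A h' = Dom A (bmap k k')" "Dom A h = Dom A h'"
    let ?p1 = "bproj1 A (Dom A k) (Dom A k')" and ?p2 = "bproj2 A (Dom A k) (Dom A k')"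
    have "bproj1 A (Dom A f) (Dom A f') \<cdot> bmap k k' \<cdot> h = bproj1 A (Dom A f) (Dom A f') \<cdot> bmap k k' \<cdot> h'"
      by (simp only: h(1))
    then have e1: "k \<cdot> ?p1 \<cdot> h = k \<cdot> ?p1 \<cdot> h'" using h(2-) k k' by simp
    have "bproj2 A (Dom A f) (Dom A f') \<cdot> bmap k k' \<cdot> h = bproj2 A (Dom A f) (Dom A f') \<cdot> bmap k k' \<cdot> h'"
      by (simp only: h(1))
    then have e2: "k' \<cdot> ?p2 \<cdot> h = k' \<cdot> ?p2 \<cdot> h'" using h(2-) k k' by simp
    show "h = h'"
    proof (rule bsum_ext[of "Dom A k" "Dom A k'"])
      show "?p1 \<cdot> h = ?p1 \<cdot> h'" by (rule kernel_mono[OF assms(1) e1]) (use h(2-) k k' in auto)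
      show "?p2 \<cdot> h = ?p2 \<cdot> h'" by (rule kernel_mono[OF assms(2) e2]) (use h(2-) k k' in auto)
    qed (use h(2-) k k' in auto)
  qed (use k k' in auto)
qed

lemma cokernel_bmap:
  assumes "is_cokernel A f k" "is_cokernel A f' k'"
  shows "is_cokernel A (bmap f f') (bmap k k')"
proof -
  note k = cokernelD[OF assms(1)] and k' = cokernelD[OF assms(2)]
  show ?thesis
  proof (rule cokernelI)
    show "bmap k k' \<cdot> bmap f f' = HZero A (Dom A (bmap f f')) (Cod A (bmap k k'))"
      using k k' by (simp add: bmap_comp bmap_zero)
  next
    fix g assume g: "g \<in> Arr A" "Dom A g = Cod A (bmap f f')"
      "g \<cdot> bmap f f' = HZero A (Dom A (bmap f f')) (Cod A g)"
    let ?i1 = "binj1 A (Cod A f) (Cod A f')" and ?i2 = "binj2 A (Cod A f) (Cod A f')"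
    have "(g \<cdot> ?i1) \<cdot> f = (g \<cdot> bmap f f') \<cdot> binj1 A (Dom A f) (Dom A f')"
      using g(1,2) k k' by simp
    also have "\<dots> = HZero A (Dom A f) (Cod A (g \<cdot> ?i1))" unfolding g(3) using g(1,2) k k' by simp
    finally obtain h where h: "h \<in> Arr A" "Cod A h = Cod A (g \<cdot> ?i1)" "Dom A h = Cod A k" "h \<cdot> k = g \<cdot> ?i1"
      using cokernel_desc[OF assms(1), of "g \<cdot> ?i1"] g(1,2) k k' by auto
    have "(g \<cdot> ?i2) \<cdot> f' = (g \<cdot> bmap f f') \<cdot> binj2 A (Dom A f) (Dom A f')"
      using g(1,2) k k' by simp
    also have "\<dots> = HZero A (Dom A f') (Cod A (g \<cdot> ?i2))" unfolding g(3) using g(1,2) k k' by simp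
    finally obtain h' where h': "h' \<in> Arr A" "Cod A h' = Cod A (g \<cdot> ?i2)" "Dom A h' = Cod A k'" "h' \<cdot> k' = g \<cdot> ?i2"
      using cokernel_desc[OF assms(2), of "g \<cdot> ?i2"] g(1,2) k k' by auto
    let ?h = "(h \<cdot> bproj1 A (Cod A k) (Cod A k')) \<oplus>\<^sub>h (h' \<cdot> bproj2 A (Cod A k) (Cod A k'))"
    have hh: "?h \<in> Arr A" "Cod A ?h = Cod A g" "Dom A ?h = Cod A (bmap k k')"
      using h h' g(1,2) k k' by auto
    have "?h \<cdot> bmap k k' = g"
      by (rule bsum_coext[of "Cod A f" "Cod A f'"]) (use hh h h' g(1,2) k k' in auto)
    then show "\<exists>h. h \<in> Arr A \<and> Dom A h = Cod A (bmap k k') \<and> Cod A h = Cod A g \<and> h \<cdot> bmap k k' = g"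
      using hh by blast
  next
    fix h h' assume h: "h \<cdot> bmap k k' = h' \<cdot> bmap k k'" "h \<in> Arr A" "h' \<in> Arr A"
      "Dom A h = Cod A (bmap k k')" "Dom A h' = Cod A (bmap k k')" "Cod A h = Cod A h'"
    let ?i1 = "binj1 A (Cod A k) (Cod A k')" and ?i2 = "binj2 A (Cod A k) (Cod A k')"
    have "(h \<cdot> bmap k k') \<cdot> binj1 A (Cod A f) (Cod A f') = (h' \<cdot> bmap k k') \<cdot> binj1 A (Cod A f) (Cod A f')"
      by (simp only: h(1))
    then have e1: "(h \<cdot> ?i1) \<cdot> k = (h' \<cdot> ?i1) \<cdot> k" using h(2-) k k' by simp
    have "(h \<cdot> bmap k k') \<cdot> binj2 A (Cod A f) (Cod A f') = (h' \<cdot> bmap k k') \<cdot> binj2 A (Cod A f) (Cod A f')"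
      by (simp only: h(1))
    then have e2: "(h \<cdot> ?i2) \<cdot> k' = (h' \<cdot> ?i2) \<cdot> k'" using h(2-) k k' by simp
    show "h = h'"
    proof (rule bsum_coext[of "Cod A k" "Cod A k'"])
      show "h \<cdot> ?i1 = h' \<cdot> ?i1" by (rule cokernel_epi[OF assms(1) e1]) (use h(2-) k k' in auto)
      show "h \<cdot> ?i2 = h' \<cdot> ?i2" by (rule cokernel_epi[OF assms(2) e2]) (use h(2-) k k' in auto)
    qed (use h(2-) k k' in auto)
  qed (use k k' in auto)
qed

end

section \<open>Zigzags and the localization of a category\<close>

context category
begin

lemma zigzag_obj: "zigzag C W X Y p \<Longrightarrow> X \<in> Obj C \<and> Y \<in> Obj C"
proof (induction p arbitrary: X)
  case (Cons s p)
  then show ?case by (cases s) auto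
qed simp

lemma zigzag_append [simp]:
  "zigzag C W X Z (p @ q) \<longleftrightarrow> (\<exists>Y. zigzag C W X Y p \<and> zigzag C W Y Z q)"
proof (induction p arbitrary: X)
  case Nil
  then show ?case using zigzag_obj by auto
next
  case (Cons s p)
  then show ?case by (cases s) auto
qed

lemma zz_eq_zigzag:
  assumes "zz_eq C W X Y p q"
  shows "zigzag C W X Y p \<and> zigzag C W X Y q"
  using assms by induction auto

lemma zz_eq_append:
  assumes "zz_eq C W X Y p q" "zigzag C W X' X a" "zigzag C W Y Y' b"
  shows "zz_eq C W X' Y' (a @ p @ b) (a @ q @ b)"
  using assms
proof (induction)
  case (rel l r a' b')
  have "zz_eq C W X' Y' ((a @ a') @ l @ (b' @ b)) ((a @ a') @ r @ (b' @ b))"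
    by (rule zz_eq.rel) (use rel in auto)
  then show ?case by simp
next
  case (refl p)
  then show ?case by (intro zz_eq.refl) auto
qed (auto intro: zz_eq.sym zz_eq.trans)

lemma zz_eq_append2:
  assumes "zz_eq C W X Y p p'" "zz_eq C W Y Z q q'"
  shows "zz_eq C W X Z (p @ q) (p' @ q')"
proof -
  have "zz_eq C W X Z ([] @ p @ q) ([] @ p' @ q)"
    by (rule zz_eq_append[OF assms(1)]) (use assms[THEN zz_eq_zigzag] zigzag_obj in auto)
  moreover have "zz_eq C W X Z (p' @ q @ []) (p' @ q' @ [])"
    by (rule zz_eq_append[OF assms(2)]) (use assms[THEN zz_eq_zigzag] zigzag_obj in auto)
  ultimately show ?thesis by (auto intro: zz_eq.trans)
qed

lemma zz_eq_step:
  assumes "zz_rel C W l r" "zigzag C W X Y l"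
  shows "zz_eq C W X Y l r"
proof -
  have "zigzag C W X Y r" using assms by cases auto
  then show ?thesis using zz_eq.rel[OF assms(1), of X Y "[]" "[]"] assms(2) by simp
qed

lemma zz_eq_comp:
  assumes "f \<in> Arr C" "g \<in> Arr C" "Cod C f = Dom C g" "Dom C f = X" "Cod C g = Y"
  shows "zz_eq C W X Y [Fwd f, Fwd g] [Fwd (g \<cdot> f)]"
  by (rule zz_eq_step, rule zz_rel.comp) (use assms in auto)

lemma zz_eq_ident:
  assumes "X \<in> Obj C"
  shows "zz_eq C W X X [Fwd (Ident C X)] []"
  by (rule zz_eq_step, rule zz_rel.ident) (use assms in auto)

lemma zz_eq_cancel_right:
  assumes "w \<in> Arr C" "w \<in> W" "Dom C w = X"
  shows "zz_eq C W X X [Fwd w, Bwd w] []"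
  by (rule zz_eq_step, rule zz_rel.cancel_right) (use assms dom_obj[of w] in auto)

lemma zz_eq_cancel_left:
  assumes "w \<in> Arr C" "w \<in> W" "Cod C w = X"
  shows "zz_eq C W X X [Bwd w, Fwd w] []"
  by (rule zz_eq_step, rule zz_rel.cancel_left) (use assms cod_obj[of w] in auto)

text \<open>Arrows of the localization are compared through their representing zigzags; together with the
  description of composition as concatenation this reduces every statement about the localization to one
  about lists of steps.\<close>

lemma zz_class_eq_iff:
  assumes "zigzag C W X Y p" "zigzag C W X' Y' q"
  shows "zz_class C W X Y p = zz_class C W X' Y' q \<longleftrightarrow> X = X' \<and> Y = Y' \<and> zz_eq C W X Y p q"
proof
  assume eq: "zz_class C W X Y p = zz_class C W X' Y' q"
  moreover from this have "{r. zz_eq C W X Y p r} = {r. zz_eq C W X' Y' q r}"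
    by (auto simp only: zz_class_def prod.inject)
  then have "q \<in> {r. zz_eq C W X Y p r}" using zz_eq.refl[OF assms(2)] by blast
  ultimately show "X = X' \<and> Y = Y' \<and> zz_eq C W X Y p q" by (simp add: zz_class_def)
next
  assume "X = X' \<and> Y = Y' \<and> zz_eq C W X Y p q"
  then show "zz_class C W X Y p = zz_class C W X' Y' q"
    unfolding zz_class_def by (auto intro: zz_eq.sym zz_eq.trans)
qed

lemma localization_simps:
  "Obj (localization C W) = Obj C"
  "Dom (localization C W) (zz_class C W X Y p) = X"
  "Cod (localization C W) (zz_class C W X Y p) = Y"
  "Ident (localization C W) X = zz_class C W X X []"
  by (auto simp: localization_def zz_class_def)

lemma localization_Hom:
  "Hom (localization C W) X Y = {zz_class C W X Y p | p. zigzag C W X Y p}"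
  unfolding Hom_def by (auto simp: localization_def zz_class_def)

lemma localization_comp:
  assumes "zigzag C W X Y p" "zigzag C W Y Z q"
  shows "zz_class C W Y Z q \<cdot>\<^bsub>localization C W\<^esub> zz_class C W X Y p = zz_class C W X Z (p @ q)"
proof -
  have "(\<exists>p' q'. zz_eq C W X Y p p' \<and> zz_eq C W Y Z q q' \<and> zz_eq C W X Z (p' @ q') r) \<longleftrightarrow>
      zz_eq C W X Z (p @ q) r" for r
    using zz_eq_append2 assms zz_eq.refl zz_eq.trans by metis
  then show ?thesis
    unfolding zz_class_def localization_def by auto
qed

lemma category_localization: "category (localization C W)"
proof
  let ?D = "localization C W"
  note h = localization_Hom
  show "Dom ?D f \<in> Obj ?D" "Cod ?D f \<in> Obj ?D" if "f \<in> Arr ?D" for f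
    using that zigzag_obj by (force simp: localization_def zz_class_def)+
  show "Ident ?D X \<in> Hom ?D X X" if "X \<in> Obj ?D" for X
    using that by (auto simp: h localization_simps intro!: exI[of _ "[]"] simp del: Hom_def)
  show "g \<cdot>\<^bsub>?D\<^esub> f \<in> Hom ?D X Z" if "f \<in> Hom ?D X Y" "g \<in> Hom ?D Y Z" for f g X Y Z
    using that by (auto simp: h localization_comp simp del: Hom_def) (metis zigzag_append)
  show "(k \<cdot>\<^bsub>?D\<^esub> g) \<cdot>\<^bsub>?D\<^esub> f = k \<cdot>\<^bsub>?D\<^esub> g \<cdot>\<^bsub>?D\<^esub> f"
    if "f \<in> Hom ?D X Y" "g \<in> Hom ?D Y Z" "k \<in> Hom ?D Z V" for f g k X Y Z V
    using that by (clarsimp simp: h simp del: Hom_def) (subst localization_comp, auto)+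
  show "f \<cdot>\<^bsub>?D\<^esub> Ident ?D X = f" if "f \<in> Hom ?D X Y" for f X Y
    using that zigzag_obj by (clarsimp simp: h localization_simps simp del: Hom_def) (subst localization_comp, auto)
  show "Ident ?D Y \<cdot>\<^bsub>?D\<^esub> f = f" if "f \<in> Hom ?D X Y" for f X Y
    using that zigzag_obj by (clarsimp simp: h localization_simps simp del: Hom_def) (subst localization_comp, auto)
qed

lemma loc_functor_Hom:
  "f \<in> Hom C X Y \<Longrightarrow> loc_functor C W f \<in> Hom (localization C W) X Y"
  unfolding localization_Hom loc_functor_def
  by (auto intro!: exI[of _ "[Fwd f]"] simp del: Hom_def simp: Hom_def[of C])

lemma loc_functor_comp:
  assumes "f \<in> Hom C X Y" "g \<in> Hom C Y Z"
  shows "loc_functor C W (g \<cdot> f) = loc_functor C W g \<cdot>\<^bsub>localization C W\<^esub> loc_functor C W f"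
proof -
  have "zz_class C W X Z [Fwd (g \<cdot> f)] = zz_class C W X Z ([Fwd f] @ [Fwd g])"
    using assms zz_eq_comp[of f g X Z W, THEN zz_eq.sym] by (subst zz_class_eq_iff) auto
  then show ?thesis
    using assms unfolding loc_functor_def by (auto simp: localization_comp)
qed

lemma loc_functor_Ident:
  assumes "X \<in> Obj C"
  shows "loc_functor C W (Ident C X) = Ident (localization C W) X"
  unfolding loc_functor_def localization_simps
  using assms zz_eq_ident[of X W] by (subst zz_class_eq_iff) auto

lemma loc_functor_iso:
  assumes "is_iso C f" "f \<in> Hom C X Y"
  shows "is_iso (localization C W) (loc_functor C W f)"
proof -
  interpret D: category "localization C W" by (rule category_localization)
  obtain g where g: "g \<in> Hom C Y X" "g \<cdot> f = Ident C X" "f \<cdot> g = Ident C Y"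
    using is_isoE[OF assms] .
  have o: "X \<in> Obj C" "Y \<in> Obj C" using assms(2) by auto
  show ?thesis
  proof (rule D.is_isoI)
    show "loc_functor C W g \<cdot>\<^bsub>localization C W\<^esub> loc_functor C W f = Ident (localization C W) X"
      using loc_functor_comp[OF assms(2) g(1)] g(2) loc_functor_Ident[OF o(1)] by metis
    show "loc_functor C W f \<cdot>\<^bsub>localization C W\<^esub> loc_functor C W g = Ident (localization C W) Y"
      using loc_functor_comp[OF g(1) assms(2)] g(3) loc_functor_Ident[OF o(2)] by metis
  qed (rule loc_functor_Hom[OF assms(2)] loc_functor_Hom[OF g(1)])+
qed

lemma loc_functor_inverts:
  assumes "w \<in> W" "w \<in> Hom C X Y"
  shows "is_iso (localization C W) (loc_functor C W w)"
proof -
  interpret D: category "localization C W" by (rule category_localization)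
  have w: "w \<in> Arr C" "Dom C w = X" "Cod C w = Y" using assms by auto
  have o: "X \<in> Obj C" "Y \<in> Obj C" using w by auto
  show ?thesis
    by (rule D.is_isoI[where X = X and Y = Y and g = "zz_class C W Y X [Bwd w]"])
       (use assms w o zz_eq_cancel_left[of w W Y] zz_eq_cancel_right[of w W X] in
        \<open>auto simp: loc_functor_def localization_simps localization_comp localization_Hom
           zz_class_eq_iff simp del: Hom_def Hom_def[of "localization C W"]\<close>)
qed

text \<open>An endofunctor that maps the inverted class into itself; applied step by step to zigzags, it descends
  to the localization.\<close>

definition preserves :: "'m set \<Rightarrow> ('o \<Rightarrow> 'o) \<Rightarrow> ('m \<Rightarrow> 'm) \<Rightarrow> bool" where
  "preserves W \<Phi> \<phi> \<longleftrightarrow>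
     (\<forall>X \<in> Obj C. \<Phi> X \<in> Obj C \<and> \<phi> (Ident C X) = Ident C (\<Phi> X)) \<and>
     (\<forall>f \<in> Arr C. \<phi> f \<in> Hom C (\<Phi> (Dom C f)) (\<Phi> (Cod C f))) \<and>
     (\<forall>f \<in> Arr C. \<forall>g \<in> Arr C. Cod C f = Dom C g \<longrightarrow> \<phi> (g \<cdot> f) = \<phi> g \<cdot> \<phi> f) \<and>
     (\<forall>w \<in> Arr C \<inter> W. \<phi> w \<in> W)"

lemma preserves_id: "preserves W (\<lambda>X. X) (\<lambda>f. f)"
  by (auto simp: preserves_def)

lemma zigzag_map:
  assumes "preserves W \<Phi> \<phi>" "zigzag C W X Y p"
  shows "zigzag C W (\<Phi> X) (\<Phi> Y) (map (map_zstep \<phi>) p)"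
  using assms(2)
proof (induction p arbitrary: X)
  case Nil
  then show ?case using assms(1) by (auto simp: preserves_def)
next
  case (Cons s p)
  then show ?case using assms(1) by (cases s) (auto simp: preserves_def)
qed

lemma zz_eq_map:
  assumes "preserves W \<Phi> \<phi>" "zz_eq C W X Y p q"
  shows "zz_eq C W (\<Phi> X) (\<Phi> Y) (map (map_zstep \<phi>) p) (map (map_zstep \<phi>) q)"
  using assms(2)
proof (induction)
  case (rel l r a b)
  have "zz_rel C W (map (map_zstep \<phi>) l) (map (map_zstep \<phi>) r)"
    using rel(1)
  proof cases
    case (comp f U V g Z)
    then have "\<phi> (g \<cdot> f) = \<phi> g \<cdot> \<phi> f" "\<phi> f \<in> Hom C (\<Phi> U) (\<Phi> V)" "\<phi> g \<in> Hom C (\<Phi> V) (\<Phi> Z)"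
      using assms(1) by (auto simp: preserves_def)
    then show ?thesis using comp zz_rel.comp[of "\<phi> f" C "\<Phi> U" "\<Phi> V" "\<phi> g" "\<Phi> Z"] by simp
  qed (use assms(1) in \<open>auto simp: preserves_def intro: zz_rel.intros\<close>)
  then show ?case
    using zz_eq.rel zigzag_map[OF assms(1) rel(2)] zigzag_map[OF assms(1) rel(3)] by (metis map_append)
qed (auto intro: zz_eq.intros zigzag_map[OF assms(1)])

text \<open>A transformation that is natural for the arrows of the category is natural for zigzags as well: the
  naturality square of an arrow in the inverted class may also be read backwards.\<close>

lemma zz_eq_natural:
  assumes "preserves W \<Phi> \<phi>" "preserves W \<Psi> \<psi>"
    and \<eta>: "\<And>X. X \<in> Obj C \<Longrightarrow> \<eta> X \<in> Hom C (\<Phi> X) (\<Psi> X)"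
    and nat: "\<And>f. f \<in> Arr C \<Longrightarrow> \<eta> (Cod C f) \<cdot> \<phi> f = \<psi> f \<cdot> \<eta> (Dom C f)"
    and "zigzag C W X Y p"
  shows "zz_eq C W (\<Phi> X) (\<Psi> Y) (map (map_zstep \<phi>) p @ [Fwd (\<eta> Y)])
    (Fwd (\<eta> X) # map (map_zstep \<psi>) p)"
  using assms(5)
proof (induction p arbitrary: X)
  case Nil
  then show ?case using \<eta>[of X] by (auto intro!: zz_eq.refl) (use assms in \<open>auto simp: preserves_def\<close>)
next
  case (Cons s p)
  define X' where "X' = (case s of Fwd f \<Rightarrow> Cod C f | Bwd w \<Rightarrow> Dom C w)"
  have p: "zigzag C W X' Y p" using Cons.prems by (cases s) (auto simp: X'_def)
  have o: "X \<in> Obj C" "X' \<in> Obj C" using Cons.prems p zigzag_obj by auto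
  note IH = Cons.IH[OF p]
  note \<psi>p = zigzag_map[OF assms(2) p]
  have sq: "zz_eq C W (\<Phi> X) (\<Psi> X') [map_zstep \<phi> s, Fwd (\<eta> X')] [Fwd (\<eta> X), map_zstep \<psi> s]"
  proof (cases s)
    case (Fwd f)
    then have f: "f \<in> Arr C" "Dom C f = X" "Cod C f = X'" using Cons.prems by (auto simp: X'_def)
    have "zz_eq C W (\<Phi> X) (\<Psi> X') [Fwd (\<phi> f), Fwd (\<eta> X')] [Fwd (\<eta> X' \<cdot> \<phi> f)]"
      using f assms(1) \<eta>[OF o(2)] by (intro zz_eq_comp) (auto simp: preserves_def)
    moreover have "zz_eq C W (\<Phi> X) (\<Psi> X') [Fwd (\<eta> X), Fwd (\<psi> f)] [Fwd (\<psi> f \<cdot> \<eta> X)]"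
      using f assms(2) \<eta>[OF o(1)] by (intro zz_eq_comp) (auto simp: preserves_def)
    ultimately show ?thesis using nat[OF f(1)] f Fwd by (auto intro: zz_eq.sym zz_eq.trans)
  next
    case (Bwd w)
    then have w: "w \<in> Arr C" "w \<in> W" "Cod C w = X" "Dom C w = X'"
      using Cons.prems by (auto simp: X'_def)
    have \<phi>w: "\<phi> w \<in> Arr C" "\<phi> w \<in> W" "Dom C (\<phi> w) = \<Phi> X'" "Cod C (\<phi> w) = \<Phi> X"
      and \<psi>w: "\<psi> w \<in> Arr C" "\<psi> w \<in> W" "Dom C (\<psi> w) = \<Psi> X'" "Cod C (\<psi> w) = \<Psi> X"
      using w assms(1,2) by (auto simp: preserves_def)
    note e = \<eta>[OF o(1)] \<eta>[OF o(2)]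
    have "zz_eq C W (\<Phi> X) (\<Psi> X') ([Bwd (\<phi> w), Fwd (\<eta> X')] @ [Fwd (\<psi> w), Bwd (\<psi> w)] @ [])
        ([Bwd (\<phi> w), Fwd (\<eta> X')] @ [] @ [])"
      by (rule zz_eq_append[OF zz_eq_cancel_right]) (use \<phi>w \<psi>w e cod_obj[of "\<eta> X'"] in auto)
    moreover have "zz_eq C W (\<Phi> X') (\<Psi> X) [Fwd (\<eta> X'), Fwd (\<psi> w)] [Fwd (\<psi> w \<cdot> \<eta> X')]"
      by (rule zz_eq_comp) (use \<phi>w \<psi>w e in auto)
    moreover have "zz_eq C W (\<Phi> X') (\<Psi> X) [Fwd (\<phi> w), Fwd (\<eta> X)] [Fwd (\<eta> X \<cdot> \<phi> w)]"
      by (rule zz_eq_comp) (use \<phi>w \<psi>w e in auto)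
    ultimately have 1: "zz_eq C W (\<Phi> X') (\<Psi> X) [Fwd (\<eta> X'), Fwd (\<psi> w)] [Fwd (\<phi> w), Fwd (\<eta> X)]"
      and 2: "zz_eq C W (\<Phi> X) (\<Psi> X') [Bwd (\<phi> w), Fwd (\<eta> X')]
        [Bwd (\<phi> w), Fwd (\<eta> X'), Fwd (\<psi> w), Bwd (\<psi> w)]"
      using nat[OF w(1)] w by (auto intro: zz_eq.sym zz_eq.trans)
    have "zz_eq C W (\<Phi> X) (\<Psi> X') ([Bwd (\<phi> w)] @ [Fwd (\<eta> X'), Fwd (\<psi> w)] @ [Bwd (\<psi> w)])
        ([Bwd (\<phi> w)] @ [Fwd (\<phi> w), Fwd (\<eta> X)] @ [Bwd (\<psi> w)])"
      by (rule zz_eq_append[OF 1]) (use \<phi>w \<psi>w e dom_obj[of "\<psi> w"] dom_obj[of "\<phi> w"] in auto)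
    moreover have "zz_eq C W (\<Phi> X) (\<Psi> X') ([] @ [Bwd (\<phi> w), Fwd (\<phi> w)] @ [Fwd (\<eta> X), Bwd (\<psi> w)])
        ([] @ [] @ [Fwd (\<eta> X), Bwd (\<psi> w)])"
      by (rule zz_eq_append[OF zz_eq_cancel_left])
         (use \<phi>w \<psi>w e dom_obj[of "\<psi> w"] cod_obj[of "\<phi> w"] in auto)
    ultimately show ?thesis using 2 Bwd by (auto intro: zz_eq.sym zz_eq.trans)
  qed
  have "zz_eq C W (\<Phi> X) (\<Psi> Y) ([map_zstep \<phi> s] @ (map (map_zstep \<phi>) p @ [Fwd (\<eta> Y)]) @ [])
      ([map_zstep \<phi> s] @ (Fwd (\<eta> X') # map (map_zstep \<psi>) p) @ [])"
    by (rule zz_eq_append[OF IH])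
       (use zz_eq_zigzag[OF sq] zz_eq_zigzag[OF IH] zigzag_obj in \<open>cases s; force\<close>)+
  moreover have "zz_eq C W (\<Phi> X) (\<Psi> Y) ([] @ [map_zstep \<phi> s, Fwd (\<eta> X')] @ map (map_zstep \<psi>) p)
      ([] @ [Fwd (\<eta> X), map_zstep \<psi> s] @ map (map_zstep \<psi>) p)"
    by (rule zz_eq_append[OF sq]) (use \<psi>p zz_eq_zigzag[OF sq] zigzag_obj in auto)
  ultimately show ?case by (auto intro: zz_eq.trans)
qed

text \<open>The variant of the naturality principle with a constant functor as source.  It is proved separately
  because identities need not belong to the inverted class.\<close>

lemma zz_eq_cone:
  assumes "preserves W \<Phi> \<phi>"
    and \<kappa>: "\<And>X. X \<in> Obj C \<Longrightarrow> \<kappa> X \<in> Hom C K (\<Phi> X)"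
    and nat: "\<And>f. f \<in> Arr C \<Longrightarrow> \<phi> f \<cdot> \<kappa> (Dom C f) = \<kappa> (Cod C f)"
    and "zigzag C W X Y p"
  shows "zz_eq C W K (\<Phi> Y) (Fwd (\<kappa> X) # map (map_zstep \<phi>) p) [Fwd (\<kappa> Y)]"
  using assms(4)
proof (induction p arbitrary: X)
  case Nil
  then have k: "\<kappa> X \<in> Arr C" "Dom C (\<kappa> X) = K" "Cod C (\<kappa> X) = \<Phi> X" "X = Y" using \<kappa>[of X] by auto
  show ?case using k dom_obj[OF k(1)] cod_obj[OF k(1)] by (auto intro!: zz_eq.refl)
next
  case (Cons s p)
  define X' where "X' = (case s of Fwd f \<Rightarrow> Cod C f | Bwd w \<Rightarrow> Dom C w)"
  have p: "zigzag C W X' Y p" using Cons.prems by (cases s) (auto simp: X'_def)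
  have o: "X \<in> Obj C" "X' \<in> Obj C" using Cons.prems p zigzag_obj by auto
  have K: "K \<in> Obj C" using \<kappa>[OF o(1)] by auto
  note IH = Cons.IH[OF p]
  note e = \<kappa>[OF o(1)] \<kappa>[OF o(2)]
  have tri: "zz_eq C W K (\<Phi> X') [Fwd (\<kappa> X), map_zstep \<phi> s] [Fwd (\<kappa> X')]"
  proof (cases s)
    case (Fwd f)
    then have f: "f \<in> Arr C" "Dom C f = X" "Cod C f = X'" using Cons.prems by (auto simp: X'_def)
    have "zz_eq C W K (\<Phi> X') [Fwd (\<kappa> X), Fwd (\<phi> f)] [Fwd (\<phi> f \<cdot> \<kappa> X)]"
      using f assms(1) e by (intro zz_eq_comp) (auto simp: preserves_def)
    then show ?thesis using nat[OF f(1)] f Fwd by simp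
  next
    case (Bwd w)
    then have w: "w \<in> Arr C" "w \<in> W" "Cod C w = X" "Dom C w = X'"
      using Cons.prems by (auto simp: X'_def)
    have \<phi>w: "\<phi> w \<in> Arr C" "\<phi> w \<in> W" "Dom C (\<phi> w) = \<Phi> X'" "Cod C (\<phi> w) = \<Phi> X"
      using w assms(1) by (auto simp: preserves_def)
    have 1: "zz_eq C W K (\<Phi> X) [Fwd (\<kappa> X'), Fwd (\<phi> w)] [Fwd (\<phi> w \<cdot> \<kappa> X')]"
      by (rule zz_eq_comp) (use \<phi>w e in auto)
    have "zz_eq C W K (\<Phi> X') ([] @ [Fwd (\<kappa> X'), Fwd (\<phi> w)] @ [Bwd (\<phi> w)])
        ([] @ [Fwd (\<phi> w \<cdot> \<kappa> X')] @ [Bwd (\<phi> w)])"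
      by (rule zz_eq_append[OF 1]) (use \<phi>w K dom_obj[of "\<phi> w"] in auto)
    moreover have "zz_eq C W K (\<Phi> X') ([Fwd (\<kappa> X')] @ [Fwd (\<phi> w), Bwd (\<phi> w)] @ []) ([Fwd (\<kappa> X')] @ [] @ [])"
      by (rule zz_eq_append[OF zz_eq_cancel_right]) (use \<phi>w e cod_obj[of "\<kappa> X'"] in auto)
    ultimately have "zz_eq C W K (\<Phi> X') [Fwd (\<phi> w \<cdot> \<kappa> X'), Bwd (\<phi> w)] [Fwd (\<kappa> X')]"
      by (auto intro: zz_eq.trans[OF zz_eq.sym])
    then show ?thesis using nat[OF w(1)] w Bwd by simp
  qed
  have "zz_eq C W K (\<Phi> Y) ([] @ [Fwd (\<kappa> X), map_zstep \<phi> s] @ map (map_zstep \<phi>) p)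
      ([] @ [Fwd (\<kappa> X')] @ map (map_zstep \<phi>) p)"
    by (rule zz_eq_append[OF tri]) (use zigzag_map[OF assms(1) p] K in auto)
  then have "zz_eq C W K (\<Phi> Y) (Fwd (\<kappa> X) # map (map_zstep \<phi>) (s # p)) (Fwd (\<kappa> X') # map (map_zstep \<phi>) p)"
    by simp
  then show ?case using IH by (rule zz_eq.trans)
qed

text \<open>Initial and terminal objects survive localization: composing the canonical arrow with any zigzag gives
  the canonical arrow again, and the canonical endomorphism of the object is its identity.\<close>

lemma localization_initial:
  assumes init: "\<And>X. X \<in> Obj C \<Longrightarrow> \<exists>!f. f \<in> Hom C Z X" and Z: "Z \<in> Obj C"
  shows "is_direct_sum (localization C W) [] Z"
proof -
  define \<kappa> where "\<kappa> X = (THE f. f \<in> Hom C Z X)" for X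
  have \<kappa>: "\<kappa> X \<in> Hom C Z X" if "X \<in> Obj C" for X
    unfolding \<kappa>_def using init[OF that] by (rule theI')
  have u: "f = \<kappa> X" if "f \<in> Hom C Z X" for f X
  proof -
    have "X \<in> Obj C" using that by auto
    then show ?thesis using init[of X] \<kappa>[of X] that by blast
  qed
  have "zz_class C W Z T p = zz_class C W Z T [Fwd (\<kappa> T)]" if p: "zigzag C W Z T p" for p T
  proof -
    have T: "T \<in> Obj C" using p zigzag_obj by blast
    have "zz_eq C W Z T (Fwd (\<kappa> Z) # map (map_zstep (\<lambda>f. f)) p) [Fwd (\<kappa> T)]"
    proof (rule zz_eq_cone[OF preserves_id _ _ p])
      fix f assume f: "f \<in> Arr C"
      then have "f \<cdot> \<kappa> (Dom C f) \<in> Hom C Z (Cod C f)" using \<kappa>[of "Dom C f"] by auto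
      then show "f \<cdot> \<kappa> (Dom C f) = \<kappa> (Cod C f)" by (rule u)
    qed (rule \<kappa>)
    then have 1: "zz_eq C W Z T (Fwd (\<kappa> Z) # p) [Fwd (\<kappa> T)]" by (simp add: zstep.map_id0[unfolded id_def])
    have "\<kappa> Z = Ident C Z" using u[of "Ident C Z" Z] Z by auto
    then have "zz_eq C W Z T ([] @ [Fwd (\<kappa> Z)] @ p) ([] @ [] @ p)"
      using zz_eq_append[OF zz_eq_ident[OF Z, of W], of Z "[]" T p] p Z by simp
    then have "zz_eq C W Z T p (Fwd (\<kappa> Z) # p)" by (auto intro: zz_eq.sym)
    then have "zz_eq C W Z T p [Fwd (\<kappa> T)]" using 1 by (rule zz_eq.trans)
    then show ?thesis using zz_class_eq_iff[OF p, of Z T "[Fwd (\<kappa> T)]"] zz_eq_zigzag by blast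
  qed
  note eq = this
  have "\<exists>!h. h \<in> Hom (localization C W) Z T" if T: "T \<in> Obj C" for T
  proof (rule ex1I)
    have "zigzag C W Z T [Fwd (\<kappa> T)]" using \<kappa>[OF T] T by auto
    then show "zz_class C W Z T [Fwd (\<kappa> T)] \<in> Hom (localization C W) Z T"
      unfolding localization_Hom by blast
    show "h = zz_class C W Z T [Fwd (\<kappa> T)]" if "h \<in> Hom (localization C W) Z T" for h
      using that eq unfolding localization_Hom by blast
  qed
  then show ?thesis using Z by (auto simp: is_direct_sum_def localization_simps simp del: Hom_def)
qed

lemma localization_terminal:
  assumes terminal: "\<And>X. X \<in> Obj C \<Longrightarrow> \<exists>!f. f \<in> Hom C X Z" and Z: "Z \<in> Obj C" and X: "X \<in> Obj C"
  shows "\<exists>!h. h \<in> Hom (localization C W) X Z"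
proof -
  define \<tau> where "\<tau> X = (THE f. f \<in> Hom C X Z)" for X
  have "\<tau> X \<in> Hom C X Z" if "X \<in> Obj C" for X
    unfolding \<tau>_def using terminal[OF that] by (rule theI')
  then have \<tau>: "\<tau> X \<in> Arr C" "Dom C (\<tau> X) = X" "Cod C (\<tau> X) = Z" if "X \<in> Obj C" for X
    using that by auto
  have u: "f = \<tau> X" if "f \<in> Arr C" "Dom C f = X" "Cod C f = Z" for f X
  proof -
    have "f \<in> Hom C X Z" "X \<in> Obj C" using that by auto
    then show ?thesis using terminal[of X] \<tau>[of X] by auto
  qed
  have eq: "zz_eq C W X Z (p @ [Fwd (\<tau> Y)]) [Fwd (\<tau> X)]" if "zigzag C W X Y p" for p X Y
    using that
  proof (induction p arbitrary: X)
    case Nil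
    then show ?case using \<tau>[of X] Z by (auto intro: zz_eq.refl)
  next
    case (Cons s p)
    define X' where "X' = (case s of Fwd f \<Rightarrow> Cod C f | Bwd w \<Rightarrow> Dom C w)"
    have p: "zigzag C W X' Y p" and s: "zigzag C W X X' [s]"
      using Cons.prems zigzag_obj[of W X' Y p] by (cases s; auto simp: X'_def)+
    have o: "X \<in> Obj C" "X' \<in> Obj C" using zigzag_obj[OF s] by auto
    have "zz_eq C W X Z ([s] @ (p @ [Fwd (\<tau> Y)]) @ []) ([s] @ [Fwd (\<tau> X')] @ [])"
      by (rule zz_eq_append[OF Cons.IH[OF p] s]) (use Z in simp)
    moreover have "zz_eq C W X Z [s, Fwd (\<tau> X')] [Fwd (\<tau> X)]"
    proof (cases s)
      case (Fwd f)
      then have f: "f \<in> Arr C" "Dom C f = X" "Cod C f = X'" using s by auto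
      have "zz_eq C W X Z [Fwd f, Fwd (\<tau> X')] [Fwd (\<tau> X' \<cdot> f)]"
        by (rule zz_eq_comp) (use f \<tau>[OF o(2)] in auto)
      moreover have "\<tau> X' \<cdot> f = \<tau> X" by (rule u) (use f \<tau>[OF o(2)] in auto)
      ultimately show ?thesis using Fwd by simp
    next
      case (Bwd w)
      then have w: "w \<in> Arr C" "w \<in> W" "Cod C w = X" "Dom C w = X'" using s by auto
      have 1: "zz_eq C W X' Z [Fwd w, Fwd (\<tau> X)] [Fwd (\<tau> X \<cdot> w)]"
        by (rule zz_eq_comp) (use w \<tau>[OF o(1)] in auto)
      have e: "\<tau> X \<cdot> w = \<tau> X'" by (rule u) (use w \<tau>[OF o(1)] in auto)
      have "zz_eq C W X Z ([Bwd w] @ [Fwd w, Fwd (\<tau> X)] @ []) ([Bwd w] @ [Fwd (\<tau> X')] @ [])"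
        by (rule zz_eq_append[OF 1[unfolded e]]) (use w o Z in auto)
      moreover have "zz_eq C W X Z ([] @ [Bwd w, Fwd w] @ [Fwd (\<tau> X)]) ([] @ [] @ [Fwd (\<tau> X)])"
        by (rule zz_eq_append[OF zz_eq_cancel_left]) (use w o Z \<tau>[OF o(1)] in auto)
      ultimately show ?thesis unfolding Bwd
        using zz_eq.trans[OF zz_eq.sym] by (metis append.simps append_Nil2)
    qed
    ultimately show ?case by (auto intro: zz_eq.trans)
  qed
  show ?thesis
  proof (rule ex1I)
    have z: "zigzag C W X Z [Fwd (\<tau> X)]" using \<tau>[OF X] X Z by auto
    then show "zz_class C W X Z [Fwd (\<tau> X)] \<in> Hom (localization C W) X Z"
      unfolding localization_Hom by blast
    show "h = zz_class C W X Z [Fwd (\<tau> X)]" if h: "h \<in> Hom (localization C W) X Z" for h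
    proof -
      obtain p where p: "zigzag C W X Z p" "h = zz_class C W X Z p"
        using h unfolding localization_Hom by blast
      have "Ident C Z = \<tau> Z" by (rule u) (use Z in auto)
      then have "zz_eq C W X Z (p @ [Fwd (\<tau> Z)] @ []) (p @ [] @ [])"
        using zz_eq_append[OF zz_eq_ident[OF Z], of W X p Z "[]"] p(1) Z by simp
      then have "zz_eq C W X Z p (p @ [Fwd (\<tau> Z)])" by (auto intro: zz_eq.sym)
      then have "zz_eq C W X Z p [Fwd (\<tau> X)]" using eq[OF p(1)] by (rule zz_eq.trans)
      then show ?thesis using zz_class_eq_iff[OF p(1) z] p(2) by blast
    qed
  qed
qed

end

section \<open>Coproducts in a localization\<close>

text \<open>Localization preserves binary coproducts as soon as the inverted class contains the identities and is
  closed under coproducts of arrows: the functors \<open>- \<squnion> Y\<close> and \<open>X \<squnion> -\<close> then descend to the localization, and the universal property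
  is recovered from them and the codiagonal.\<close>

locale localized_coproducts = category C
  for C :: "('o, 'm, 'x) cat_scheme" (structure) +
  fixes W :: "'m set"
    and cop :: "'o \<Rightarrow> 'o \<Rightarrow> 'o"
    and j1 j2 :: "'o \<Rightarrow> 'o \<Rightarrow> 'm"
    and cpr :: "'m \<Rightarrow> 'm \<Rightarrow> 'm"
  assumes cop_inj: "X \<in> Obj C \<Longrightarrow> Y \<in> Obj C \<Longrightarrow>
      j1 X Y \<in> Hom C X (cop X Y) \<and> j2 X Y \<in> Hom C Y (cop X Y)"
    and cop_pair: "f \<in> Hom C X T \<Longrightarrow> g \<in> Hom C Y T \<Longrightarrow>
      cpr f g \<in> Hom C (cop X Y) T \<and> cpr f g \<cdot> j1 X Y = f \<and> cpr f g \<cdot> j2 X Y = g"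
    and cop_ext: "\<lbrakk>X \<in> Obj C; Y \<in> Obj C; h \<in> Hom C (cop X Y) T; h' \<in> Hom C (cop X Y) T;
      h \<cdot> j1 X Y = h' \<cdot> j1 X Y; h \<cdot> j2 X Y = h' \<cdot> j2 X Y\<rbrakk> \<Longrightarrow> h = h'"
    and W_ident: "X \<in> Obj C \<Longrightarrow> Ident C X \<in> W"
    and W_cop: "\<lbrakk>f \<in> Hom C X X'; g \<in> Hom C Y Y'; f \<in> W; g \<in> W\<rbrakk> \<Longrightarrow>
      cpr (j1 X' Y' \<cdot> f) (j2 X' Y' \<cdot> g) \<in> W"
begin

definition cop_map :: "'m \<Rightarrow> 'm \<Rightarrow> 'm" where
  "cop_map f g = cpr (j1 (Cod C f) (Cod C g) \<cdot> f) (j2 (Cod C f) (Cod C g) \<cdot> g)"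

lemma cop_simps [simp]:
  assumes "X \<in> Obj C" "Y \<in> Obj C"
  shows "j1 X Y \<in> Arr C" "Dom C (j1 X Y) = X" "Cod C (j1 X Y) = cop X Y"
    "j2 X Y \<in> Arr C" "Dom C (j2 X Y) = Y" "Cod C (j2 X Y) = cop X Y" "cop X Y \<in> Obj C"
  using cop_inj[OF assms] cod_obj[of "j1 X Y"] by auto

lemma cop_map_simps [simp]:
  assumes "f \<in> Arr C" "g \<in> Arr C"
  shows "cop_map f g \<in> Arr C" "Dom C (cop_map f g) = cop (Dom C f) (Dom C g)"
    "Cod C (cop_map f g) = cop (Cod C f) (Cod C g)"
    "Dom C f = X \<Longrightarrow> Dom C g = Y \<Longrightarrow> cop_map f g \<cdot> j1 X Y = j1 (Cod C f) (Cod C g) \<cdot> f"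
    "Dom C f = X \<Longrightarrow> Dom C g = Y \<Longrightarrow> cop_map f g \<cdot> j2 X Y = j2 (Cod C f) (Cod C g) \<cdot> g"
  using cop_pair[of "j1 (Cod C f) (Cod C g) \<cdot> f" "Dom C f" "cop (Cod C f) (Cod C g)"
      "j2 (Cod C f) (Cod C g) \<cdot> g" "Dom C g"] assms
  by (auto simp: cop_map_def)

lemma cop_map_j_comp [simp]:
  assumes "f \<in> Arr C" "g \<in> Arr C" "x \<in> Arr C" "Dom C f = X" "Dom C g = Y"
  shows "Cod C x = X \<Longrightarrow> cop_map f g \<cdot> (j1 X Y \<cdot> x) = j1 (Cod C f) (Cod C g) \<cdot> f \<cdot> x"
    "Cod C x = Y \<Longrightarrow> cop_map f g \<cdot> (j2 X Y \<cdot> x) = j2 (Cod C f) (Cod C g) \<cdot> g \<cdot> x"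
proof -
  have o: "X \<in> Obj C" "Y \<in> Obj C" using assms dom_obj[of f] dom_obj[of g] by auto
  show "Cod C x = X \<Longrightarrow> cop_map f g \<cdot> (j1 X Y \<cdot> x) = j1 (Cod C f) (Cod C g) \<cdot> f \<cdot> x"
    by (subst comp_extend[OF cop_map_simps(4)]) (use assms o in auto)
  show "Cod C x = Y \<Longrightarrow> cop_map f g \<cdot> (j2 X Y \<cdot> x) = j2 (Cod C f) (Cod C g) \<cdot> g \<cdot> x"
    by (subst comp_extend[OF cop_map_simps(5)]) (use assms o in auto)
qed

lemma cop_ext':
  assumes "X \<in> Obj C" "Y \<in> Obj C" "h \<in> Arr C" "h' \<in> Arr C" "Dom C h = cop X Y" "Dom C h' = cop X Y"
    "Cod C h = Cod C h'" "h \<cdot> j1 X Y = h' \<cdot> j1 X Y" "h \<cdot> j2 X Y = h' \<cdot> j2 X Y"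
  shows "h = h'"
  by (rule cop_ext[of X Y h "Cod C h'"]) (use assms in auto)

lemma cop_map_ident: "X \<in> Obj C \<Longrightarrow> Y \<in> Obj C \<Longrightarrow> cop_map (Ident C X) (Ident C Y) = Ident C (cop X Y)"
  by (rule cop_ext'[of X Y]) auto

lemma cop_map_comp:
  assumes "f \<in> Arr C" "f' \<in> Arr C" "g \<in> Arr C" "g' \<in> Arr C" "Cod C f = Dom C f'" "Cod C g = Dom C g'"
  shows "cop_map f' g' \<cdot> cop_map f g = cop_map (f' \<cdot> f) (g' \<cdot> g)"
  by (rule cop_ext'[of "Dom C f" "Dom C g"]) (use assms in auto)

lemma cop_map_W:
  assumes "f \<in> Arr C" "g \<in> Arr C" "f \<in> W" "g \<in> W"
  shows "cop_map f g \<in> W"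
  unfolding cop_map_def by (rule W_cop[of f "Dom C f" _ g "Dom C g"]) (use assms in auto)

text \<open>The functors \<open>- \<squnion> Y\<close> and \<open>X \<squnion> -\<close> on zigzags.\<close>

definition Lmap :: "'o \<Rightarrow> 'm zstep list \<Rightarrow> 'm zstep list" where
  "Lmap Y = map (map_zstep (\<lambda>f. cop_map f (Ident C Y)))"

definition Rmap :: "'o \<Rightarrow> 'm zstep list \<Rightarrow> 'm zstep list" where
  "Rmap X = map (map_zstep (\<lambda>f. cop_map (Ident C X) f))"

lemma preserves_L: "Y \<in> Obj C \<Longrightarrow> preserves W (\<lambda>X. cop X Y) (\<lambda>f. cop_map f (Ident C Y))"
  unfolding preserves_def using W_ident cop_map_W by (auto simp: cop_map_comp cop_map_ident)

lemma preserves_R: "X \<in> Obj C \<Longrightarrow> preserves W (\<lambda>Y. cop X Y) (\<lambda>f. cop_map (Ident C X) f)"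
  unfolding preserves_def using W_ident cop_map_W by (auto simp: cop_map_comp cop_map_ident)

definition codiag :: "'o \<Rightarrow> 'm" where
  "codiag T = cpr (Ident C T) (Ident C T)"

lemma codiag_simps [simp]:
  assumes "T \<in> Obj C"
  shows "codiag T \<in> Arr C" "Dom C (codiag T) = cop T T" "Cod C (codiag T) = T"
    "codiag T \<cdot> j1 T T = Ident C T" "codiag T \<cdot> j2 T T = Ident C T"
  using cop_pair[of "Ident C T" T T "Ident C T" T] assms by (auto simp: codiag_def)

lemma codiag_j_comp [simp]:
  assumes "T \<in> Obj C" "x \<in> Arr C" "Cod C x = T"
  shows "codiag T \<cdot> (j1 T T \<cdot> x) = x" "codiag T \<cdot> (j2 T T \<cdot> x) = x"
  using comp_extend[OF codiag_simps(4)[OF assms(1)], of x] comp_extend[OF codiag_simps(5)[OF assms(1)], of x] assms by auto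

abbreviation "zeq \<equiv> zz_eq C W"
abbreviation "zz \<equiv> zigzag C W"

lemma zz_L: "zz X X' p \<Longrightarrow> Y \<in> Obj C \<Longrightarrow> zz (cop X Y) (cop X' Y) (Lmap Y p)"
  unfolding Lmap_def by (rule zigzag_map[OF preserves_L])

lemma zz_R: "zz Y Y' p \<Longrightarrow> X \<in> Obj C \<Longrightarrow> zz (cop X Y) (cop X Y') (Rmap X p)"
  unfolding Rmap_def by (rule zigzag_map[OF preserves_R])

lemma zeq_L: "zeq X X' p q \<Longrightarrow> Y \<in> Obj C \<Longrightarrow> zeq (cop X Y) (cop X' Y) (Lmap Y p) (Lmap Y q)"
  unfolding Lmap_def by (rule zz_eq_map[OF preserves_L])

lemma zeq_R: "zeq Y Y' p q \<Longrightarrow> X \<in> Obj C \<Longrightarrow> zeq (cop X Y) (cop X Y') (Rmap X p) (Rmap X q)"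
  unfolding Rmap_def by (rule zz_eq_map[OF preserves_R])

lemma zeq_j1_L:
  assumes p: "zz X X' p" and Y: "Y \<in> Obj C"
  shows "zeq X (cop X' Y) (Fwd (j1 X Y) # Lmap Y p) (p @ [Fwd (j1 X' Y)])"
proof -
  have "zeq X (cop X' Y) (map (map_zstep (\<lambda>f. f)) p @ [Fwd (j1 X' Y)]) (Fwd (j1 X Y) # Lmap Y p)"
    unfolding Lmap_def
    by (rule zz_eq_natural[OF preserves_id preserves_L[OF Y] _ _ p, of "\<lambda>X. j1 X Y"]) (use Y in auto)
  then show ?thesis by (simp add: zstep.map_id0[unfolded id_def] zz_eq.sym)
qed

lemma zeq_j2_R:
  assumes p: "zz Y Y' p" and X: "X \<in> Obj C"
  shows "zeq Y (cop X Y') (Fwd (j2 X Y) # Rmap X p) (p @ [Fwd (j2 X Y')])"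
proof -
  have "zeq Y (cop X Y') (map (map_zstep (\<lambda>f. f)) p @ [Fwd (j2 X Y')]) (Fwd (j2 X Y) # Rmap X p)"
    unfolding Rmap_def
    by (rule zz_eq_natural[OF preserves_id preserves_R[OF X] _ _ p, of "\<lambda>Y. j2 X Y"]) (use X in auto)
  then show ?thesis by (simp add: zstep.map_id0[unfolded id_def] zz_eq.sym)
qed

lemma zeq_j2_L:
  assumes p: "zz X X' p" and Y: "Y \<in> Obj C"
  shows "zeq Y (cop X' Y) (Fwd (j2 X Y) # Lmap Y p) [Fwd (j2 X' Y)]"
  unfolding Lmap_def by (rule zz_eq_cone[OF preserves_L[OF Y] _ _ p, of "\<lambda>X. j2 X Y"]) (use Y in auto)

lemma zeq_j1_R:
  assumes p: "zz Y Y' p" and X: "X \<in> Obj C"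
  shows "zeq X (cop X Y') (Fwd (j1 X Y) # Rmap X p) [Fwd (j1 X Y')]"
  unfolding Rmap_def by (rule zz_eq_cone[OF preserves_R[OF X] _ _ p, of "\<lambda>Y. j1 X Y"]) (use X in auto)

lemma interchange_arrow:
  assumes p: "zz X X' p" and g: "g \<in> Hom C Y Y'"
  shows "zeq (cop X Y) (cop X' Y') (Lmap Y p @ [Fwd (cop_map (Ident C X') g)])
     (Fwd (cop_map (Ident C X) g) # Lmap Y' p)"
  unfolding Lmap_def
  by (rule zz_eq_natural[OF preserves_L preserves_L _ _ p, of Y Y' "\<lambda>X. cop_map (Ident C X) g"])
     (use g dom_obj[of g] cod_obj[of g] in \<open>auto simp: cop_map_comp\<close>)

text \<open>The coproduct is a bifunctor on the localization.  For one ordinary arrow \<open>g\<close> this is naturality of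
  \<open>- \<squnion> g\<close>; a backward step is obtained from the corresponding forward square by conjugation.\<close>

lemma interchange:
  assumes p: "zz X X' p" and q: "zz Y Y' q"
  shows "zeq (cop X Y) (cop X' Y') (Lmap Y p @ Rmap X' q) (Rmap X q @ Lmap Y' p)"
  using q
proof (induction q arbitrary: Y)
  case Nil
  then show ?case using zz_L[OF p, of Y] by (auto simp: Rmap_def intro: zz_eq.refl)
next
  case (Cons s q)
  define Y1 where "Y1 = (case s of Fwd f \<Rightarrow> Cod C f | Bwd w \<Rightarrow> Dom C w)"
  have q: "zz Y1 Y' q" and s: "zz Y Y1 [s]"
    using Cons.prems zigzag_obj[of W Y1 Y' q] by (cases s; auto simp: Y1_def)+
  have o: "X \<in> Obj C" "X' \<in> Obj C" "Y \<in> Obj C" "Y1 \<in> Obj C" "Y' \<in> Obj C"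
    using zigzag_obj[OF p] zigzag_obj[OF s] zigzag_obj[OF q] by auto
  have step: "zeq (cop X Y) (cop X' Y1) (Lmap Y p @ Rmap X' [s]) (Rmap X [s] @ Lmap Y1 p)"
  proof (cases s)
    case (Fwd f)
    then show ?thesis using interchange_arrow[OF p, of f Y Y1] s by (simp add: Rmap_def)
  next
    case (Bwd w)
    then have w: "w \<in> Arr C" "w \<in> W" "Cod C w = Y" "Dom C w = Y1" using s by auto
    let ?b = "\<lambda>X. cop_map (Ident C X) w"
    have b: "?b X \<in> W" "?b X' \<in> W" using w o W_ident cop_map_W by auto
    have "zeq (cop X Y) (cop X' Y1) ([Bwd (?b X)] @ (Lmap Y1 p @ [Fwd (?b X')]) @ [Bwd (?b X')])
       ([Bwd (?b X)] @ (Fwd (?b X) # Lmap Y p) @ [Bwd (?b X')])"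
      by (rule zz_eq_append[OF interchange_arrow[OF p, of w Y1 Y]]) (use w o b in auto)
    moreover have "zeq (cop X Y) (cop X' Y1) (([Bwd (?b X)] @ Lmap Y1 p) @ [Fwd (?b X'), Bwd (?b X')] @ [])
       (([Bwd (?b X)] @ Lmap Y1 p) @ [] @ [])"
      by (rule zz_eq_append[OF zz_eq_cancel_right]) (use w o b zz_L[OF p, of Y1] in auto)
    moreover have "zeq (cop X Y) (cop X' Y1) ([] @ [Bwd (?b X), Fwd (?b X)] @ (Lmap Y p @ [Bwd (?b X')]))
       ([] @ [] @ (Lmap Y p @ [Bwd (?b X')]))"
      by (rule zz_eq_append[OF zz_eq_cancel_left]) (use w o b zz_L[OF p, of Y] in auto)
    ultimately show ?thesis
      unfolding Bwd Rmap_def append.simps append_assoc append_Nil2 list.map zstep.map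
      by (meson zz_eq.sym zz_eq.trans)
  qed
  have "zeq (cop X Y) (cop X' Y') ([] @ (Lmap Y p @ Rmap X' [s]) @ Rmap X' q) ([] @ (Rmap X [s] @ Lmap Y1 p) @ Rmap X' q)"
    by (rule zz_eq_append[OF step]) (use zz_R[OF q, of X'] o in auto)
  moreover have "zeq (cop X Y) (cop X' Y') (Rmap X [s] @ (Lmap Y1 p @ Rmap X' q) @ [])
      (Rmap X [s] @ (Rmap X q @ Lmap Y' p) @ [])"
    by (rule zz_eq_append[OF Cons.IH[OF q]]) (use zz_R[OF s, of X] o in auto)
  ultimately show ?case by (simp add: Rmap_def) (rule zz_eq.trans)
qed

text \<open>The identity \<open>h \<circ> \<nabla> = \<nabla> \<circ> (h \<squnion> h)\<close> for an arrow \<open>h\<close> of the localization, where \<open>h \<squnion> h\<close> is written as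
  the composite of its two one-sided halves.\<close>

lemma codiagonal_natural:
  assumes h: "zz S T h"
  shows "zeq (cop S S) T (Lmap S h @ Rmap T h @ [Fwd (codiag T)]) (Fwd (codiag S) # h)"
  using h
proof (induction h arbitrary: S)
  case Nil
  then show ?case by (auto simp: Lmap_def Rmap_def intro: zz_eq.refl)
next
  case (Cons s h)
  define S1 where "S1 = (case s of Fwd f \<Rightarrow> Cod C f | Bwd w \<Rightarrow> Dom C w)"
  have h: "zz S1 T h" and s: "zz S S1 [s]"
    using Cons.prems zigzag_obj[of W S1 T h] by (cases s; auto simp: S1_def)+
  have o: "S \<in> Obj C" "S1 \<in> Obj C" "T \<in> Obj C"
    using zigzag_obj[OF h] zigzag_obj[OF s] by auto
  have step: "zeq (cop S S) S1 (Lmap S [s] @ Rmap S1 [s] @ [Fwd (codiag S1)]) (Fwd (codiag S) # [s])"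
  proof (cases s)
    case (Fwd f)
    then have f: "f \<in> Arr C" "Dom C f = S" "Cod C f = S1" using s by auto
    let ?l = "cop_map f (Ident C S)" and ?r = "cop_map (Ident C S1) f"
    have 1: "zeq (cop S S) (cop S1 S1) [Fwd ?l, Fwd ?r] [Fwd (?r \<cdot> ?l)]"
      by (rule zz_eq_comp) (use f o in auto)
    have a: "zeq (cop S S) S1 ([] @ [Fwd ?l, Fwd ?r] @ [Fwd (codiag S1)]) ([] @ [Fwd (?r \<cdot> ?l)] @ [Fwd (codiag S1)])"
      by (rule zz_eq_append[OF 1]) (use f o in auto)
    have b: "zeq (cop S S) S1 [Fwd (?r \<cdot> ?l), Fwd (codiag S1)] [Fwd (codiag S1 \<cdot> ?r \<cdot> ?l)]"
      by (rule zz_eq_comp) (use f o in auto)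
    have e: "codiag S1 \<cdot> ?r \<cdot> ?l = f \<cdot> codiag S"
      by (rule cop_ext'[of S S]) (use f o in auto)
    have c: "zeq (cop S S) S1 [Fwd (codiag S), Fwd f] [Fwd (f \<cdot> codiag S)]"
      by (rule zz_eq_comp) (use f o in auto)
    show ?thesis
      using zz_eq.trans[OF zz_eq.trans[OF a[unfolded append.simps append_Nil2] b, unfolded e] zz_eq.sym[OF c]]
      unfolding Fwd Rmap_def Lmap_def by simp
  next
    case (Bwd w)
    then have w: "w \<in> Arr C" "w \<in> W" "Cod C w = S" "Dom C w = S1" using s by auto
    let ?l = "cop_map w (Ident C S)" and ?r = "cop_map (Ident C S1) w"
    have b: "?l \<in> W" "?r \<in> W" using w o W_ident cop_map_W by auto
    have e: "codiag S \<cdot> ?l \<cdot> ?r = w \<cdot> codiag S1"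
      by (rule cop_ext'[of S1 S1]) (use w o in auto)
    have 1: "zeq (cop S1 S1) (cop S S) [Fwd ?r, Fwd ?l] [Fwd (?l \<cdot> ?r)]"
      by (rule zz_eq_comp) (use w o in auto)
    have a: "zeq (cop S1 S1) S ([] @ [Fwd ?r, Fwd ?l] @ [Fwd (codiag S)]) ([] @ [Fwd (?l \<cdot> ?r)] @ [Fwd (codiag S)])"
      by (rule zz_eq_append[OF 1]) (use w o in auto)
    have c: "zeq (cop S1 S1) S [Fwd (?l \<cdot> ?r), Fwd (codiag S)] [Fwd (codiag S \<cdot> ?l \<cdot> ?r)]"
      by (rule zz_eq_comp) (use w o in auto)
    have d: "zeq (cop S1 S1) S [Fwd (codiag S1), Fwd w] [Fwd (w \<cdot> codiag S1)]"
      by (rule zz_eq_comp) (use w o in auto)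
    have 2: "zeq (cop S1 S1) S [Fwd (codiag S1), Fwd w] [Fwd ?r, Fwd ?l, Fwd (codiag S)]"
      by (rule zz_eq.trans[OF d zz_eq.sym[OF zz_eq.trans[OF a[unfolded append.simps append_Nil2] c, unfolded e]]])
    have A: "zeq (cop S S) S1 ([Bwd ?l, Bwd ?r] @ [Fwd (codiag S1), Fwd w] @ [Bwd w])
        ([Bwd ?l, Bwd ?r] @ [Fwd ?r, Fwd ?l, Fwd (codiag S)] @ [Bwd w])"
      by (rule zz_eq_append[OF 2]) (use w o b in auto)
    have B: "zeq (cop S S) S1 ([Bwd ?l, Bwd ?r, Fwd (codiag S1)] @ [Fwd w, Bwd w] @ [])
        ([Bwd ?l, Bwd ?r, Fwd (codiag S1)] @ [] @ [])"
      by (rule zz_eq_append[OF zz_eq_cancel_right]) (use w o b in auto)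
    have D: "zeq (cop S S) S1 ([Bwd ?l] @ [Bwd ?r, Fwd ?r] @ [Fwd ?l, Fwd (codiag S), Bwd w])
        ([Bwd ?l] @ [] @ [Fwd ?l, Fwd (codiag S), Bwd w])"
      by (rule zz_eq_append[OF zz_eq_cancel_left]) (use w o b in auto)
    have E: "zeq (cop S S) S1 ([] @ [Bwd ?l, Fwd ?l] @ [Fwd (codiag S), Bwd w])
        ([] @ [] @ [Fwd (codiag S), Bwd w])"
      by (rule zz_eq_append[OF zz_eq_cancel_left]) (use w o b in auto)
    show ?thesis
      using zz_eq.trans[OF zz_eq.sym[OF B[unfolded append.simps append_Nil2]]
        zz_eq.trans[OF A[unfolded append.simps append_Nil2] zz_eq.trans[OF D[unfolded append.simps append_Nil2] E[unfolded append.simps append_Nil2]]]]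
      unfolding Bwd Rmap_def Lmap_def by simp
  qed
  have "zeq (cop S S) T (Lmap S [s] @ (Lmap S h @ Rmap T [s]) @ (Rmap T h @ [Fwd (codiag T)]))
      (Lmap S [s] @ (Rmap S1 [s] @ Lmap S1 h) @ (Rmap T h @ [Fwd (codiag T)]))"
    by (rule zz_eq_append[OF interchange[OF h s]]) (use zz_L[OF s] zz_R[OF h] o in auto)
  moreover have "zeq (cop S S) T ((Lmap S [s] @ Rmap S1 [s]) @ (Lmap S1 h @ Rmap T h @ [Fwd (codiag T)]) @ [])
      ((Lmap S [s] @ Rmap S1 [s]) @ (Fwd (codiag S1) # h) @ [])"
    by (rule zz_eq_append[OF Cons.IH[OF h]]) (use zz_L[OF s] zz_R[OF s] o in auto)
  moreover have "zeq (cop S S) T ([] @ (Lmap S [s] @ Rmap S1 [s] @ [Fwd (codiag S1)]) @ h)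
      ([] @ (Fwd (codiag S) # [s]) @ h)"
    by (rule zz_eq_append[OF step]) (use h o in auto)
  ultimately show ?case
    unfolding append_assoc append.simps append_Nil2 Lmap_def Rmap_def list.map
    by (meson zz_eq.trans)
qed

text \<open>Existence in the universal property: \<open>\<nabla> \<circ> (p \<squnion> q)\<close> restricts to \<open>p\<close> and \<open>q\<close>.\<close>

lemma copair_zigzag:
  assumes p: "zz X T p" and q: "zz Y T q"
  shows "zz (cop X Y) T (Lmap Y p @ Rmap T q @ [Fwd (codiag T)])"
    and "zeq X T (Fwd (j1 X Y) # Lmap Y p @ Rmap T q @ [Fwd (codiag T)]) p"
    and "zeq Y T (Fwd (j2 X Y) # Lmap Y p @ Rmap T q @ [Fwd (codiag T)]) q"
proof -
  have o: "X \<in> Obj C" "Y \<in> Obj C" "T \<in> Obj C" using zigzag_obj[OF p] zigzag_obj[OF q] by auto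
  show "zz (cop X Y) T (Lmap Y p @ Rmap T q @ [Fwd (codiag T)])"
    using zz_L[OF p o(2)] zz_R[OF q o(3)] o by auto
  have nab: "zeq T T [Fwd j, Fwd (codiag T)] []" if "j = j1 T T \<or> j = j2 T T" for j
    using that o zz_eq_comp[of j "codiag T" T T W] zz_eq_ident[of T W] by (auto intro: zz_eq.trans)
  have "zeq X T ([] @ (Fwd (j1 X Y) # Lmap Y p) @ (Rmap T q @ [Fwd (codiag T)]))
      ([] @ (p @ [Fwd (j1 T Y)]) @ (Rmap T q @ [Fwd (codiag T)]))"
    by (rule zz_eq_append[OF zeq_j1_L[OF p o(2)]]) (use zz_R[OF q o(3)] o in auto)
  moreover have "zeq X T (p @ (Fwd (j1 T Y) # Rmap T q) @ [Fwd (codiag T)]) (p @ [Fwd (j1 T T)] @ [Fwd (codiag T)])"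
    by (rule zz_eq_append[OF zeq_j1_R[OF q o(3)]]) (use p o in auto)
  moreover have "zeq X T (p @ [Fwd (j1 T T), Fwd (codiag T)] @ []) (p @ [] @ [])"
    by (rule zz_eq_append[OF nab]) (use p o in auto)
  ultimately show "zeq X T (Fwd (j1 X Y) # Lmap Y p @ Rmap T q @ [Fwd (codiag T)]) p"
    unfolding append_assoc append.simps append_Nil2 by (meson zz_eq.trans)
  have "zeq Y T ([] @ (Fwd (j2 X Y) # Lmap Y p) @ (Rmap T q @ [Fwd (codiag T)]))
      ([] @ [Fwd (j2 T Y)] @ (Rmap T q @ [Fwd (codiag T)]))"
    by (rule zz_eq_append[OF zeq_j2_L[OF p o(2)]]) (use zz_R[OF q o(3)] o in auto)
  moreover have "zeq Y T ([] @ (Fwd (j2 T Y) # Rmap T q) @ [Fwd (codiag T)])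
      ([] @ (q @ [Fwd (j2 T T)]) @ [Fwd (codiag T)])"
    by (rule zz_eq_append[OF zeq_j2_R[OF q o(3)]]) (use o in auto)
  moreover have "zeq Y T (q @ [Fwd (j2 T T), Fwd (codiag T)] @ []) (q @ [] @ [])"
    by (rule zz_eq_append[OF nab]) (use q o in auto)
  ultimately show "zeq Y T (Fwd (j2 X Y) # Lmap Y p @ Rmap T q @ [Fwd (codiag T)]) q"
    unfolding append_assoc append.simps append_Nil2 by (meson zz_eq.trans)
qed

text \<open>Uniqueness in the universal property: \<open>h\<close> is recovered from its two restrictions, since
  \<open>h = h \<circ> \<nabla> \<circ> (j\<^sub>1 \<squnion> j\<^sub>2) = \<nabla> \<circ> (h \<squnion> h) \<circ> (j\<^sub>1 \<squnion> j\<^sub>2) = \<nabla> \<circ> (h j\<^sub>1 \<squnion> h j\<^sub>2)\<close>.\<close>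

lemma zigzag_eta:
  assumes X: "X \<in> Obj C" and Y: "Y \<in> Obj C" and h: "zz (cop X Y) T h"
  shows "zeq (cop X Y) T h
     (Lmap Y (Fwd (j1 X Y) # h) @ Rmap T (Fwd (j2 X Y) # h) @ [Fwd (codiag T)])"
proof -
  let ?S = "cop X Y"
  have o: "?S \<in> Obj C" "T \<in> Obj C" using zigzag_obj[OF h] by auto
  have j: "zz X ?S [Fwd (j1 X Y)]" "zz Y ?S [Fwd (j2 X Y)]" using X Y by auto
  let ?a = "cop_map (j1 X Y) (Ident C Y)" and ?b = "cop_map (Ident C ?S) (j2 X Y)"
  have La: "Lmap Y [Fwd (j1 X Y)] = [Fwd ?a]" and Rb: "Rmap ?S [Fwd (j2 X Y)] = [Fwd ?b]"
    by (auto simp: Lmap_def Rmap_def)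
  have I: "zeq ?S T (Lmap Y [Fwd (j1 X Y)] @ (Lmap Y h @ Rmap T [Fwd (j2 X Y)]) @ (Rmap T h @ [Fwd (codiag T)]))
     (Lmap Y [Fwd (j1 X Y)] @ (Rmap ?S [Fwd (j2 X Y)] @ Lmap ?S h) @ (Rmap T h @ [Fwd (codiag T)]))"
    by (rule zz_eq_append[OF interchange[OF h j(2)]]) (use zz_L[OF j(1) Y] zz_R[OF h] o in auto)
  have II: "zeq ?S T ([Fwd ?a, Fwd ?b] @ (Lmap ?S h @ Rmap T h @ [Fwd (codiag T)]) @ [])
      ([Fwd ?a, Fwd ?b] @ (Fwd (codiag ?S) # h) @ [])"
    by (rule zz_eq_append[OF codiagonal_natural[OF h]]) (use X Y o in auto)
  have III: "zeq ?S T ([] @ [Fwd ?a, Fwd ?b, Fwd (codiag ?S)] @ h) ([] @ [] @ h)"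
  proof (rule zz_eq_append)
    have a: "zeq ?S ?S ([Fwd ?a] @ [Fwd ?b, Fwd (codiag ?S)] @ []) ([Fwd ?a] @ [Fwd (codiag ?S \<cdot> ?b)] @ [])"
      by (rule zz_eq_append[OF zz_eq_comp]) (use X Y o in auto)
    have b: "zeq ?S ?S [Fwd ?a, Fwd (codiag ?S \<cdot> ?b)] [Fwd ((codiag ?S \<cdot> ?b) \<cdot> ?a)]"
      by (rule zz_eq_comp) (use X Y o in auto)
    have e: "(codiag ?S \<cdot> ?b) \<cdot> ?a = Ident C ?S"
      by (rule cop_ext'[of X Y]) (use X Y o in auto)
    have c: "zeq ?S ?S [Fwd (Ident C ?S)] []" by (rule zz_eq_ident[OF o(1)])
    show "zeq ?S ?S [Fwd ?a, Fwd ?b, Fwd (codiag ?S)] []"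
      by (rule zz_eq.trans[OF a[unfolded append_assoc append.simps append_Nil2] zz_eq.trans[OF b[unfolded e] c]])
  qed (use h o in auto)
  show ?thesis
    using zz_eq.sym[OF zz_eq.trans[OF I[unfolded La Rb append_assoc append.simps append_Nil2]
      zz_eq.trans[OF II[unfolded append_assoc append.simps append_Nil2] III[unfolded append_assoc append.simps append_Nil2]]]]
    by (simp add: Lmap_def Rmap_def)
qed

theorem localization_coproduct:
  assumes X: "X \<in> Obj C" and Y: "Y \<in> Obj C"
  shows "is_direct_sum (localization C W) [X, Y] (cop X Y)"
proof -
  let ?D = "localization C W" and ?S = "cop X Y"
  define \<iota> where "\<iota> k = (if k = 0 then zz_class C W X ?S [Fwd (j1 X Y)]
    else zz_class C W Y ?S [Fwd (j2 X Y)])" for k :: nat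
  have j: "zz X ?S [Fwd (j1 X Y)]" "zz Y ?S [Fwd (j2 X Y)]" using X Y by auto
  have S: "?S \<in> Obj C" using X Y by simp
  have k2: "(\<forall>k < length [X, Y]. P k) \<longleftrightarrow> P 0 \<and> P 1" for P :: "nat \<Rightarrow> bool"
    by (auto simp: less_Suc_eq)
  have "\<exists>!h. h \<in> Hom ?D ?S T \<and> (\<forall>k < length [X, Y]. h \<cdot>\<^bsub>?D\<^esub> \<iota> k = f k)"
    if f: "\<forall>k < length [X, Y]. f k \<in> Hom ?D ([X, Y] ! k) T" for T f
  proof -
    obtain p q where p: "zz X T p" "f 0 = zz_class C W X T p" and q: "zz Y T q" "f 1 = zz_class C W Y T q"
      using f unfolding k2 localization_Hom by auto
    let ?h = "Lmap Y p @ Rmap T q @ [Fwd (codiag T)]"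
    have comp: "zz_class C W ?S T h \<cdot>\<^bsub>?D\<^esub> \<iota> 0 = zz_class C W X T (Fwd (j1 X Y) # h)"
      "zz_class C W ?S T h \<cdot>\<^bsub>?D\<^esub> \<iota> 1 = zz_class C W Y T (Fwd (j2 X Y) # h)"
      and zz: "zz X T (Fwd (j1 X Y) # h)" "zz Y T (Fwd (j2 X Y) # h)"
      if "zz ?S T h" for h
      using that j X Y localization_comp[OF j(1) that] localization_comp[OF j(2) that]
      by (auto simp: \<iota>_def)
    note h = copair_zigzag[OF p(1) q(1)]
    show ?thesis unfolding k2
    proof (rule ex1I[of _ "zz_class C W ?S T ?h"], intro conjI)
      show "zz_class C W ?S T ?h \<in> Hom ?D ?S T" unfolding localization_Hom using h(1) by blast
      show "zz_class C W ?S T ?h \<cdot>\<^bsub>?D\<^esub> \<iota> 0 = f 0" "zz_class C W ?S T ?h \<cdot>\<^bsub>?D\<^esub> \<iota> 1 = f 1"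
        unfolding comp[OF h(1)] p(2) q(2)
        using zz_class_eq_iff[OF zz(1)[OF h(1)] p(1)] zz_class_eq_iff[OF zz(2)[OF h(1)] q(1)] h(2,3)
        by auto
    next
      fix k assume k: "k \<in> Hom ?D ?S T \<and> k \<cdot>\<^bsub>?D\<^esub> \<iota> 0 = f 0 \<and> k \<cdot>\<^bsub>?D\<^esub> \<iota> 1 = f 1"
      then obtain r where r: "zz ?S T r" "k = zz_class C W ?S T r" unfolding localization_Hom by auto
      have o: "T \<in> Obj C" using zigzag_obj[OF r(1)] by simp
      have eqs: "zeq X T (Fwd (j1 X Y) # r) p" "zeq Y T (Fwd (j2 X Y) # r) q"
        using k unfolding r(2) comp[OF r(1)] p(2) q(2)
        using zz_class_eq_iff[OF zz(1)[OF r(1)] p(1)] zz_class_eq_iff[OF zz(2)[OF r(1)] q(1)] by auto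
      have "zeq ?S T (Lmap Y (Fwd (j1 X Y) # r) @ (Rmap T (Fwd (j2 X Y) # r) @ [Fwd (codiag T)])) ?h"
        by (rule zz_eq_append2[OF zeq_L[OF eqs(1) Y] zz_eq_append2[OF zeq_R[OF eqs(2) o] zz_eq.refl]])
           (use o in auto)
      then have "zeq ?S T r ?h" by (rule zz_eq.trans[OF zigzag_eta[OF X Y r(1)]])
      then show "k = zz_class C W ?S T ?h" unfolding r(2) using zz_class_eq_iff[OF r(1) h(1)] by auto
    qed
  qed
  moreover have "\<forall>k < length [X, Y]. \<iota> k \<in> Hom ?D ([X, Y] ! k) ?S"
    unfolding k2 localization_Hom using j by (auto simp: \<iota>_def simp del: zigzag.simps)
  ultimately show ?thesis
    unfolding is_direct_sum_def localization_simps using X Y S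
    by (intro conjI exI[of _ \<iota>] ballI allI impI) auto
qed

end

section \<open>Bounded complexes and quasi-isomorphisms\<close>

context abelian_category
begin

lemma index_simps: "n + 1 + 1 = n + (2::int)" "n - 1 + 2 = n + (1::int)" "1 + n = n + (1::int)"
  by auto

lemma Cb_simps [simp]:
  "X \<in> Obj (Cb A) \<longleftrightarrow> is_complex A X \<and> is_bounded A X"
  "Dom (Cb A) = csrc" "Cod (Cb A) = ctgt"
  "Ident (Cb A) X = \<lparr>csrc = X, ctgt = X, cmap = (\<lambda>n. Ident A (cobj X n))\<rparr>"
  "g \<cdot>\<^bsub>Cb A\<^esub> f = \<lparr>csrc = csrc f, ctgt = ctgt g, cmap = (\<lambda>n. cmap g n \<cdot> cmap f n)\<rparr>"
  by (auto simp: Cb_def)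

lemma Cb_Arr: "f \<in> Arr (Cb A) \<longleftrightarrow> csrc f \<in> Obj (Cb A) \<and> ctgt f \<in> Obj (Cb A) \<and> is_chain_map A f"
  by (auto simp: Cb_def)

lemma complex_simps [simp]:
  assumes "is_complex A X"
  shows "cobj X n \<in> Obj A" "cdiff X n \<in> Arr A" "Dom A (cdiff X n) = cobj X n"
    "Cod A (cdiff X n) = cobj X (n + 1)"
    "cdiff X (n + 1) \<cdot> cdiff X n = HZero A (cobj X n) (cobj X (n + 2))"
    "cdiff X n \<cdot> cdiff X (n - 1) = HZero A (cobj X (n - 1)) (cobj X (n + 1))"
proof -
  have "cdiff X (n - 1 + 1) \<cdot> cdiff X (n - 1) = HZero A (cobj X (n - 1)) (cobj X (n - 1 + 2))"
    using assms unfolding is_complex_def by blast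
  then show "cdiff X n \<cdot> cdiff X (n - 1) = HZero A (cobj X (n - 1)) (cobj X (n + 1))"
    by (simp add: index_simps)
qed (use assms in \<open>auto simp: is_complex_def\<close>)

lemma chain_simps [simp]:
  assumes "is_chain_map A f"
  shows "cmap f n \<in> Arr A" "Dom A (cmap f n) = cobj (csrc f) n" "Cod A (cmap f n) = cobj (ctgt f) n"
    "cmap f (n + 1) \<cdot> cdiff (csrc f) n = cdiff (ctgt f) n \<cdot> cmap f n"
  using assms by (auto simp: is_chain_map_def)

lemma chain_pred:
  "is_chain_map A f \<Longrightarrow> cmap f n \<cdot> cdiff (csrc f) (n - 1) = cdiff (ctgt f) (n - 1) \<cdot> cmap f (n - 1)"
  using chain_simps(4)[of f "n - 1"] by simp

lemma complexI:
  assumes "\<And>n. cobj X n \<in> Obj A" "\<And>n. cdiff X n \<in> Arr A" "\<And>n. Dom A (cdiff X n) = cobj X n"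
    "\<And>n. Cod A (cdiff X n) = cobj X (n + 1)"
    "\<And>n. cdiff X (n + 1) \<cdot> cdiff X n = HZero A (cobj X n) (cobj X (n + 2))"
  shows "is_complex A X"
  unfolding is_complex_def using assms by auto

lemma chainI:
  assumes "\<And>n. cmap f n \<in> Arr A" "\<And>n. Dom A (cmap f n) = cobj (csrc f) n"
    "\<And>n. Cod A (cmap f n) = cobj (ctgt f) n"
    "\<And>n. cmap f (n + 1) \<cdot> cdiff (csrc f) n = cdiff (ctgt f) n \<cdot> cmap f n"
  shows "is_chain_map A f"
  unfolding is_chain_map_def using assms by auto

lemma category_Cb: "category (Cb A)"
proof
  fix f g X Y Z assume f: "f \<in> Hom (Cb A) X Y" and g: "g \<in> Hom (Cb A) Y Z"
  have "is_chain_map A (g \<cdot>\<^bsub>Cb A\<^esub> f)"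
  proof (rule chainI)
    fix n
    have a: "is_chain_map A f" "is_chain_map A g" "csrc g = ctgt f" "is_complex A (csrc f)" "is_complex A (ctgt f)"
      "is_complex A (ctgt g)" using f g by (auto simp: Cb_Arr)
    have "cmap g (n + 1) \<cdot> cdiff (ctgt f) n = cdiff (ctgt g) n \<cdot> cmap g n"
      using chain_simps(4)[OF a(2), of n] a(3) by simp
    from comp_extend[OF this, of "cmap f n"]
    show "cmap (g \<cdot>\<^bsub>Cb A\<^esub> f) (n + 1) \<cdot> cdiff (csrc (g \<cdot>\<^bsub>Cb A\<^esub> f)) n
        = cdiff (ctgt (g \<cdot>\<^bsub>Cb A\<^esub> f)) n \<cdot> cmap (g \<cdot>\<^bsub>Cb A\<^esub> f) n"
      using a by simp
  qed (use f g in \<open>auto simp: Cb_Arr\<close>)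
  then show "g \<cdot>\<^bsub>Cb A\<^esub> f \<in> Hom (Cb A) X Z" using f g by (auto simp: Cb_Arr)
next
  fix X assume X: "X \<in> Obj (Cb A)"
  have "is_chain_map A (Ident (Cb A) X)" by (rule chainI) (use X in auto)
  then show "Ident (Cb A) X \<in> Hom (Cb A) X X" using X by (auto simp: Cb_Arr)
qed (auto simp: Cb_Arr intro!: chmap.equality ext)

text \<open>Cohomology computed with an arbitrary kernel \<open>k\<close> of the differential, the induced arrow \<open>e\<close> from the
  previous degree, and a cokernel \<open>q\<close> of \<open>e\<close>.  Explicit kernels and cokernels can then be used in place of
  the chosen ones.\<close>

definition coh_pres :: "('o, 'm) cplx \<Rightarrow> int \<Rightarrow> 'm \<Rightarrow> 'm \<Rightarrow> 'm \<Rightarrow> bool" where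
  "coh_pres X n k e q \<longleftrightarrow> is_kernel A (cdiff X n) k \<and> e \<in> Hom A (cobj X (n - 1)) (Dom A k) \<and>
     k \<cdot> e = cdiff X (n - 1) \<and> is_cokernel A e q"

lemma coh_presD:
  assumes "coh_pres X n k e q" "is_complex A X"
  shows "k \<in> Arr A" "Cod A k = cobj X n" "e \<in> Arr A" "Dom A e = cobj X (n - 1)" "Cod A e = Dom A k"
    "k \<cdot> e = cdiff X (n - 1)" "q \<in> Arr A" "Dom A q = Dom A k" "q \<cdot> e = HZero A (cobj X (n - 1)) (Cod A q)"
    "cdiff X n \<cdot> k = HZero A (Dom A k) (cobj X (n + 1))"
    "is_kernel A (cdiff X n) k" "is_cokernel A e q"
  using assms kernelD[of "cdiff X n" k] cokernelD[of e q] by (auto simp: coh_pres_def)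

lemma chosen_coh_pres:
  assumes X: "is_complex A X"
  shows "coh_pres X n (cocyc A X n) (cobd A X n) (coh_proj A X n)"
proof -
  have k: "is_kernel A (cdiff X n) (cocyc A X n)"
    unfolding cocyc_def by (rule someI_ex[OF kernel_exists]) (use X in auto)
  note kD = kernelD[OF k]
  let ?P = "\<lambda>e. e \<in> Hom A (cobj X (n - 1)) (Dom A (cocyc A X n)) \<and> cocyc A X n \<cdot> e = cdiff X (n - 1)"
  have "cdiff X n \<cdot> cdiff X (n - 1) = HZero A (Dom A (cdiff X (n - 1))) (Cod A (cdiff X n))"
    using X by simp
  then obtain e where e: "?P e" using kernel_lift[OF k, of "cdiff X (n - 1)"] X by auto
  have "\<exists>!e. ?P e"
  proof (rule ex1I[of ?P, OF e])
    show "e' = e" if "?P e'" for e'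
      by (rule kernel_mono[OF k]) (use that e in auto)
  qed
  then have c: "?P (cobd A X n)" unfolding cobd_def by (rule theI')
  moreover have "is_cokernel A (cobd A X n) (coh_proj A X n)"
    unfolding coh_proj_def by (rule someI_ex[OF cokernel_exists]) (use c in auto)
  ultimately show ?thesis using k by (auto simp: coh_pres_def)
qed

text \<open>Two presentations have canonically isomorphic cokernels, since the kernels and then the cokernels are
  determined up to unique isomorphism.\<close>

lemma coh_pres_compare:
  assumes X: "is_complex A X" and p: "coh_pres X n k e q" and p': "coh_pres X n k' e' q'"
  obtains \<alpha> \<beta> where "\<alpha> \<in> Arr A" "Dom A \<alpha> = Dom A k" "Cod A \<alpha> = Dom A k'" "k' \<cdot> \<alpha> = k"
    "\<beta> \<in> Hom A (Cod A q) (Cod A q')" "\<beta> \<cdot> q = q' \<cdot> \<alpha>" "is_iso A \<beta>"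
proof -
  have ex: "\<exists>\<alpha> \<beta>. \<alpha> \<in> Arr A \<and> Dom A \<alpha> = Dom A k \<and> Cod A \<alpha> = Dom A k' \<and> k' \<cdot> \<alpha> = k \<and>
      \<beta> \<in> Arr A \<and> Dom A \<beta> = Cod A q \<and> Cod A \<beta> = Cod A q' \<and> \<beta> \<cdot> q = q' \<cdot> \<alpha>"
    if "coh_pres X n k e q" and "coh_pres X n k' e' q'" for k e q k' e' q'
  proof -
    note p = coh_presD[OF that(1) X] and p' = coh_presD[OF that(2) X]
    obtain \<alpha> where \<alpha>: "\<alpha> \<in> Arr A" "Dom A \<alpha> = Dom A k" "Cod A \<alpha> = Dom A k'" "k' \<cdot> \<alpha> = k"
      using kernel_lift[OF p'(11), of k] p X by auto
    have "\<alpha> \<cdot> e = e'"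
    proof (rule kernel_mono[OF p'(11)])
      show "k' \<cdot> \<alpha> \<cdot> e = k' \<cdot> e'" using comp_extend[OF \<alpha>(4), of e] \<alpha> p p' by simp
    qed (use \<alpha> p p' in auto)
    then have "(q' \<cdot> \<alpha>) \<cdot> e = HZero A (Dom A e) (Cod A (q' \<cdot> \<alpha>))" using \<alpha> p p' by simp
    then obtain \<beta> where "\<beta> \<in> Arr A" "Dom A \<beta> = Cod A q" "Cod A \<beta> = Cod A (q' \<cdot> \<alpha>)" "\<beta> \<cdot> q = q' \<cdot> \<alpha>"
      using cokernel_desc[OF p(12), of "q' \<cdot> \<alpha>"] \<alpha> p p' by auto
    then show ?thesis using \<alpha> p' by (intro exI[of _ \<alpha>] exI[of _ \<beta>]) auto
  qed
  obtain \<alpha> \<beta> where a: "\<alpha> \<in> Arr A" "Dom A \<alpha> = Dom A k" "Cod A \<alpha> = Dom A k'" "k' \<cdot> \<alpha> = k"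
    "\<beta> \<in> Arr A" "Dom A \<beta> = Cod A q" "Cod A \<beta> = Cod A q'" "\<beta> \<cdot> q = q' \<cdot> \<alpha>"
    using ex[OF p p'] by blast
  obtain \<alpha>' \<beta>' where a': "\<alpha>' \<in> Arr A" "Dom A \<alpha>' = Dom A k'" "Cod A \<alpha>' = Dom A k" "k \<cdot> \<alpha>' = k'"
    "\<beta>' \<in> Arr A" "Dom A \<beta>' = Cod A q'" "Cod A \<beta>' = Cod A q" "\<beta>' \<cdot> q' = q \<cdot> \<alpha>'"
    using ex[OF p' p] by blast
  have inv: "\<beta>' \<cdot> \<beta> = Ident A (Cod A q)"
    if p: "coh_pres X n k e q" and p': "coh_pres X n k' e' q'" and
      a: "\<alpha> \<in> Arr A" "Dom A \<alpha> = Dom A k" "Cod A \<alpha> = Dom A k'" "k' \<cdot> \<alpha> = k"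
    "\<beta> \<in> Arr A" "Dom A \<beta> = Cod A q" "Cod A \<beta> = Cod A q'" "\<beta> \<cdot> q = q' \<cdot> \<alpha>" and
    a': "\<alpha>' \<in> Arr A" "Dom A \<alpha>' = Dom A k'" "Cod A \<alpha>' = Dom A k" "k \<cdot> \<alpha>' = k'"
    "\<beta>' \<in> Arr A" "Dom A \<beta>' = Cod A q'" "Cod A \<beta>' = Cod A q" "\<beta>' \<cdot> q' = q \<cdot> \<alpha>'"
    for k e q k' e' q' \<alpha> \<beta> \<alpha>' \<beta>'
  proof -
    note p = coh_presD[OF p X] and p' = coh_presD[OF p' X]
    have "\<alpha>' \<cdot> \<alpha> = Ident A (Dom A k)"
      by (rule kernel_mono[OF p(11)]) (use comp_extend[OF a'(4), of \<alpha>] a a' p p' in auto)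
    then have "(\<beta>' \<cdot> \<beta>) \<cdot> q = Ident A (Cod A q) \<cdot> q"
      using comp_extend[OF a'(8), of \<alpha>] a a' p p' by simp
    then show ?thesis by (rule cokernel_epi[OF p(12)]) (use a a' p p' in auto)
  qed
  have "is_iso A \<beta>"
    by (rule is_isoI[of _ "Cod A q" "Cod A q'" \<beta>'])
       (use a a' inv[OF p p' a a'] inv[OF p' p a' a] in auto)
  then show thesis using that[of \<alpha> \<beta>] a by simp
qed

definition coh_iso_at :: "('o, 'm) chmap \<Rightarrow> int \<Rightarrow> bool" where
  "coh_iso_at f n \<longleftrightarrow> (\<exists>k e q k' e' q' z h. coh_pres (csrc f) n k e q \<and> coh_pres (ctgt f) n k' e' q' \<and>
     z \<in> Hom A (Dom A k) (Dom A k') \<and> k' \<cdot> z = cmap f n \<cdot> k \<and>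
     h \<in> Hom A (Cod A q) (Cod A q') \<and> h \<cdot> q = q' \<cdot> z \<and> is_iso A h)"

lemma coh_iso_atI:
  assumes "coh_pres (csrc f) n k e q" "coh_pres (ctgt f) n k' e' q'"
    "z \<in> Hom A (Dom A k) (Dom A k')" "k' \<cdot> z = cmap f n \<cdot> k"
    "h \<in> Hom A (Cod A q) (Cod A q')" "h \<cdot> q = q' \<cdot> z" "is_iso A h"
  shows "coh_iso_at f n"
  using assms unfolding coh_iso_at_def by blast

lemma cocyc_map_ex:
  assumes c: "is_complex A (csrc f)" "is_complex A (ctgt f)" "is_chain_map A f"
    and p: "coh_pres (csrc f) n k e q" and p': "coh_pres (ctgt f) n k' e' q'"
  obtains z h where "z \<in> Arr A" "Dom A z = Dom A k" "Cod A z = Dom A k'" "k' \<cdot> z = cmap f n \<cdot> k"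
    "h \<in> Arr A" "Dom A h = Cod A q" "Cod A h = Cod A q'" "h \<cdot> q = q' \<cdot> z"
proof -
  note P = coh_presD[OF p c(1)] and P' = coh_presD[OF p' c(2)]
  have "cdiff (ctgt f) n \<cdot> cmap f n \<cdot> k = cmap f (n + 1) \<cdot> cdiff (csrc f) n \<cdot> k"
    using comp_extend[OF chain_simps(4)[OF c(3), of n], of k] c P by simp
  also have "\<dots> = HZero A (Dom A k) (cobj (ctgt f) (n + 1))"
    using c P by simp
  finally obtain z where z: "z \<in> Arr A" "Dom A z = Dom A k" "Cod A z = Dom A k'" "k' \<cdot> z = cmap f n \<cdot> k"
    using kernel_lift[OF P'(11), of "cmap f n \<cdot> k"] c P by auto
  have "z \<cdot> e = e' \<cdot> cmap f (n - 1)"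
  proof (rule kernel_mono[OF P'(11)])
    have "k' \<cdot> z \<cdot> e = cmap f n \<cdot> k \<cdot> e" using comp_extend[OF z(4), of e] z c P P' by simp
    also have "\<dots> = cdiff (ctgt f) (n - 1) \<cdot> cmap f (n - 1)" using P(6) chain_pred[OF c(3)] by simp
    also have "\<dots> = k' \<cdot> e' \<cdot> cmap f (n - 1)"
      using comp_extend[OF P'(6), of "cmap f (n - 1)"] c P' by simp
    finally show "k' \<cdot> z \<cdot> e = k' \<cdot> e' \<cdot> cmap f (n - 1)" .
  qed (use z c P P' in auto)
  then have "(q' \<cdot> z) \<cdot> e = HZero A (Dom A e) (Cod A (q' \<cdot> z))"
    using comp_extend[OF P'(9), of "cmap f (n - 1)"] z c P P' by simp
  then obtain h where "h \<in> Arr A" "Dom A h = Cod A q" "Cod A h = Cod A (q' \<cdot> z)" "h \<cdot> q = q' \<cdot> z"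
    using cokernel_desc[OF P(12), of "q' \<cdot> z"] z P P' by auto
  then show thesis using that z P' by simp
qed

lemma coh_map_eq:
  assumes c: "is_complex A (csrc f)" "is_complex A (ctgt f)" "is_chain_map A f"
    and z: "z \<in> Arr A" "Dom A z = Dom A (cocyc A (csrc f) n)" "Cod A z = Dom A (cocyc A (ctgt f) n)"
      "cocyc A (ctgt f) n \<cdot> z = cmap f n \<cdot> cocyc A (csrc f) n"
    and h: "h \<in> Arr A" "Dom A h = cohomology A (csrc f) n" "Cod A h = cohomology A (ctgt f) n"
      "h \<cdot> coh_proj A (csrc f) n = coh_proj A (ctgt f) n \<cdot> z"
  shows "coh_map A f n = h"
proof -
  note P = coh_presD[OF chosen_coh_pres[OF c(1), of n] c(1)]
  note P' = coh_presD[OF chosen_coh_pres[OF c(2), of n] c(2)]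
  have "cocyc_map A f n = z"
    unfolding cocyc_map_def
  proof (rule the_equality)
    show "x = z" if "x \<in> Hom A (Dom A (cocyc A (csrc f) n)) (Dom A (cocyc A (ctgt f) n)) \<and>
       cocyc A (ctgt f) n \<cdot> x = cmap f n \<cdot> cocyc A (csrc f) n" for x
      by (rule kernel_mono[OF P'(11)]) (use that z in auto)
  qed (use z in auto)
  then show ?thesis
    unfolding coh_map_def
  proof (intro the_equality)
    assume [simp]: "cocyc_map A f n = z"
    show "x = h" if "x \<in> Hom A (cohomology A (csrc f) n) (cohomology A (ctgt f) n) \<and>
       x \<cdot> coh_proj A (csrc f) n = coh_proj A (ctgt f) n \<cdot> cocyc_map A f n" for x
      by (rule cokernel_epi[OF P(12)]) (use that h in \<open>auto simp: cohomology_def\<close>)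
  qed (use h in auto)
qed

text \<open>Whether a chain map induces an isomorphism on cohomology may be tested on any presentations of the two
  sides: the map between the chosen cohomology objects differs from the one between the presented objects by
  the comparison isomorphisms.\<close>

lemma coh_iso_at_iff:
  assumes c: "is_complex A (csrc f)" "is_complex A (ctgt f)" "is_chain_map A f"
  shows "is_iso A (coh_map A f n) \<longleftrightarrow> coh_iso_at f n"
proof
  note p = chosen_coh_pres[OF c(1), of n] and p' = chosen_coh_pres[OF c(2), of n]
  obtain z h where z: "z \<in> Arr A" "Dom A z = Dom A (cocyc A (csrc f) n)" "Cod A z = Dom A (cocyc A (ctgt f) n)"
      "cocyc A (ctgt f) n \<cdot> z = cmap f n \<cdot> cocyc A (csrc f) n"
    and h: "h \<in> Arr A" "Dom A h = cohomology A (csrc f) n" "Cod A h = cohomology A (ctgt f) n"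
      "h \<cdot> coh_proj A (csrc f) n = coh_proj A (ctgt f) n \<cdot> z"
    using cocyc_map_ex[OF c p p'] unfolding cohomology_def by blast
  assume "is_iso A (coh_map A f n)"
  then have "is_iso A h" unfolding coh_map_eq[OF c z h] .
  then show "coh_iso_at f n"
    by (intro coh_iso_atI[OF p p']) (use z h in \<open>auto simp: cohomology_def\<close>)
next
  note p = chosen_coh_pres[OF c(1), of n] and p' = chosen_coh_pres[OF c(2), of n]
  note P = coh_presD[OF p c(1)] and P' = coh_presD[OF p' c(2)]
  assume "coh_iso_at f n"
  then obtain k e q k' e' q' z h where r: "coh_pres (csrc f) n k e q" "coh_pres (ctgt f) n k' e' q'"
     and z: "z \<in> Arr A" "Dom A z = Dom A k" "Cod A z = Dom A k'" "k' \<cdot> z = cmap f n \<cdot> k"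
     and h: "h \<in> Hom A (Cod A q) (Cod A q')" "h \<cdot> q = q' \<cdot> z" "is_iso A h"
    unfolding coh_iso_at_def by auto
  note R = coh_presD[OF r(1) c(1)] and R' = coh_presD[OF r(2) c(2)]
  obtain \<alpha> \<beta> where a: "\<alpha> \<in> Arr A" "Dom A \<alpha> = Dom A (cocyc A (csrc f) n)" "Cod A \<alpha> = Dom A k"
    "k \<cdot> \<alpha> = cocyc A (csrc f) n" "\<beta> \<in> Hom A (Cod A (coh_proj A (csrc f) n)) (Cod A q)"
    "\<beta> \<cdot> coh_proj A (csrc f) n = q \<cdot> \<alpha>" "is_iso A \<beta>"
    by (rule coh_pres_compare[OF c(1) p r(1)])
  obtain \<gamma> \<delta> where b: "\<gamma> \<in> Arr A" "Dom A \<gamma> = Dom A k'" "Cod A \<gamma> = Dom A (cocyc A (ctgt f) n)"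
    "cocyc A (ctgt f) n \<cdot> \<gamma> = k'" "\<delta> \<in> Hom A (Cod A q') (Cod A (coh_proj A (ctgt f) n))"
    "\<delta> \<cdot> q' = coh_proj A (ctgt f) n \<cdot> \<gamma>" "is_iso A \<delta>"
    by (rule coh_pres_compare[OF c(2) r(2) p'])
  have iso: "is_iso A (\<delta> \<cdot> h \<cdot> \<beta>)"
    using is_iso_comp[OF is_iso_comp[OF a(7) h(3) a(5) h(1)] b(7) _ b(5)] a(5) h(1) by auto
  have "coh_map A f n = \<delta> \<cdot> h \<cdot> \<beta>"
  proof (rule coh_map_eq[OF c, of "\<gamma> \<cdot> z \<cdot> \<alpha>"])
    have "cocyc A (ctgt f) n \<cdot> \<gamma> \<cdot> z \<cdot> \<alpha> = k' \<cdot> z \<cdot> \<alpha>"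
      using comp_extend[OF b(4), of "z \<cdot> \<alpha>"] a b z P P' R' by simp
    also have "\<dots> = cmap f n \<cdot> k \<cdot> \<alpha>" using comp_extend[OF z(4), of \<alpha>] a z c R R' by simp
    finally show "cocyc A (ctgt f) n \<cdot> \<gamma> \<cdot> z \<cdot> \<alpha> = cmap f n \<cdot> cocyc A (csrc f) n" using a(4) by simp
    have "(\<delta> \<cdot> h \<cdot> \<beta>) \<cdot> coh_proj A (csrc f) n = \<delta> \<cdot> h \<cdot> q \<cdot> \<alpha>"
      using a b h P by simp
    also have "\<dots> = \<delta> \<cdot> q' \<cdot> z \<cdot> \<alpha>" using comp_extend[OF h(2), of \<alpha>] a h z R R' by simp
    also have "\<dots> = coh_proj A (ctgt f) n \<cdot> \<gamma> \<cdot> z \<cdot> \<alpha>"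
      using comp_extend[OF b(6), of "z \<cdot> \<alpha>"] a b z R' P' by simp
    finally show "(\<delta> \<cdot> h \<cdot> \<beta>) \<cdot> coh_proj A (csrc f) n = coh_proj A (ctgt f) n \<cdot> \<gamma> \<cdot> z \<cdot> \<alpha>" .
  qed (use a b h z in \<open>auto simp: cohomology_def\<close>)
  then show "is_iso A (coh_map A f n)" using iso by simp
qed

lemma quasi_isos_iff: "f \<in> quasi_isos A \<longleftrightarrow> f \<in> Arr (Cb A) \<and> (\<forall>n. coh_iso_at f n)"
  unfolding quasi_isos_def using coh_iso_at_iff by (auto simp: Cb_Arr)

lemma shift_Obj:
  assumes "X \<in> Obj (Cb A)"
  shows "shift_cplx A X \<in> Obj (Cb A)"
proof -
  have X: "is_complex A X" "is_bounded A X" using assms by auto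
  have "is_complex A (shift_cplx A X)"
    by (rule complexI)
       (use X complex_simps(5)[OF X(1), of "_ + 1"] in \<open>auto simp: shift_cplx_def algebra_simps\<close>)
  moreover obtain N where N: "\<And>n. \<bar>n\<bar> > N \<Longrightarrow> is_zero_obj A (cobj X n)"
    using X by (auto simp: is_bounded_def)
  have "is_bounded A (shift_cplx A X)"
    unfolding is_bounded_def by (rule exI[of _ "N + 1"]) (auto simp: shift_cplx_def intro!: N)
  ultimately show ?thesis by simp
qed

text \<open>Needed to know that the shift of an identity of the derived category is an identity: the shifted
  arrow is built from all representing zigzags, not only from the empty one.  Negating the differential keeps
  the same kernels and cokernels.\<close>

lemma preserves_shift: "category.preserves (Cb A) (quasi_isos A) (shift_cplx A) (shift_chmap A)"
proof -
  interpret K: category "Cb A" by (rule category_Cb)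
  have map: "shift_chmap A f \<in> Arr (Cb A)" if "f \<in> Arr (Cb A)" for f
  proof -
    have f: "is_complex A (csrc f)" "is_complex A (ctgt f)" "is_chain_map A f" using that by (auto simp: Cb_Arr)
    have "is_chain_map A (shift_chmap A f)"
      by (rule chainI)
         (use f chain_simps(4)[OF f(3), of "_ + 1"] in \<open>auto simp: shift_chmap_def shift_cplx_def algebra_simps\<close>)
    then show ?thesis using that shift_Obj[of "csrc f"] shift_Obj[of "ctgt f"]
      by (auto simp: Cb_Arr) (auto simp: shift_chmap_def)
  qed
  have pres: "coh_pres (shift_cplx A X) n k (hneg A e) q" if X: "is_complex A X" and "coh_pres X (n + 1) k e q" for X n k e q
    using coh_presD[OF that(2) X] that
    by (auto simp: coh_pres_def shift_cplx_def intro: kernel_hneg cokernel_hneg)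
  have "shift_chmap A f \<in> quasi_isos A" if "f \<in> quasi_isos A" for f
  proof -
    have f: "f \<in> Arr (Cb A)" "\<And>n. coh_iso_at f n" using that by (auto simp: quasi_isos_iff)
    then have c: "is_complex A (csrc f)" "is_complex A (ctgt f)" by (auto simp: Cb_Arr)
    have "coh_iso_at (shift_chmap A f) n" for n
    proof -
      obtain k e q k' e' q' z h where "coh_pres (csrc f) (n + 1) k e q" "coh_pres (ctgt f) (n + 1) k' e' q'"
        "z \<in> Hom A (Dom A k) (Dom A k') \<and> k' \<cdot> z = cmap f (n + 1) \<cdot> k \<and>
        h \<in> Hom A (Cod A q) (Cod A q') \<and> h \<cdot> q = q' \<cdot> z \<and> is_iso A h"
        using f(2)[of "n + 1"] unfolding coh_iso_at_def by blast
      then show ?thesis using pres c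
        by (intro coh_iso_atI[of "shift_chmap A f" n k "hneg A e" q k' "hneg A e'" q' z h])
           (auto simp: shift_chmap_def)
    qed
    then show ?thesis using map f(1) by (auto simp: quasi_isos_iff)
  qed
  then show ?thesis
    unfolding K.preserves_def using map shift_Obj
    by (auto simp del: Cb_simps(1)) (auto simp: shift_chmap_def shift_cplx_def)
qed

section \<open>Direct sums of complexes\<close>

lemma coh_pres_bmap:
  assumes "is_complex A X" "is_complex A Y" "coh_pres X n k e q" "coh_pres Y n k' e' q'"
    "cdiff Z n = bmap (cdiff X n) (cdiff Y n)" "cdiff Z (n - 1) = bmap (cdiff X (n - 1)) (cdiff Y (n - 1))"
    "cobj Z (n - 1) = bsum A (cobj X (n - 1)) (cobj Y (n - 1))"
  shows "coh_pres Z n (bmap k k') (bmap e e') (bmap q q')"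
  using coh_presD[OF assms(3,1)] coh_presD[OF assms(4,2)] assms
  by (auto simp: coh_pres_def bmap_comp kernel_bmap cokernel_bmap)

definition ccop :: "('o, 'm) cplx \<Rightarrow> ('o, 'm) cplx \<Rightarrow> ('o, 'm) cplx" where
  "ccop X Y = \<lparr>cobj = (\<lambda>n. bsum A (cobj X n) (cobj Y n)), cdiff = (\<lambda>n. bmap (cdiff X n) (cdiff Y n))\<rparr>"

definition cj1 :: "('o, 'm) cplx \<Rightarrow> ('o, 'm) cplx \<Rightarrow> ('o, 'm) chmap" where
  "cj1 X Y = \<lparr>csrc = X, ctgt = ccop X Y, cmap = (\<lambda>n. binj1 A (cobj X n) (cobj Y n))\<rparr>"

definition cj2 :: "('o, 'm) cplx \<Rightarrow> ('o, 'm) cplx \<Rightarrow> ('o, 'm) chmap" where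
  "cj2 X Y = \<lparr>csrc = Y, ctgt = ccop X Y, cmap = (\<lambda>n. binj2 A (cobj X n) (cobj Y n))\<rparr>"

definition ccpr :: "('o, 'm) chmap \<Rightarrow> ('o, 'm) chmap \<Rightarrow> ('o, 'm) chmap" where
  "ccpr f g = \<lparr>csrc = ccop (csrc f) (csrc g), ctgt = ctgt f,
     cmap = (\<lambda>n. (cmap f n \<cdot> bproj1 A (cobj (csrc f) n) (cobj (csrc g) n)) \<oplus>\<^sub>h
                 (cmap g n \<cdot> bproj2 A (cobj (csrc f) n) (cobj (csrc g) n)))\<rparr>"

lemma bounded2:
  assumes "is_bounded A X" "is_bounded A Y"
  obtains N where "\<And>n. \<bar>n\<bar> > N \<Longrightarrow> is_zero_obj A (cobj X n)" "\<And>n. \<bar>n\<bar> > N \<Longrightarrow> is_zero_obj A (cobj Y n)"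
proof -
  obtain N M where "\<forall>n. \<bar>n\<bar> > N \<longrightarrow> is_zero_obj A (cobj X n)" "\<forall>n. \<bar>n\<bar> > M \<longrightarrow> is_zero_obj A (cobj Y n)"
    using assms by (auto simp: is_bounded_def)
  then show thesis using that[of "max N M"] by auto
qed

lemma ccop_Obj:
  assumes "X \<in> Obj (Cb A)" "Y \<in> Obj (Cb A)"
  shows "ccop X Y \<in> Obj (Cb A)"
proof -
  have X: "is_complex A X" "is_bounded A X" and Y: "is_complex A Y" "is_bounded A Y" using assms by auto
  have "is_complex A (ccop X Y)"
    by (rule complexI) (use X Y in \<open>auto simp: ccop_def bmap_comp bmap_zero\<close>)
  moreover have "is_bounded A (ccop X Y)"
    using bounded2[OF X(2) Y(2)] is_zero_bsum unfolding is_bounded_def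
    by (metis (no_types, lifting) ccop_def cplx.simps(1))
  ultimately show ?thesis by simp
qed

lemma chmap_eqI:
  assumes "csrc f = csrc g" "ctgt f = ctgt g" "\<And>n. cmap f n = cmap g n"
  shows "f = (g :: ('o, 'm) chmap)"
  by (rule chmap.equality) (use assms in auto)

lemma localized_coproducts_Cb: "localized_coproducts (Cb A) (quasi_isos A) ccop cj1 cj2 ccpr"
proof -
  interpret K: category "Cb A" by (rule category_Cb)
  have j: "cj1 X Y \<in> Hom (Cb A) X (ccop X Y) \<and> cj2 X Y \<in> Hom (Cb A) Y (ccop X Y)"
    if "X \<in> Obj (Cb A)" "Y \<in> Obj (Cb A)" for X Y
  proof -
    have c: "is_complex A X" "is_complex A Y" using that by auto
    have "is_chain_map A (cj1 X Y)" "is_chain_map A (cj2 X Y)"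
      by (rule chainI; use c in \<open>auto simp: cj1_def cj2_def ccop_def\<close>)+
    then show ?thesis using that ccop_Obj[OF that] by (auto simp: Cb_Arr) (auto simp: cj1_def cj2_def)
  qed
  have pair: "ccpr f g \<in> Hom (Cb A) (ccop X Y) T"
    if f: "f \<in> Hom (Cb A) X T" and g: "g \<in> Hom (Cb A) Y T" for f g X Y T
  proof -
    have c: "is_complex A X" "is_complex A Y" "is_complex A T" "csrc f = X" "csrc g = Y" "ctgt f = T" "ctgt g = T"
      "is_chain_map A f" "is_chain_map A g"
      using f g by (auto simp: Cb_Arr)
    have o: "X \<in> Obj (Cb A)" "Y \<in> Obj (Cb A)" "T \<in> Obj (Cb A)" using f g by (auto simp: Cb_Arr)
    have "is_chain_map A (ccpr f g)"
    proof (rule chainI)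
      fix n
      show "cmap (ccpr f g) (n + 1) \<cdot> cdiff (csrc (ccpr f g)) n = cdiff (ctgt (ccpr f g)) n \<cdot> cmap (ccpr f g) n"
        using c comp_extend[OF chain_simps(4)[OF c(8), of n], of "bproj1 A (cobj X n) (cobj Y n)"]
          comp_extend[OF chain_simps(4)[OF c(9), of n], of "bproj2 A (cobj X n) (cobj Y n)"]
        by (simp add: ccpr_def ccop_def)
    qed (use c in \<open>auto simp: ccpr_def ccop_def\<close>)
    then show ?thesis using o ccop_Obj[OF o(1,2)] c by (auto simp: Cb_Arr) (auto simp: ccpr_def)
  qed
  show ?thesis
  proof (unfold_locales)
    fix X Y assume "X \<in> Obj (Cb A)" "Y \<in> Obj (Cb A)"
    then show "cj1 X Y \<in> Hom (Cb A) X (ccop X Y) \<and> cj2 X Y \<in> Hom (Cb A) Y (ccop X Y)" by (rule j)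
  next
    fix f X T g Y assume f: "f \<in> Hom (Cb A) X T" and g: "g \<in> Hom (Cb A) Y T"
    have c: "is_complex A X" "is_complex A Y" "is_complex A T" "csrc f = X" "csrc g = Y" "ctgt f = T" "ctgt g = T"
      "is_chain_map A f" "is_chain_map A g"
      using f g by (auto simp: Cb_Arr)
    have "ccpr f g \<cdot>\<^bsub>Cb A\<^esub> cj1 X Y = f" "ccpr f g \<cdot>\<^bsub>Cb A\<^esub> cj2 X Y = g"
      by (rule chmap_eqI; use c in \<open>simp add: ccpr_def cj1_def cj2_def\<close>)+
    then show "ccpr f g \<in> Hom (Cb A) (ccop X Y) T \<and> ccpr f g \<cdot>\<^bsub>Cb A\<^esub> cj1 X Y = f \<and>
        ccpr f g \<cdot>\<^bsub>Cb A\<^esub> cj2 X Y = g"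
      using pair[OF f g] by simp
  next
    fix X Y h T h'
    assume X: "X \<in> Obj (Cb A)" and Y: "Y \<in> Obj (Cb A)"
      and h: "h \<in> Hom (Cb A) (ccop X Y) T" and h': "h' \<in> Hom (Cb A) (ccop X Y) T"
      and e1: "h \<cdot>\<^bsub>Cb A\<^esub> cj1 X Y = h' \<cdot>\<^bsub>Cb A\<^esub> cj1 X Y" and e2: "h \<cdot>\<^bsub>Cb A\<^esub> cj2 X Y = h' \<cdot>\<^bsub>Cb A\<^esub> cj2 X Y"
    have c: "is_complex A X" "is_complex A Y" "is_complex A T" "csrc h = ccop X Y" "csrc h' = ccop X Y"
      "ctgt h = T" "ctgt h' = T" "is_chain_map A h" "is_chain_map A h'"
      using h h' X Y by (auto simp: Cb_Arr)
    have E1: "cmap h n \<cdot> binj1 A (cobj X n) (cobj Y n) = cmap h' n \<cdot> binj1 A (cobj X n) (cobj Y n)" for n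
      using fun_cong[OF arg_cong[OF e1, of cmap], of n] by (simp add: cj1_def)
    have E2: "cmap h n \<cdot> binj2 A (cobj X n) (cobj Y n) = cmap h' n \<cdot> binj2 A (cobj X n) (cobj Y n)" for n
      using fun_cong[OF arg_cong[OF e2, of cmap], of n] by (simp add: cj2_def)
    show "h = h'"
    proof (rule chmap_eqI)
      show "cmap h n = cmap h' n" for n
        by (rule bsum_coext[OF _ _ _ _ _ _ E1 E2]) (use c in \<open>auto simp: ccop_def\<close>)
    qed (use c in auto)
  next
    fix X assume X: "X \<in> Obj (Cb A)"
    then have c: "is_complex A X" by simp
    have "coh_iso_at (Ident (Cb A) X) n" for n
      using coh_presD[OF chosen_coh_pres[OF c] c, of n]
      by (intro coh_iso_atI[of "Ident (Cb A) X" n "cocyc A X n" "cobd A X n" "coh_proj A X n"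
            "cocyc A X n" "cobd A X n" "coh_proj A X n" "Ident A (Dom A (cocyc A X n))" "Ident A (Cod A (coh_proj A X n))"])
         (auto intro: is_iso_Ident simp: chosen_coh_pres c)
    then show "Ident (Cb A) X \<in> quasi_isos A" using K.ident_hom[OF X] by (auto simp: quasi_isos_iff)
  next
    fix f X X' g Y Y'
    assume f: "f \<in> Hom (Cb A) X X'" and g: "g \<in> Hom (Cb A) Y Y'" and W: "f \<in> quasi_isos A" "g \<in> quasi_isos A"
    let ?b = "ccpr (cj1 X' Y' \<cdot>\<^bsub>Cb A\<^esub> f) (cj2 X' Y' \<cdot>\<^bsub>Cb A\<^esub> g)"
    have c: "is_complex A X" "is_complex A Y" "is_complex A X'" "is_complex A Y'" "csrc f = X" "csrc g = Y"
      "ctgt f = X'" "ctgt g = Y'" "is_chain_map A f" "is_chain_map A g"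
      using f g by (auto simp: Cb_Arr)
    have o: "X' \<in> Obj (Cb A)" "Y' \<in> Obj (Cb A)" using f g by (auto simp: Cb_Arr)
    have b: "?b \<in> Hom (Cb A) (ccop X Y) (ccop X' Y')"
      using j[OF o] by (intro pair K.comp_hom[OF f] K.comp_hom[OF g]) auto
    have cop_map: "csrc ?b = ccop X Y" "ctgt ?b = ccop X' Y'" "cmap ?b n = bmap (cmap f n) (cmap g n)" for n
      using c by (simp_all add: ccpr_def cj1_def cj2_def bmap_def)
    have "coh_iso_at ?b n" for n
    proof -
      obtain k e q k' e' q' z h where 1: "coh_pres X n k e q" "coh_pres X' n k' e' q'"
        "z \<in> Hom A (Dom A k) (Dom A k')" "k' \<cdot> z = cmap f n \<cdot> k"
        "h \<in> Hom A (Cod A q) (Cod A q')" "h \<cdot> q = q' \<cdot> z" "is_iso A h"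
        using W(1) c unfolding quasi_isos_iff coh_iso_at_def by blast
      obtain k2 e2 q2 k2' e2' q2' z2 h2 where 2: "coh_pres Y n k2 e2 q2" "coh_pres Y' n k2' e2' q2'"
        "z2 \<in> Hom A (Dom A k2) (Dom A k2')" "k2' \<cdot> z2 = cmap g n \<cdot> k2"
        "h2 \<in> Hom A (Cod A q2) (Cod A q2')" "h2 \<cdot> q2 = q2' \<cdot> z2" "is_iso A h2"
        using W(2) c unfolding quasi_isos_iff coh_iso_at_def by blast
      note P = coh_presD[OF 1(1) c(1)] coh_presD[OF 1(2) c(3)] coh_presD[OF 2(1) c(2)] coh_presD[OF 2(2) c(4)]
      show ?thesis
      proof (rule coh_iso_atI)
        show "coh_pres (csrc ?b) n (bmap k k2) (bmap e e2) (bmap q q2)"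
          unfolding cop_map by (rule coh_pres_bmap[OF c(1,2) 1(1) 2(1)]) (auto simp: ccop_def)
        show "coh_pres (ctgt ?b) n (bmap k' k2') (bmap e' e2') (bmap q' q2')"
          unfolding cop_map by (rule coh_pres_bmap[OF c(3,4) 1(2) 2(2)]) (auto simp: ccop_def)
        show "bmap z z2 \<in> Hom A (Dom A (bmap k k2)) (Dom A (bmap k' k2'))" using 1(3) 2(3) P by auto
        show "bmap k' k2' \<cdot> bmap z z2 = cmap ?b n \<cdot> bmap k k2"
          unfolding cop_map using 1(3,4) 2(3,4) P c by (simp add: bmap_comp)
        show "bmap h h2 \<in> Hom A (Cod A (bmap q q2)) (Cod A (bmap q' q2'))" using 1(5) 2(5) P by auto
        show "bmap h h2 \<cdot> bmap q q2 = bmap q' q2' \<cdot> bmap z z2"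
          using 1(3,5,6) 2(3,5,6) P by (simp add: bmap_comp)
        show "is_iso A (bmap h h2)" by (rule is_iso_bmap[OF 1(7) 2(7)])
      qed
    qed
    then show "?b \<in> quasi_isos A" using b by (auto simp: quasi_isos_iff)
  qed
qed

section \<open>Complexes with zero differential\<close>

definition zero_diff :: "(int \<Rightarrow> 'o) \<Rightarrow> ('o, 'm) cplx" where
  "zero_diff V = \<lparr>cobj = V, cdiff = (\<lambda>n. HZero A (V n) (V (n + 1)))\<rparr>"

lemma zero_diff_simps [simp]: "cobj (zero_diff V) = V" "cdiff (zero_diff V) n = HZero A (V n) (V (n + 1))"
  by (auto simp: zero_diff_def)

lemma zero_diff_complex [simp]:
  assumes "\<And>n. V n \<in> Obj A"
  shows "is_complex A (zero_diff V)"
  by (rule complexI) (use assms in \<open>auto simp: index_simps\<close>)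

text \<open>For vanishing differentials the coproduct of complexes is the family of biproducts on the nose, so
  decompositions in each degree give decompositions of complexes.\<close>

lemma zero_diff_ccop:
  assumes "\<And>n. V n \<in> Obj A" "\<And>n. V' n \<in> Obj A"
  shows "ccop (zero_diff V) (zero_diff V') = zero_diff (\<lambda>n. bsum A (V n) (V' n))"
  using assms by (auto simp: ccop_def zero_diff_def bmap_zero)

lemma zero_diff_isomorphic:
  assumes V: "zero_diff V \<in> Obj (Cb A)" and V': "zero_diff V' \<in> Obj (Cb A)" and iso: "\<And>n. isomorphic A (V n) (V' n)"
  shows "isomorphic (Cb A) (zero_diff V) (zero_diff V')"
proof -
  interpret K: category "Cb A" by (rule category_Cb)
  have o: "V n \<in> Obj A" "V' n \<in> Obj A" for n
    using V V' complex_simps(1)[of "zero_diff V" n] complex_simps(1)[of "zero_diff V'" n] by auto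
  have "\<exists>f g. f \<in> Hom A (V n) (V' n) \<and> g \<in> Hom A (V' n) (V n) \<and> g \<cdot> f = Ident A (V n) \<and> f \<cdot> g = Ident A (V' n)" for n
    using iso[of n] unfolding isomorphic_def by (metis is_isoE)
  then obtain f g where fg: "\<And>n. f n \<in> Hom A (V n) (V' n)" "\<And>n. g n \<in> Hom A (V' n) (V n)"
    "\<And>n. g n \<cdot> f n = Ident A (V n)" "\<And>n. f n \<cdot> g n = Ident A (V' n)"
    by metis
  let ?f = "\<lparr>csrc = zero_diff V, ctgt = zero_diff V', cmap = f\<rparr>" and ?g = "\<lparr>csrc = zero_diff V', ctgt = zero_diff V, cmap = g\<rparr>"
  have "is_chain_map A ?f" "is_chain_map A ?g"
    by (rule chainI; use fg o in simp)+
  then show ?thesis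
    using V V' fg by (intro K.isomorphicI[of ?f _ _ ?g]) (auto simp: Cb_Arr)
qed

lemma Cb_zero_initial:
  assumes Z: "Z \<in> Obj (Cb A)" and zero: "\<And>n. is_zero_obj A (cobj Z n)" and X: "X \<in> Obj (Cb A)"
  shows "\<exists>!f. f \<in> Hom (Cb A) Z X" "\<exists>!f. f \<in> Hom (Cb A) X Z"
proof -
  have c: "is_complex A X" "is_complex A Z" using X Z by auto
  let ?f = "\<lparr>csrc = Z, ctgt = X, cmap = (\<lambda>n. HZero A (cobj Z n) (cobj X n))\<rparr>"
  let ?g = "\<lparr>csrc = X, ctgt = Z, cmap = (\<lambda>n. HZero A (cobj X n) (cobj Z n))\<rparr>"
  have "is_chain_map A ?f" "is_chain_map A ?g" by (rule chainI; use c in simp)+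
  then have a: "?f \<in> Arr (Cb A)" "?g \<in> Arr (Cb A)" using Z X by (auto simp: Cb_Arr)
  show "\<exists>!f. f \<in> Hom (Cb A) Z X"
  proof (rule ex1I[of _ ?f])
    show "f = ?f" if "f \<in> Hom (Cb A) Z X" for f
    proof (rule chmap_eqI)
      show "cmap f n = cmap ?f n" for n
        using zero_obj_Arr[of "cmap f n"] that zero[of n] chain_simps[of f n] by (auto simp: Cb_Arr)
    qed (use that in auto)
  qed (use a in auto)
  show "\<exists>!f. f \<in> Hom (Cb A) X Z"
  proof (rule ex1I[of _ ?g])
    show "f = ?g" if "f \<in> Hom (Cb A) X Z" for f
    proof (rule chmap_eqI)
      show "cmap f n = cmap ?g n" for n
        using zero_obj_Arr[of "cmap f n"] that zero[of n] chain_simps[of f n] by (auto simp: Cb_Arr)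
    qed (use that in auto)
  qed (use a in auto)
qed

section \<open>Mapping cones\<close>

lemma cone_cobj [simp]: "cobj (cone A f) n = bsum A (cobj (csrc f) (n + 1)) (cobj (ctgt f) n)"
  by (simp add: cone_def Let_def)

lemma cone_cdiff:
  assumes "is_complex A (csrc f)" "is_complex A (ctgt f)" "is_chain_map A f"
  shows "cdiff (cone A f) n \<in> Arr A"
    "Dom A (cdiff (cone A f) n) = bsum A (cobj (csrc f) (n + 1)) (cobj (ctgt f) n)"
    "Cod A (cdiff (cone A f) n) = bsum A (cobj (csrc f) (n + 2)) (cobj (ctgt f) (n + 1))"
    "bproj1 A (cobj (csrc f) (n + 2)) (cobj (ctgt f) (n + 1)) \<cdot> cdiff (cone A f) n =
      hneg A (cdiff (csrc f) (n + 1) \<cdot> bproj1 A (cobj (csrc f) (n + 1)) (cobj (ctgt f) n))"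
    "bproj2 A (cobj (csrc f) (n + 2)) (cobj (ctgt f) (n + 1)) \<cdot> cdiff (cone A f) n =
      (cmap f (n + 1) \<cdot> bproj1 A (cobj (csrc f) (n + 1)) (cobj (ctgt f) n)) \<oplus>\<^sub>h
      (cdiff (ctgt f) n \<cdot> bproj2 A (cobj (csrc f) (n + 1)) (cobj (ctgt f) n))"
  using assms by (simp_all add: cone_def Let_def index_simps)

lemma cone_Obj:
  assumes "f \<in> Arr (Cb A)"
  shows "cone A f \<in> Obj (Cb A)"
proof -
  let ?X = "csrc f" and ?Y = "ctgt f"
  have c: "is_complex A ?X" "is_bounded A ?X" "is_complex A ?Y" "is_bounded A ?Y" "is_chain_map A f"
    using assms by (auto simp: Cb_Arr)
  note d = cone_cdiff[OF c(1,3,5)]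
  have "is_complex A (cone A f)"
  proof (rule complexI)
    fix n :: int
    have i: "n + 1 + 1 = n + 2" "n + 1 + 2 = n + 3" by auto
    note d1 = d[of "n + 1", unfolded i] and d0 = d[of n]
    let ?p1 = "bproj1 A (cobj ?X (n + 1)) (cobj ?Y n)" and ?p2 = "bproj2 A (cobj ?X (n + 1)) (cobj ?Y n)"
    have dX: "cdiff ?X (n + 2) \<cdot> cdiff ?X (n + 1) = HZero A (cobj ?X (n + 1)) (cobj ?X (n + 3))"
      using complex_simps(5)[OF c(1), of "n + 1"] by (simp only: i)
    have fd: "cmap f (n + 2) \<cdot> cdiff ?X (n + 1) = cdiff ?Y (n + 1) \<cdot> cmap f (n + 1)"
      using chain_simps(4)[OF c(5), of "n + 1"] by (simp only: i)
    have cd: "Cod A (cdiff ?X (n + 1)) = cobj ?X (n + 2)" "Cod A (cdiff ?X (n + 2)) = cobj ?X (n + 3)"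
      "Cod A (cdiff ?Y (n + 1)) = cobj ?Y (n + 2)"
      using c complex_simps(4)[OF c(1), of "n + 1"] complex_simps(4)[OF c(1), of "n + 2"]
        complex_simps(4)[OF c(3), of "n + 1"] by (auto simp: algebra_simps)
    have e1: "bproj1 A (cobj ?X (n + 3)) (cobj ?Y (n + 2)) \<cdot> cdiff (cone A f) (n + 1) \<cdot> cdiff (cone A f) n =
        HZero A (bsum A (cobj ?X (n + 1)) (cobj ?Y n)) (cobj ?X (n + 3))"
      by (subst comp_extend[OF d1(4)]) (use c d0 d1 cd comp_extend[OF dX, of ?p1] in auto)
    have "bproj2 A (cobj ?X (n + 3)) (cobj ?Y (n + 2)) \<cdot> cdiff (cone A f) (n + 1) \<cdot> cdiff (cone A f) n =
        hneg A (cmap f (n + 2) \<cdot> cdiff ?X (n + 1) \<cdot> ?p1) \<oplus>\<^sub>h ((cdiff ?Y (n + 1) \<cdot> cmap f (n + 1) \<cdot> ?p1) \<oplus>\<^sub>h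
          (cdiff ?Y (n + 1) \<cdot> cdiff ?Y n \<cdot> ?p2))"
      by (subst comp_extend[OF d1(5)]) (use c d0 d1 cd in auto)
    also have "cmap f (n + 2) \<cdot> cdiff ?X (n + 1) \<cdot> ?p1 = cdiff ?Y (n + 1) \<cdot> cmap f (n + 1) \<cdot> ?p1"
      using comp_extend[OF fd, of ?p1] c cd by simp
    also have "cdiff ?Y (n + 1) \<cdot> cdiff ?Y n \<cdot> ?p2 = HZero A (bsum A (cobj ?X (n + 1)) (cobj ?Y n)) (cobj ?Y (n + 2))"
      using comp_extend[OF complex_simps(5)[OF c(3), of n], of ?p2] c by simp
    finally have e2: "bproj2 A (cobj ?X (n + 3)) (cobj ?Y (n + 2)) \<cdot> cdiff (cone A f) (n + 1) \<cdot> cdiff (cone A f) n =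
        HZero A (bsum A (cobj ?X (n + 1)) (cobj ?Y n)) (cobj ?Y (n + 2))"
      using c cd by simp
    have "cdiff (cone A f) (n + 1) \<cdot> cdiff (cone A f) n =
       HZero A (bsum A (cobj ?X (n + 1)) (cobj ?Y n)) (bsum A (cobj ?X (n + 3)) (cobj ?Y (n + 2)))"
      by (rule bsum_ext[of "cobj ?X (n + 3)" "cobj ?Y (n + 2)"]) (use c d0 d1 e1 e2 in auto)
    then show "cdiff (cone A f) (n + 1) \<cdot> cdiff (cone A f) n = HZero A (cobj (cone A f) n) (cobj (cone A f) (n + 2))"
      by (simp add: algebra_simps)
  qed (use c d in \<open>auto simp: index_simps\<close>)
  moreover have "is_bounded A (cone A f)"
  proof -
    obtain N where N: "\<And>n. \<bar>n\<bar> > N \<Longrightarrow> is_zero_obj A (cobj ?X n)" "\<And>n. \<bar>n\<bar> > N \<Longrightarrow> is_zero_obj A (cobj ?Y n)"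
      using bounded2[OF c(2,4)] by blast
    show ?thesis unfolding is_bounded_def
      by (rule exI[of _ "N + 1"]) (auto intro!: is_zero_bsum N)
  qed
  ultimately show ?thesis by simp
qed

lemma cone_in_out:
  assumes "f \<in> Arr (Cb A)"
  shows "cone_in A f \<in> Hom (Cb A) (ctgt f) (cone A f)"
    "cone_out A f \<in> Hom (Cb A) (cone A f) (shift_cplx A (csrc f))"
proof -
  let ?X = "csrc f" and ?Y = "ctgt f"
  have c: "is_complex A ?X" "is_complex A ?Y" "is_chain_map A f" using assms by (auto simp: Cb_Arr)
  have o: "?X \<in> Obj (Cb A)" "?Y \<in> Obj (Cb A)" using assms by (auto simp: Cb_Arr)
  note d = cone_cdiff[OF c]
  have "is_chain_map A (cone_in A f)"
    by (rule chainI) (use c in \<open>auto simp: cone_in_def cone_def Let_def index_simps\<close>)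
  then show "cone_in A f \<in> Hom (Cb A) ?Y (cone A f)"
    using o cone_Obj[OF assms] by (auto simp: Cb_Arr) (auto simp: cone_in_def)
  have "is_chain_map A (cone_out A f)"
    by (rule chainI) (use c d in \<open>auto simp: cone_out_def index_simps shift_cplx_def\<close>)
  then show "cone_out A f \<in> Hom (Cb A) (cone A f) (shift_cplx A ?X)"
    using shift_Obj[OF o(1)] cone_Obj[OF assms] by (auto simp: Cb_Arr) (auto simp: cone_out_def)
qed

section \<open>The quotient of a complex by its cocycles\<close>

lemma is_zero_obj_kernel:
  assumes "is_kernel A f k" "is_zero_obj A (Dom A f)"
  shows "is_zero_obj A (Dom A k)"
proof -
  note k = kernelD[OF assms(1)]
  have "k = HZero A (Dom A k) (Dom A f)" using zero_obj_Arr[of k] k assms(2) by simp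
  then have "k \<cdot> Ident A (Dom A k) = k \<cdot> HZero A (Dom A k) (Dom A k)" using k by simp
  then have "Ident A (Dom A k) = HZero A (Dom A k) (Dom A k)"
    by (rule kernel_mono[OF assms(1)]) (use k in auto)
  then show ?thesis using k by (simp add: zero_obj_iff)
qed

lemma is_zero_obj_cokernel:
  assumes "is_cokernel A f q" "is_zero_obj A (Cod A f)"
  shows "is_zero_obj A (Cod A q)"
proof -
  note q = cokernelD[OF assms(1)]
  have "q = HZero A (Cod A f) (Cod A q)" using zero_obj_Arr[of q] q assms(2) by simp
  then have "Ident A (Cod A q) \<cdot> q = HZero A (Cod A q) (Cod A q) \<cdot> q" using q by simp
  then have "Ident A (Cod A q) = HZero A (Cod A q) (Cod A q)"
    by (rule cokernel_epi[OF assms(1)]) (use q in auto)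
  then show ?thesis using q by (simp add: zero_obj_iff)
qed

definition cocyc_incl :: "('o, 'm) cplx \<Rightarrow> ('o, 'm) chmap" where
  "cocyc_incl X = \<lparr>csrc = zero_diff (\<lambda>n. Dom A (cocyc A X n)), ctgt = X, cmap = cocyc A X\<rparr>"

text \<open>The coimage \<open>X\<^sup>n \<rightarrow> X\<^sup>n / Z\<^sup>n\<close>.  Since \<open>d\<close> maps into the cocycles, the quotient complex of \<open>X\<close> by its
  cocycles has zero differential.\<close>

definition coim :: "('o, 'm) cplx \<Rightarrow> int \<Rightarrow> 'm" where
  "coim X n = (SOME q. is_cokernel A (cocyc A X n) q)"

definition cone_to_coim :: "('o, 'm) cplx \<Rightarrow> ('o, 'm) chmap" where
  "cone_to_coim X = \<lparr>csrc = cone A (cocyc_incl X), ctgt = zero_diff (\<lambda>n. Cod A (coim X n)),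
     cmap = (\<lambda>n. coim X n \<cdot> bproj2 A (Dom A (cocyc A X (n + 1))) (cobj X n))\<rparr>"

lemma cocyc_incl_Arr:
  assumes "X \<in> Obj (Cb A)"
  shows "cocyc_incl X \<in> Arr (Cb A)"
proof -
  have X: "is_complex A X" "is_bounded A X" using assms by auto
  note k = coh_presD[OF chosen_coh_pres[OF X(1)] X(1)]
  have "is_chain_map A (cocyc_incl X)"
    by (rule chainI) (use X k in \<open>auto simp: cocyc_incl_def\<close>)
  moreover have "is_bounded A (zero_diff (\<lambda>n. Dom A (cocyc A X n)))"
    using X k(11) is_zero_obj_kernel unfolding is_bounded_def by (metis complex_simps(3) zero_diff_simps(1))
  ultimately show ?thesis using X k by (auto simp: Cb_Arr) (auto simp: cocyc_incl_def)
qed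

lemma coim_cokernel: "is_complex A X \<Longrightarrow> is_cokernel A (cocyc A X n) (coim X n)"
  unfolding coim_def by (rule someI_ex[OF cokernel_exists]) (auto dest: coh_presD(1)[OF chosen_coh_pres])

lemma zero_diff_coim_Obj:
  assumes "X \<in> Obj (Cb A)"
  shows "zero_diff (\<lambda>n. Cod A (coim X n)) \<in> Obj (Cb A)"
proof -
  have X: "is_complex A X" "is_bounded A X" using assms by auto
  note k = coh_presD[OF chosen_coh_pres[OF X(1)] X(1)] and q = coim_cokernel[OF X(1)]
  have "is_bounded A (zero_diff (\<lambda>n. Cod A (coim X n)))"
    using X k(2) is_zero_obj_cokernel[OF q] unfolding is_bounded_def by (metis zero_diff_simps(1))
  then show ?thesis using cokernelD[OF q] by auto
qed

text \<open>The quotient \<open>X/Z\<close> represents the cone of the inclusion \<open>Z \<rightarrow> X\<close> of the cocycles \<open>i\<close>.  Writing \<open>d\<close>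
  as \<open>i \<circ> b\<close>, the differential \<open>(z, x) \<mapsto> (0, i z + d x)\<close> of the cone has kernel
  \<open>(- b, 1) : X\<^sup>n \<rightarrow> Z\<^sup>n\<^sup>+\<^sup>1 \<oplus> X\<^sup>n\<close>; through it the previous differential becomes \<open>(i, d) : Z\<^sup>n \<oplus> X\<^sup>n\<^sup>-\<^sup>1 \<rightarrow> X\<^sup>n\<close>,
  whose image is \<open>Z\<^sup>n\<close> because \<open>d\<close> lands in the cocycles.  Hence the cohomology of the cone is \<open>X\<^sup>n / Z\<^sup>n\<close>.\<close>

lemma cone_to_coim_quasi_iso:
  assumes "X \<in> Obj (Cb A)"
  shows "cone_to_coim X \<in> quasi_isos A"
proof -
  have X: "is_complex A X" "is_bounded A X" using assms by auto
  let ?K = "\<lambda>n. Dom A (cocyc A X n)" and ?k = "cocyc A X" and ?f = "cocyc_incl X"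
  have f: "?f \<in> Arr (Cb A)" by (rule cocyc_incl_Arr[OF assms])
  then have c: "is_complex A (csrc ?f)" "is_complex A (ctgt ?f)" "is_chain_map A ?f" by (auto simp: Cb_Arr)
  note k = coh_presD[OF chosen_coh_pres[OF X(1)] X(1)]
  have kd: "?k n \<in> Arr A" "Dom A (?k n) = ?K n" "Cod A (?k n) = cobj X n" "?K n \<in> Obj A" for n
    using k(1,2)[of n] by auto
  note q = cokernelD[OF coim_cokernel[OF X(1)]]
  have qd: "coim X n \<in> Arr A" "Dom A (coim X n) = cobj X n" "coim X n \<cdot> ?k n = HZero A (?K n) (Cod A (coim X n))" for n
    using q[of n] kd[of n] by auto
  have sel: "csrc ?f = zero_diff ?K" "ctgt ?f = X" "cmap ?f = ?k" by (auto simp: cocyc_incl_def)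
  note d = cone_cdiff[OF c, unfolded sel zero_diff_simps]
  \<comment> \<open>the differential factors through the cocycles of the next degree\<close>
  have b: "cobd A X (n + 1) \<in> Arr A" "Dom A (cobd A X (n + 1)) = cobj X n" "Cod A (cobd A X (n + 1)) = ?K (n + 1)"
    "?k (n + 1) \<cdot> cobd A X (n + 1) = cdiff X n" for n
    using k(3-6)[of "n + 1"] by auto
  have qd0: "coim X (n + 1) \<cdot> cdiff X n = HZero A (cobj X n) (Cod A (coim X (n + 1)))" for n
  proof -
    have "coim X (n + 1) \<cdot> ?k (n + 1) \<cdot> cobd A X (n + 1) = HZero A (cobj X n) (Cod A (coim X (n + 1)))"
      using comp_extend[OF qd(3)[of "n + 1"], of "cobd A X (n + 1)"] b qd kd by simp
    then show ?thesis using b(4) by simp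
  qed
  have bk: "cobd A X (n + 1) \<cdot> ?k n = HZero A (?K n) (?K (n + 1))" for n
    by (rule kernel_mono[OF k(11)[of "n + 1"]])
       (use b kd k(10) X comp_extend[OF b(4)[of n], of "?k n"] in auto)
  have bd: "cobd A X (n + 1) \<cdot> cdiff X (n - 1) = HZero A (cobj X (n - 1)) (?K (n + 1))" for n
    by (rule kernel_mono[OF k(11)[of "n + 1"]])
       (use b kd k(10) X comp_extend[OF b(4)[of n], of "cdiff X (n - 1)"] in auto)
  have "is_chain_map A (cone_to_coim X)"
  proof (rule chainI)
    fix n :: int
    have i: "n + 1 + 1 = n + 2" by simp
    show "cmap (cone_to_coim X) (n + 1) \<cdot> cdiff (csrc (cone_to_coim X)) n =
        cdiff (ctgt (cone_to_coim X)) n \<cdot> cmap (cone_to_coim X) n"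
      using X d kd qd(1,2) comp_extend[OF qd(3)[of "n + 1"], of "bproj1 A (?K (n + 1)) (cobj X n)"]
        comp_extend[OF qd0[of n], of "bproj2 A (?K (n + 1)) (cobj X n)"]
      by (simp add: cone_to_coim_def i)
  qed (use X d kd qd(1,2) in \<open>auto simp: cone_to_coim_def sel\<close>)
  then have a: "cone_to_coim X \<in> Arr (Cb A)"
    using cone_Obj[OF f] zero_diff_coim_Obj[OF assms] by (auto simp: Cb_Arr) (auto simp: cone_to_coim_def)
  have "coh_iso_at (cone_to_coim X) n" for n
  proof -
    let ?p1 = "bproj1 A (?K (n + 1)) (cobj X n)" and ?p2 = "bproj2 A (?K (n + 1)) (cobj X n)"
    let ?i1 = "binj1 A (?K (n + 1)) (cobj X n)" and ?i2 = "binj2 A (?K (n + 1)) (cobj X n)"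
    let ?r1 = "bproj1 A (?K n) (cobj X (n - 1))" and ?r2 = "bproj2 A (?K n) (cobj X (n - 1))"
    let ?j1 = "binj1 A (?K n) (cobj X (n - 1))" and ?j2 = "binj2 A (?K n) (cobj X (n - 1))"
    let ?s = "(?i1 \<cdot> hneg A (cobd A X (n + 1))) \<oplus>\<^sub>h ?i2"
    let ?e = "(?k n \<cdot> ?r1) \<oplus>\<^sub>h (cdiff X (n - 1) \<cdot> ?r2)"
    let ?D = "cdiff (cone A ?f) n" and ?D' = "cdiff (cone A ?f) (n - 1)"
    \<comment> \<open>the zero-differential complex is presented by identities, so its comparison map is \<open>coim X n\<close> itself\<close>
    let ?V = "\<lambda>n. Cod A (coim X n)"
    have V: "?V n \<in> Obj A" for n using qd(1)[of n] by simp
    have s: "?s \<in> Arr A" "Dom A ?s = cobj X n" "Cod A ?s = bsum A (?K (n + 1)) (cobj X n)"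
      "?p1 \<cdot> ?s = hneg A (cobd A X (n + 1))" "?p2 \<cdot> ?s = Ident A (cobj X n)"
      using X b[of n] kd by auto
    have e: "?e \<in> Arr A" "Dom A ?e = bsum A (?K n) (cobj X (n - 1))" "Cod A ?e = cobj X n"
      "?e \<cdot> ?j1 = ?k n" "?e \<cdot> ?j2 = cdiff X (n - 1)"
      using X kd by auto
    note dn = d[of n] and dn' = d[of "n - 1", unfolded diff_add_cancel index_simps]
    have D1: "bproj1 A (?K (n + 2)) (cobj X (n + 1)) \<cdot> ?D = HZero A (bsum A (?K (n + 1)) (cobj X n)) (?K (n + 2))"
      using dn(4) X kd by (simp add: index_simps)
    have D1': "?p1 \<cdot> ?D' = HZero A (bsum A (?K n) (cobj X (n - 1))) (?K (n + 1))"
      using dn'(4) X kd by simp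
    have D2': "?p2 \<cdot> ?D' = ?e" using dn'(5) by simp
    have ker: "is_kernel A ?D ?s"
    proof (rule kernelI)
      show "?D \<cdot> ?s = HZero A (Dom A ?s) (Cod A ?D)"
      proof (rule bsum_ext[of "?K (n + 2)" "cobj X (n + 1)"])
        show "bproj1 A (?K (n + 2)) (cobj X (n + 1)) \<cdot> ?D \<cdot> ?s =
           bproj1 A (?K (n + 2)) (cobj X (n + 1)) \<cdot> HZero A (Dom A ?s) (Cod A ?D)"
          by (subst comp_extend[OF D1]) (use X kd dn s in auto)
        show "bproj2 A (?K (n + 2)) (cobj X (n + 1)) \<cdot> ?D \<cdot> ?s =
           bproj2 A (?K (n + 2)) (cobj X (n + 1)) \<cdot> HZero A (Dom A ?s) (Cod A ?D)"
          by (subst comp_extend[OF dn(5)]) (use X kd dn s b[of n] in \<open>auto simp del: comp_hplus(2)\<close>)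
      qed (use X kd dn s in auto)
    next
      fix g assume g: "g \<in> Arr A" "Cod A g = Dom A ?D" "?D \<cdot> g = HZero A (Dom A g) (Cod A ?D)"
      have "(?k (n + 1) \<cdot> ?p1 \<cdot> g) \<oplus>\<^sub>h (cdiff X n \<cdot> ?p2 \<cdot> g) = bproj2 A (?K (n + 2)) (cobj X (n + 1)) \<cdot> ?D \<cdot> g"
        by (subst comp_extend[OF dn(5)]) (use X kd dn g(1,2) in auto)
      also have "\<dots> = HZero A (Dom A g) (cobj X (n + 1))" unfolding g(3) using X kd dn g(1) by simp
      finally have z: "(?k (n + 1) \<cdot> ?p1 \<cdot> g) \<oplus>\<^sub>h (cdiff X n \<cdot> ?p2 \<cdot> g) = HZero A (Dom A g) (cobj X (n + 1))" .
      have p1: "?p1 \<cdot> g = hneg A (cobd A X (n + 1) \<cdot> ?p2 \<cdot> g)"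
      proof (rule kernel_mono[OF k(11)[of "n + 1"]])
        have "?k (n + 1) \<cdot> ?p1 \<cdot> g = hneg A (cdiff X n \<cdot> ?p2 \<cdot> g)"
          by (subst eq_hneg_iff) (use X kd dn g(1,2) z in auto)
        also have "cdiff X n \<cdot> ?p2 \<cdot> g = ?k (n + 1) \<cdot> cobd A X (n + 1) \<cdot> ?p2 \<cdot> g"
          by (subst comp_extend[OF b(4)]) (use X kd dn g(1,2) b[of n] in auto)
        finally show "?k (n + 1) \<cdot> ?p1 \<cdot> g = ?k (n + 1) \<cdot> hneg A (cobd A X (n + 1) \<cdot> ?p2 \<cdot> g)"
          using X kd dn g(1,2) b[of n] by simp
      qed (use X kd dn g(1,2) b[of n] in auto)
      have "?s \<cdot> ?p2 \<cdot> g = g"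
      proof (rule bsum_ext[of "?K (n + 1)" "cobj X n"])
        show "?p1 \<cdot> ?s \<cdot> ?p2 \<cdot> g = ?p1 \<cdot> g"
          unfolding p1 by (subst comp_extend[OF s(4)]) (use X kd dn g(1,2) b[of n] s in auto)
        show "?p2 \<cdot> ?s \<cdot> ?p2 \<cdot> g = ?p2 \<cdot> g"
          by (subst comp_extend[OF s(5)]) (use X kd dn g(1,2) b[of n] s in auto)
      qed (use X kd dn g(1,2) s in auto)
      then show "\<exists>h. h \<in> Arr A \<and> Dom A h = Dom A g \<and> Cod A h = Dom A ?s \<and> ?s \<cdot> h = g"
        using X kd dn g(1,2) s by (intro exI[of _ "?p2 \<cdot> g"]) auto
    next
      fix h h' assume h: "?s \<cdot> h = ?s \<cdot> h'" "h \<in> Arr A" "h' \<in> Arr A" "Cod A h = Dom A ?s" "Cod A h' = Dom A ?s"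
        "Dom A h = Dom A h'"
      have "?p2 \<cdot> ?s \<cdot> h = ?p2 \<cdot> ?s \<cdot> h'" by (simp only: h(1))
      moreover have "?p2 \<cdot> ?s \<cdot> h = h" "?p2 \<cdot> ?s \<cdot> h' = h'"
        by (subst comp_extend[OF s(5)]; use X kd h(2-) s in auto)+
      ultimately show "h = h'" by simp
    qed (use X kd dn s in auto)
    have fac: "?s \<cdot> ?e = ?D'"
    proof (rule bsum_ext[of "?K (n + 1)" "cobj X n"])
      have "?p1 \<cdot> ?s \<cdot> ?e = hneg A (cobd A X (n + 1)) \<cdot> ?e"
        by (subst comp_extend[OF s(4)]) (use X kd s e in auto)
      also have "\<dots> = HZero A (bsum A (?K n) (cobj X (n - 1))) (?K (n + 1))"
        using X kd b[of n] comp_extend[OF bk[of n], of ?r1] comp_extend[OF bd[of n], of ?r2] by simp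
      finally show "?p1 \<cdot> ?s \<cdot> ?e = ?p1 \<cdot> ?D'" using D1' by simp
      show "?p2 \<cdot> ?s \<cdot> ?e = ?p2 \<cdot> ?D'"
        unfolding D2' by (subst comp_extend[OF s(5)]) (use X kd s e in auto)
    qed (use X kd s e dn' in auto)
    have cok: "is_cokernel A ?e (coim X n)"
    proof (rule cokernelI)
      have z: "coim X n \<cdot> cdiff X (n - 1) = HZero A (cobj X (n - 1)) (Cod A (coim X n))" using qd0[of "n - 1"] by simp
      show "coim X n \<cdot> ?e = HZero A (Dom A ?e) (Cod A (coim X n))"
        using X kd e qd[of n] comp_extend[OF qd(3)[of n], of ?r1] comp_extend[OF z, of ?r2] by simp
    next
      fix g assume g: "g \<in> Arr A" "Dom A g = Cod A ?e" "g \<cdot> ?e = HZero A (Dom A ?e) (Cod A g)"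
      have "g \<cdot> ?k n = (g \<cdot> ?e) \<cdot> ?j1" by (subst e(4)[symmetric], subst assoc) (use X kd e g(1,2) in auto)
      also have "\<dots> = HZero A (Dom A (?k n)) (Cod A g)" unfolding g(3) using X kd e g(1) by simp
      finally obtain h where "h \<in> Arr A" "Dom A h = Cod A (coim X n)" "Cod A h = Cod A g" "h \<cdot> coim X n = g"
        using cokernel_desc[OF coim_cokernel[OF X(1)], of g n] g e kd by auto
      then show "\<exists>h. h \<in> Arr A \<and> Dom A h = Cod A (coim X n) \<and> Cod A h = Cod A g \<and> h \<cdot> coim X n = g" by blast
    qed (use X kd e qd in \<open>auto intro: cokernel_epi[OF coim_cokernel[OF X(1)]]\<close>)
    show ?thesis
    proof (rule coh_iso_atI)
      show "coh_pres (csrc (cone_to_coim X)) n ?s ?e (coim X n)"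
        unfolding coh_pres_def using ker fac cok e s by (auto simp: cone_to_coim_def sel)
      show "coh_pres (ctgt (cone_to_coim X)) n (Ident A (?V n)) (HZero A (?V (n - 1)) (?V n)) (Ident A (?V n))"
        unfolding coh_pres_def using V
        by (auto simp: cone_to_coim_def intro: kernel_zero_Ident cokernel_zero_Ident)
      show "Ident A (?V n) \<cdot> coim X n = cmap (cone_to_coim X) n \<cdot> ?s"
        using X kd qd[of n] b[of n] by (simp add: cone_to_coim_def)
      show "is_iso A (Ident A (?V n))" by (rule is_iso_Ident[OF V])
    qed (use V qd s in auto)
  qed
  then show ?thesis using a by (auto simp: quasi_isos_iff)
qed

end

section \<open>Generation in the derived category\<close>

lemma sum_closed_isomorphic:
  assumes "category T" "sum_closed T S" "X \<in> S" "isomorphic T X Y"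
  shows "Y \<in> S"
  using category.direct_sum_single[OF assms(1,4)] assms(2,3) unfolding sum_closed_def
  by (metis empty_set empty_subsetI insert_subset list.simps(15))

lemma gen_incl: "I \<subseteq> gen T I"
  by (auto simp: gen_def)

lemma gen_sum_closed:
  assumes "sum_closed T (Obj T)" "I \<subseteq> Obj T"
  shows "sum_closed T (gen T I)"
proof -
  have memI: "X \<in> gen T I" if "\<And>S. I \<subseteq> S \<Longrightarrow> sum_closed T S \<Longrightarrow> X \<in> S" for X
    using that by (auto simp: gen_def)
  have memD: "gen T I \<subseteq> S" if "I \<subseteq> S" "sum_closed T S" for S
    using that by (auto simp: gen_def)
  show ?thesis unfolding sum_closed_def
  proof (intro conjI ballI allI impI iffI)
    show "gen T I \<subseteq> Obj T" by (rule memD[OF assms(2,1)])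
  next
    fix X assume X: "X \<in> Obj T" "Sh_obj T X \<in> gen T I"
    show "X \<in> gen T I"
    proof (rule memI)
      fix S assume S: "I \<subseteq> S" "sum_closed T S"
      then have "Sh_obj T X \<in> S" using memD X(2) by blast
      then show "X \<in> S" using S(2) X(1) by (simp add: sum_closed_def)
    qed
  next
    fix X assume X: "X \<in> Obj T" "X \<in> gen T I"
    show "Sh_obj T X \<in> gen T I"
    proof (rule memI)
      fix S assume S: "I \<subseteq> S" "sum_closed T S"
      then have "X \<in> S" using memD X(2) by blast
      then show "Sh_obj T X \<in> S" using S(2) X(1) by (simp add: sum_closed_def)
    qed
  next
    fix Xs D assume D: "set Xs \<subseteq> gen T I \<and> is_direct_sum T Xs D"
    show "D \<in> gen T I"
    proof (rule memI)
      fix S assume S: "I \<subseteq> S" "sum_closed T S"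
      then have "set Xs \<subseteq> S" using memD D by blast
      then show "D \<in> S" using S(2) D unfolding sum_closed_def by blast
    qed
  next
    fix X D assume D: "D \<in> gen T I \<and> is_direct_summand T X D"
    show "X \<in> gen T I"
    proof (rule memI)
      fix S assume S: "I \<subseteq> S" "sum_closed T S"
      then have "D \<in> S" using memD D by blast
      then show "X \<in> S" using S(2) D unfolding sum_closed_def by blast
    qed
  qed
qed

context abelian_category
begin

lemma direct_sum_Cons:
  assumes X: "X \<in> Obj A" and P: "is_direct_sum A Xs P"
  shows "is_direct_sum A (X # Xs) (bsum A X P)"
proof -
  let ?n = "length Xs"
  have o: "P \<in> Obj A" "set Xs \<subseteq> Obj A" using P by (auto simp: is_direct_sum_def)
  obtain \<iota> where \<iota>: "\<And>k. k < ?n \<Longrightarrow> \<iota> k \<in> Hom A (Xs ! k) P"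
    and ex: "\<And>T f. T \<in> Obj A \<Longrightarrow> (\<And>k. k < ?n \<Longrightarrow> f k \<in> Hom A (Xs ! k) T) \<Longrightarrow>
      \<exists>h \<in> Hom A P T. \<forall>k < ?n. h \<cdot> \<iota> k = f k"
    and un: "\<And>T x y. x \<in> Hom A P T \<Longrightarrow> y \<in> Hom A P T \<Longrightarrow>
      (\<And>k. k < ?n \<Longrightarrow> x \<cdot> \<iota> k = y \<cdot> \<iota> k) \<Longrightarrow> x = y"
    by (rule direct_sumE[OF P]) blast
  define \<kappa> where "\<kappa> k = (case k of 0 \<Rightarrow> binj1 A X P | Suc k \<Rightarrow> binj2 A X P \<cdot> \<iota> k)" for k
  have all: "(\<forall>k < length (X # Xs). Q k) \<longleftrightarrow> Q 0 \<and> (\<forall>k < ?n. Q (Suc k))" for Q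
    by (simp add: All_less_Suc2)
  have "\<exists>!h. h \<in> Hom A (bsum A X P) T \<and> (\<forall>k < length (X # Xs). h \<cdot> \<kappa> k = f k)"
    if T: "T \<in> Obj A" and f: "\<forall>k < length (X # Xs). f k \<in> Hom A ((X # Xs) ! k) T" for T f
  proof -
    have f0: "f 0 \<in> Hom A X T" "\<forall>k < ?n. f (Suc k) \<in> Hom A (Xs ! k) T" using f unfolding all by auto
    obtain g where g: "g \<in> Hom A P T" "\<forall>k < ?n. g \<cdot> \<iota> k = f (Suc k)"
      using ex[OF T, of "\<lambda>k. f (Suc k)"] f0(2) by blast
    have \<kappa>h: "h \<cdot> \<kappa> 0 = h \<cdot> binj1 A X P" "k < ?n \<Longrightarrow> h \<cdot> \<kappa> (Suc k) = (h \<cdot> binj2 A X P) \<cdot> \<iota> k"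
      if "h \<in> Hom A (bsum A X P) T" for h k
      using that X o \<iota>[of k] by (auto simp: \<kappa>_def)
    have "(f 0 \<cdot> bproj1 A X P) \<oplus>\<^sub>h (g \<cdot> bproj2 A X P) \<in> Hom A (bsum A X P) T"
      "((f 0 \<cdot> bproj1 A X P) \<oplus>\<^sub>h (g \<cdot> bproj2 A X P)) \<cdot> binj1 A X P = f 0"
      "((f 0 \<cdot> bproj1 A X P) \<oplus>\<^sub>h (g \<cdot> bproj2 A X P)) \<cdot> binj2 A X P = g"
      using f0(1) g(1) X o by auto
    then obtain h where h: "h \<in> Hom A (bsum A X P) T" "h \<cdot> binj1 A X P = f 0" "h \<cdot> binj2 A X P = g"
      by blast
    show ?thesis unfolding all
    proof (rule ex1I[of _ h])
      show "h \<in> Hom A (bsum A X P) T \<and> h \<cdot> \<kappa> 0 = f 0 \<and> (\<forall>k < ?n. h \<cdot> \<kappa> (Suc k) = f (Suc k))"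
        using \<kappa>h[OF h(1)] h g(2) by simp
      fix h' assume h': "h' \<in> Hom A (bsum A X P) T \<and> h' \<cdot> \<kappa> 0 = f 0 \<and> (\<forall>k < ?n. h' \<cdot> \<kappa> (Suc k) = f (Suc k))"
      then have a: "h' \<in> Hom A (bsum A X P) T" by blast
      have e1: "h' \<cdot> binj1 A X P = f 0" using h' unfolding \<kappa>h(1)[OF a] by blast
      have e2: "h' \<cdot> binj2 A X P = g"
      proof (rule un[OF _ g(1)])
        show "h' \<cdot> binj2 A X P \<in> Hom A P T" using a X o by simp
        show "(h' \<cdot> binj2 A X P) \<cdot> \<iota> k = g \<cdot> \<iota> k" if k: "k < ?n" for k
        proof -
          have "(h' \<cdot> binj2 A X P) \<cdot> \<iota> k = h' \<cdot> \<kappa> (Suc k)" by (rule \<kappa>h(2)[OF a k, symmetric])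
          also have "\<dots> = f (Suc k)" using h' k by blast
          also have "\<dots> = g \<cdot> \<iota> k" using g(2) k by simp
          finally show ?thesis .
        qed
      qed
      show "h' = h"
        by (rule bsum_coext[of X P]) (use a h(1) X o e1 e2 h(2,3) in simp_all)
    qed
  qed
  moreover have "\<forall>k < length (X # Xs). \<kappa> k \<in> Hom A ((X # Xs) ! k) (bsum A X P)"
    unfolding all using \<iota> X o by (auto simp: \<kappa>_def)
  ultimately show ?thesis unfolding is_direct_sum_def using X o
    by (intro conjI exI[of _ \<kappa>] ballI allI impI) auto
qed

lemma direct_sum_bsum:
  assumes "X \<in> Obj A" "Y \<in> Obj A"
  shows "is_direct_sum A [X, Y] (bsum A X Y)"
  by (rule direct_sum_Cons[OF assms(1) direct_sum_single[OF isomorphic_refl[OF assms(2)]]])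

lemma zero_isomorphic:
  assumes "is_zero_obj A X" "is_zero_obj A Y"
  shows "isomorphic A X Y"
  by (rule isomorphicI[of "HZero A X Y" _ _ "HZero A Y X"]) (use assms in \<open>auto simp: zero_obj_iff\<close>)

lemma bsum_zero_isomorphic:
  assumes "X \<in> Obj A" "is_zero_obj A Z"
  shows "isomorphic A (bsum A X Z) X" "isomorphic A (bsum A Z X) X"
proof -
  have Z: "Z \<in> Obj A" using assms(2) by (simp add: zero_obj_iff)
  have "bproj2 A X Z = HZero A (bsum A X Z) Z" "bproj1 A Z X = HZero A (bsum A Z X) Z"
    using zero_obj_Arr[of "bproj2 A X Z"] zero_obj_Arr[of "bproj1 A Z X"] assms Z by auto
  then have "binj1 A X Z \<cdot> bproj1 A X Z = Ident A (bsum A X Z)" "binj2 A Z X \<cdot> bproj2 A Z X = Ident A (bsum A Z X)"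
    using bsum_ident[of X Z] bsum_ident[of Z X] assms(1) Z by simp_all
  then show "isomorphic A (bsum A X Z) X" "isomorphic A (bsum A Z X) X"
    using assms(1) Z isomorphicI[of "bproj1 A X Z" "bsum A X Z" X "binj1 A X Z"]
      isomorphicI[of "bproj2 A Z X" "bsum A Z X" X "binj2 A Z X"] by auto
qed

lemma zero_diff_Obj:
  assumes "\<And>n. V n \<in> Obj A" "finite F" "\<And>n. n \<notin> F \<Longrightarrow> is_zero_obj A (V n)"
  shows "zero_diff V \<in> Obj (Cb A)"
proof -
  obtain N where N: "\<And>n. n \<in> F \<Longrightarrow> \<bar>n\<bar> \<le> N"
    using finite_imageI[OF assms(2), of abs] by (metis Max_ge imageI)
  have "is_bounded A (zero_diff V)"
    unfolding is_bounded_def by (rule exI[of _ N]) (use N assms(3) in force)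
  then show ?thesis using assms(1) by simp
qed

definition stalk_at :: "int \<Rightarrow> 'o \<Rightarrow> ('o, 'm) cplx" where
  "stalk_at a X = zero_diff (\<lambda>n. if n = a then X else zero_obj A)"

lemma stalk_eq_stalk_at: "stalk A X = stalk_at 0 X"
  by (simp add: stalk_def stalk_at_def zero_diff_def Let_def)

lemma stalk_at_Obj: "X \<in> Obj A \<Longrightarrow> stalk_at a X \<in> Obj (Cb A)"
  unfolding stalk_at_def by (rule zero_diff_Obj[of _ "{a}"]) auto

text \<open>An equality of complexes, not just an isomorphism, because the zero object is a fixed choice and the
  differentials vanish.  Thus closure under the shift in both directions moves stalks to any degree.\<close>

lemma shift_stalk_at: "X \<in> Obj A \<Longrightarrow> shift_cplx A (stalk_at (a + 1) X) = stalk_at a X"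
  by (auto simp: stalk_at_def zero_diff_def shift_cplx_def algebra_simps)

lemma Db_simps [simp]:
  "Obj (Db A) = Obj (Db_cat A)" "Arr (Db A) = Arr (Db_cat A)" "Dom (Db A) = Dom (Db_cat A)"
  "Cod (Db A) = Cod (Db_cat A)" "Ident (Db A) = Ident (Db_cat A)" "Comp (Db A) = Comp (Db_cat A)"
  "Sh_obj (Db A) = shift_cplx A" "Tri (Db A) = Db_triangles A"
  by (simp_all add: Db_def cat.extend_def)

lemma Db_Hom: "Hom (Db A) = Hom (Db_cat A)"
  by (intro ext) (simp add: Hom_def)

lemma category_Db_cat: "category (Db_cat A)"
  unfolding Db_cat_def by (rule category.category_localization[OF category_Cb])

lemma category_Db: "category (Db A)"
  using category_Db_cat unfolding category_def Db_Hom by simp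

lemma is_direct_sum_Db: "is_direct_sum (Db A) Xs S \<longleftrightarrow> is_direct_sum (Db_cat A) Xs S"
  unfolding is_direct_sum_def Db_Hom by simp

lemma is_iso_Db: "is_iso (Db A) f \<longleftrightarrow> is_iso (Db_cat A) f"
  unfolding is_iso_def Db_Hom by simp

lemma Db_Obj: "Obj (Db_cat A) = Obj (Cb A)"
  unfolding Db_cat_def by (rule category.localization_simps[OF category_Cb])

lemma Db_isomorphic: "isomorphic (Cb A) X Y \<Longrightarrow> isomorphic (Db A) X Y"
  unfolding isomorphic_def is_iso_Db Db_Hom Db_cat_def
  using category.loc_functor_Hom[OF category_Cb] category.loc_functor_iso[OF category_Cb] by blast

lemma Db_quasi_iso: "f \<in> quasi_isos A \<Longrightarrow> isomorphic (Db A) (csrc f) (ctgt f)"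
  unfolding isomorphic_def is_iso_Db Db_Hom Db_cat_def
  using category.loc_functor_Hom[OF category_Cb, of f "csrc f" "ctgt f" "quasi_isos A"]
    category.loc_functor_inverts[OF category_Cb, of f "quasi_isos A" "csrc f" "ctgt f"]
  by (auto simp: quasi_isos_iff simp del: Hom_def simp: Hom_def[of "Cb A"])

lemma Db_direct_sum:
  assumes "X \<in> Obj (Cb A)" "Y \<in> Obj (Cb A)"
  shows "is_direct_sum (Db A) [X, Y] (ccop X Y)"
  unfolding is_direct_sum_Db Db_cat_def
  by (rule localized_coproducts.localization_coproduct[OF localized_coproducts_Cb assms])

lemma Db_sum_zero:
  assumes "Z \<in> Obj (Cb A)" "\<And>n. is_zero_obj A (cobj Z n)"
  shows "is_direct_sum (Db A) [] Z"
  unfolding is_direct_sum_Db Db_cat_def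
  by (rule category.localization_initial[OF category_Cb])
     (use assms Cb_zero_initial(1)[OF assms] in auto)

lemma sum_closed_Obj: "sum_closed (Db A) (Obj (Db A))"
  unfolding sum_closed_def
proof (intro conjI ballI allI impI)
  show "X \<in> Obj (Db A)" if "D \<in> Obj (Db A) \<and> is_direct_summand (Db A) X D" for X D
    using that unfolding is_direct_summand_def is_direct_sum_def by auto
qed (use shift_Obj in \<open>auto simp: Db_Obj is_direct_sum_def simp del: Cb_simps(1)\<close>)

end

locale sum_closed_in_Db = abelian_category +
  fixes S
  assumes S: "sum_closed (Db A) S"
begin

lemma S_iso: "isomorphic (Cb A) X Y \<Longrightarrow> X \<in> S \<Longrightarrow> Y \<in> S"
  using sum_closed_isomorphic[OF category_Db S] Db_isomorphic by blast

lemma S_ccop: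
  assumes "X \<in> S" "Y \<in> S"
  shows "ccop X Y \<in> S"
proof -
  have "X \<in> Obj (Cb A)" "Y \<in> Obj (Cb A)" using assms S by (auto simp: sum_closed_def Db_Obj)
  then have "is_direct_sum (Db A) [X, Y] (ccop X Y)" by (rule Db_direct_sum)
  moreover have "set [X, Y] \<subseteq> S" using assms by simp
  ultimately show ?thesis using S unfolding sum_closed_def by blast
qed

lemma S_ccopD:
  assumes "ccop X Y \<in> S" "X \<in> Obj (Cb A)" "Y \<in> Obj (Cb A)"
  shows "X \<in> S"
  using S assms Db_direct_sum[OF assms(2,3)] unfolding sum_closed_def is_direct_summand_def by blast

lemma S_stalk_at:
  assumes X: "X \<in> Obj A" and "stalk A X \<in> S"
  shows "stalk_at a X \<in> S"
proof -
  have sh: "stalk_at i X \<in> S \<longleftrightarrow> stalk_at (i + 1) X \<in> S" for i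
  proof -
    have "\<forall>Y \<in> Obj (Cb A). shift_cplx A Y \<in> S \<longleftrightarrow> Y \<in> S"
      using S by (simp add: sum_closed_def Db_Obj del: Cb_simps(1))
    then show ?thesis using stalk_at_Obj[OF X, of "i + 1"] shift_stalk_at[OF X, of i] by metis
  qed
  show ?thesis
  proof (induction a rule: int_induct[where k = 0])
    case base
    then show ?case using assms by (simp add: stalk_eq_stalk_at)
  next
    case (step1 i)
    then show ?case using sh by blast
  next
    case (step2 i)
    then show ?case using sh[of "i - 1"] by simp
  qed
qed

text \<open>Splitting off one degree at a time writes a bounded complex with zero differential as a finite direct
  sum of shifted stalks.\<close>

lemma S_zero_diff:
  assumes st: "\<And>X. X \<in> Obj A \<Longrightarrow> stalk A X \<in> S"
    and "finite F" "\<And>n. V n \<in> Obj A" "\<And>n. n \<notin> F \<Longrightarrow> is_zero_obj A (V n)"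
  shows "zero_diff V \<in> S"
  using assms(2-4)
proof (induction F arbitrary: V)
  case empty
  then have "is_direct_sum (Db A) [] (zero_diff V)"
    by (intro Db_sum_zero) (auto intro!: zero_diff_Obj[of _ "{}"] simp del: Cb_simps(1))
  then show ?case using S unfolding sum_closed_def by (metis empty_set empty_subsetI)
next
  case (insert a F)
  let ?V = "V(a := zero_obj A)" and ?W = "\<lambda>n. if n = a then V a else zero_obj A"
  have "zero_diff ?V \<in> S" by (rule insert.IH) (use insert.prems in auto)
  moreover have "zero_diff ?W \<in> S" using S_stalk_at[OF insert.prems(1) st[OF insert.prems(1)], of a a] by (simp add: stalk_at_def)
  ultimately have "ccop (zero_diff ?V) (zero_diff ?W) \<in> S" by (rule S_ccop)
  then have "zero_diff (\<lambda>n. bsum A (?V n) (?W n)) \<in> S"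
    using zero_diff_ccop[of ?V ?W] insert.prems(1) by simp
  moreover have "isomorphic (Cb A) (zero_diff (\<lambda>n. bsum A (?V n) (?W n))) (zero_diff V)"
  proof (rule zero_diff_isomorphic)
    show "zero_diff V \<in> Obj (Cb A)" by (rule zero_diff_Obj[of _ "insert a F"]) (use insert in auto)
    show "zero_diff (\<lambda>n. bsum A (?V n) (?W n)) \<in> Obj (Cb A)"
      by (rule zero_diff_Obj[of _ "insert a F"]) (use insert in \<open>auto intro: is_zero_bsum\<close>)
    show "isomorphic A (bsum A (?V n) (?W n)) (V n)" for n
      using bsum_zero_isomorphic[of "V n" "zero_obj A"] insert.prems(1)[of n] by auto
  qed
  ultimately show ?case using S_iso by blast
qed

lemma stalk_at_isomorphic:
  assumes "isomorphic A X Y"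
  shows "isomorphic (Cb A) (stalk_at a X) (stalk_at a Y)"
proof -
  have "X \<in> Obj A" "Y \<in> Obj A" using assms by (auto simp: isomorphic_def)
  then show ?thesis using stalk_at_Obj[of X a] stalk_at_Obj[of Y a] assms isomorphic_refl[of "zero_obj A"]
    unfolding stalk_at_def by (intro zero_diff_isomorphic) auto
qed

lemma stalk_at_bsum:
  assumes "X \<in> Obj A" "Y \<in> Obj A"
  shows "isomorphic (Cb A) (ccop (stalk_at a X) (stalk_at a Y)) (stalk_at a (bsum A X Y))"
proof -
  let ?V = "\<lambda>X n. if n = a then X else zero_obj A"
  have "ccop (stalk_at a X) (stalk_at a Y) = zero_diff (\<lambda>n. bsum A (?V X n) (?V Y n))"
    unfolding stalk_at_def by (rule zero_diff_ccop) (use assms in auto)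
  moreover have "isomorphic (Cb A) (zero_diff (\<lambda>n. bsum A (?V X n) (?V Y n))) (zero_diff (?V (bsum A X Y)))"
  proof (rule zero_diff_isomorphic)
    show "zero_diff (\<lambda>n. bsum A (?V X n) (?V Y n)) \<in> Obj (Cb A)" "zero_diff (?V (bsum A X Y)) \<in> Obj (Cb A)"
      by (rule zero_diff_Obj[of _ "{a}"]; use assms in \<open>auto intro: is_zero_bsum\<close>)+
    show "isomorphic A (bsum A (?V X n) (?V Y n)) (?V (bsum A X Y) n)" for n
      using assms isomorphic_refl[of "bsum A X Y"] zero_isomorphic[OF is_zero_bsum, of "zero_obj A" "zero_obj A" "zero_obj A"]
      by auto
  qed
  ultimately show ?thesis by (simp add: stalk_at_def)
qed

lemma S_stalk_bsum:
  assumes "X \<in> Obj A" "Y \<in> Obj A"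
  shows "stalk A X \<in> S \<Longrightarrow> stalk A Y \<in> S \<Longrightarrow> stalk A (bsum A X Y) \<in> S"
    "stalk A (bsum A X Y) \<in> S \<Longrightarrow> stalk A X \<in> S"
proof -
  note iso = stalk_at_bsum[OF assms, of 0]
  show "stalk A X \<in> S \<Longrightarrow> stalk A Y \<in> S \<Longrightarrow> stalk A (bsum A X Y) \<in> S"
    unfolding stalk_eq_stalk_at using S_iso[OF iso] S_ccop by blast
  show "stalk A (bsum A X Y) \<in> S \<Longrightarrow> stalk A X \<in> S"
    unfolding stalk_eq_stalk_at using S_iso[OF category.isomorphic_sym[OF category_Cb iso]]
      S_ccopD stalk_at_Obj assms by blast
qed

lemma S_stalk_iso: "isomorphic A X Y \<Longrightarrow> stalk A X \<in> S \<Longrightarrow> stalk A Y \<in> S"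
  unfolding stalk_eq_stalk_at by (rule S_iso[OF stalk_at_isomorphic])

text \<open>The stalk functor preserves finite biproducts, so membership of \<open>stalk A M\<close> passes to all objects
  built from \<open>M\<close>.  The given direct sum need not be an iterated chosen biproduct; it is compared with one by
  uniqueness of direct sums.\<close>

lemma S_stalk_add_closure:
  assumes M: "M \<in> Obj A" "stalk A M \<in> S" and X: "X \<in> add_closure A M"
  shows "stalk A X \<in> S"
proof -
  have sums: "\<exists>P. is_direct_sum A (replicate n M) P \<and> stalk A P \<in> S" for n
  proof (induction n)
    case 0
    have "stalk A (zero_obj A) \<in> S"
    proof -
      have "is_direct_sum (Db A) [] (stalk_at 0 (zero_obj A))"
        by (rule Db_sum_zero[OF stalk_at_Obj]) (auto simp: stalk_at_def)
      then show ?thesis using S unfolding sum_closed_def stalk_eq_stalk_at by (metis empty_set empty_subsetI)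
    qed
    moreover have "is_direct_sum A [] (zero_obj A)"
      using zero_obj(1) unfolding is_direct_sum_def is_zero_obj_def by auto
    ultimately show ?case by auto
  next
    case (Suc n)
    then obtain P where P: "is_direct_sum A (replicate n M) P" "stalk A P \<in> S" by blast
    then have "P \<in> Obj A" by (simp add: is_direct_sum_def)
    then show ?case using direct_sum_Cons[OF M(1) P(1)] S_stalk_bsum(1)[OF M(1) _ M(2) P(2)] by auto
  qed
  obtain n B Y where B: "is_direct_sum A (replicate n M) B" and Y: "is_direct_sum A [X, Y] B"
    using X by (auto simp: add_closure_def is_direct_summand_def)
  then have o: "X \<in> Obj A" "Y \<in> Obj A" by (auto simp: is_direct_sum_def)
  obtain P where P: "is_direct_sum A (replicate n M) P" "stalk A P \<in> S" using sums by blast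
  have "isomorphic A P (bsum A X Y)"
    using isomorphic_trans direct_sum_unique P(1) B Y direct_sum_bsum[OF o] by blast
  then have "stalk A (bsum A X Y) \<in> S" using P(2) by (rule S_stalk_iso)
  then show ?thesis by (rule S_stalk_bsum(2)[OF o])
qed

end

section \<open>Triangles and levels\<close>

context abelian_category
begin

lemma Db_shift_Ident:
  assumes "X \<in> Obj (Cb A)"
  shows "Db_shift_arr A (Ident (Db_cat A) X) = Ident (Db_cat A) (shift_cplx A X)"
proof -
  interpret K: category "Cb A" by (rule category_Cb)
  let ?zeq = "zz_eq (Cb A) (quasi_isos A)"
  have "(\<exists>p. ?zeq X X [] p \<and> ?zeq (shift_cplx A X) (shift_cplx A X) (map (map_zstep (shift_chmap A)) p) r) \<longleftrightarrow>
      ?zeq (shift_cplx A X) (shift_cplx A X) [] r" for r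
    using K.zz_eq_map[OF preserves_shift, of X X "[]"] zz_eq.refl[of "Cb A" "quasi_isos A" X X "[]"] assms
    by (auto intro: zz_eq.trans simp del: Cb_simps(1))
  then show ?thesis
    unfolding Db_cat_def K.localization_simps by (auto simp: Db_shift_arr_def zz_class_def)
qed

lemma Db_functor_Hom: "f \<in> Hom (Cb A) X Y \<Longrightarrow> Db_functor A f \<in> Hom (Db_cat A) X Y"
  unfolding Db_functor_def Db_cat_def by (rule category.loc_functor_Hom[OF category_Cb])

text \<open>With identities as the comparison isomorphisms.  Allowing a cone as the third object makes rotations
  of triangles unnecessary; cones are later replaced by simpler complexes through closure under isomorphism.\<close>

lemma cone_triangle:
  assumes "f \<in> Arr (Cb A)"
  shows "(Db_functor A f, Db_functor A (cone_in A f), Db_functor A (cone_out A f)) \<in> Db_triangles A"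
proof -
  interpret D: category "Db_cat A" by (rule category_Db_cat)
  have f: "f \<in> Hom (Cb A) (csrc f) (ctgt f)" using assms by simp
  note F = Db_functor_Hom[OF f] Db_functor_Hom[OF cone_in_out(1)[OF assms]] Db_functor_Hom[OF cone_in_out(2)[OF assms]]
  have o: "csrc f \<in> Obj (Cb A)" "ctgt f \<in> Obj (Cb A)" "cone A f \<in> Obj (Cb A)"
    using assms cone_Obj[OF assms] by (auto simp: Cb_Arr)
  note I = D.ident_hom[unfolded Db_Obj, OF o(1)] D.ident_hom[unfolded Db_Obj, OF o(2)] D.ident_hom[unfolded Db_Obj, OF o(3)]
  note J = D.is_iso_Ident[unfolded Db_Obj, OF o(1)] D.is_iso_Ident[unfolded Db_Obj, OF o(2)] D.is_iso_Ident[unfolded Db_Obj, OF o(3)]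
  note L = D.comp_ident_left D.comp_ident_right
  show ?thesis
    unfolding Db_triangles_def Let_def mem_Collect_eq prod.case
    by (intro exI conjI) 
       (rule F I J assms | simp only: L[OF F(1)] L[OF F(2)] L[OF F(3)] Db_shift_Ident[OF o(1)])+
qed

lemma star_cone:
  assumes "f \<in> Arr (Cb A)" "csrc f \<in> I" "cone A f \<in> J"
  shows "ctgt f \<in> star (Db A) I J"
proof -
  have f: "f \<in> Hom (Cb A) (csrc f) (ctgt f)" using assms by simp
  have "ctgt f \<in> Obj (Cb A)" using assms(1) by (simp add: Cb_Arr)
  then show ?thesis
    unfolding star_def mem_Collect_eq Db_simps Db_Hom Db_Obj
    using assms cone_triangle[OF assms(1)] Db_functor_Hom[OF f]
      Db_functor_Hom[OF cone_in_out(1)[OF assms(1)]] Db_functor_Hom[OF cone_in_out(2)[OF assms(1)]] by blast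
qed

lemma Db_zero_obj:
  assumes Z: "Z \<in> Obj (Cb A)" "\<And>n. is_zero_obj A (cobj Z n)"
  shows "is_zero_obj (Db A) Z"
proof -
  interpret K: category "Cb A" by (rule category_Cb)
  have "\<exists>!f. f \<in> Hom (Db_cat A) X Z" if "X \<in> Obj (Cb A)" for X
    unfolding Db_cat_def by (rule K.localization_terminal[OF Cb_zero_initial(2)[OF Z] Z(1) that])
  moreover have "\<exists>!f. f \<in> Hom (Db_cat A) Z X" if "X \<in> Obj (Cb A)" for X
    using Db_sum_zero[OF Z] that unfolding is_direct_sum_def
    by (simp add: Db_Obj Db_Hom del: Cb_simps(1) Hom_def)
  ultimately show ?thesis using Z(1) unfolding is_zero_obj_def Db_Hom Db_simps Db_Obj by blast
qed

text \<open>For \<open>0 \<rightarrow> M\<close> the cone is \<open>M\<close> itself; this yields the triangle \<open>0 \<rightarrow> M \<rightarrow> M \<rightarrow> 0\<close>.\<close>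

lemma cone_from_zero:
  assumes M: "M \<in> Obj (Cb A)" and f: "f \<in> Hom (Cb A) Z M" and zero: "\<And>n. is_zero_obj A (cobj Z n)"
  shows "isomorphic (Cb A) M (cone A f)"
proof -
  interpret K: category "Cb A" by (rule category_Cb)
  have a: "f \<in> Arr (Cb A)" using f by simp
  have c: "is_complex A Z" "is_complex A M" "is_chain_map A f" "csrc f = Z" "ctgt f = M" using f by (auto simp: Cb_Arr)
  have c': "is_complex A (csrc f)" "is_complex A (ctgt f)" using c by auto
  note d = cone_cdiff[OF c' c(3), unfolded c(4,5)]
  have f0: "cmap f n = HZero A (cobj Z n) (cobj M n)" for n
    using zero_obj_Arr[of "cmap f n"] c zero[of n] by simp
  let ?g = "\<lparr>csrc = cone A f, ctgt = M, cmap = (\<lambda>n. bproj2 A (cobj Z (n + 1)) (cobj M n))\<rparr>"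
  have "is_chain_map A ?g"
    by (rule chainI) (use c d f0 in \<open>auto simp: index_simps\<close>)
  then have g: "?g \<in> Hom (Cb A) (cone A f) M" using M cone_Obj[OF a] by (auto simp: Cb_Arr)
  have i: "cone_in A f \<in> Hom (Cb A) M (cone A f)" using cone_in_out(1)[OF a] c by simp
  have e: "binj2 A (cobj Z (n + 1)) (cobj M n) \<cdot> bproj2 A (cobj Z (n + 1)) (cobj M n) =
      Ident A (bsum A (cobj Z (n + 1)) (cobj M n))" for n
  proof -
    have "bproj1 A (cobj Z (n + 1)) (cobj M n) = HZero A (bsum A (cobj Z (n + 1)) (cobj M n)) (cobj Z (n + 1))"
      using zero_obj_Arr[of "bproj1 A (cobj Z (n + 1)) (cobj M n)"] zero[of "n + 1"] c by simp
    then show ?thesis using bsum_ident[of "cobj Z (n + 1)" "cobj M n"] c by simp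
  qed
  show ?thesis
  proof (rule K.isomorphicI[OF i g])
    show "?g \<cdot>\<^bsub>Cb A\<^esub> cone_in A f = Ident (Cb A) M"
      by (rule chmap_eqI) (use c in \<open>auto simp: cone_in_def\<close>)
    show "cone_in A f \<cdot>\<^bsub>Cb A\<^esub> ?g = Ident (Cb A) (cone A f)"
      by (rule chmap_eqI) (use c e in \<open>auto simp: cone_in_def\<close>)
  qed
qed

text \<open>Both parts of the main result are instances: \<open>I\<close> may be all stalks, or a single stalk that generates
  the others.  Every object \<open>M\<close> of \<open>gen I\<close> lies in the first level, by the triangle on \<open>0 \<rightarrow> M\<close>; and every complex
  \<open>X\<close> sits in a triangle between its cocycles \<open>Z\<close> and \<open>X/Z\<close>, which both lie in \<open>gen I\<close>.\<close>

theorem Db_eq_gen_level_2: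
  assumes I: "I \<subseteq> Obj (Db A)" and stalks: "stalk A ` Obj A \<subseteq> gen (Db A) I"
  shows "Obj (Db A) = gen_level (Db A) I 2"
proof -
  let ?G = "gen (Db A) I"
  have G: "sum_closed (Db A) ?G" by (rule gen_sum_closed[OF sum_closed_Obj I])
  then interpret G: sum_closed_in_Db A ?G by unfold_locales
  have GO: "?G \<subseteq> Obj (Cb A)" using G unfolding sum_closed_def by (auto simp: Db_Obj simp del: Cb_simps(1))
  have zero_diff: "zero_diff V \<in> ?G" if "zero_diff V \<in> Obj (Cb A)" for V
  proof -
    have c: "is_complex A (zero_diff V)" "is_bounded A (zero_diff V)" using that by auto
    obtain N where N: "\<And>n. \<bar>n\<bar> > N \<Longrightarrow> is_zero_obj A (V n)" using c(2) by (auto simp: is_bounded_def)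
    show ?thesis
      by (rule G.S_zero_diff[of "{-N..N}"]) (use stalks N complex_simps(1)[OF c(1)] in auto)
  qed
  have level1: "?G \<subseteq> gen_level (Db A) I 1"
  proof
    fix M assume M: "M \<in> ?G"
    then have MO: "M \<in> Obj (Cb A)" using GO by blast
    let ?Z = "zero_diff (\<lambda>_. zero_obj A)"
    have Z: "?Z \<in> Obj (Cb A)" by (rule zero_diff_Obj[of _ "{}"]) auto
    obtain f where f: "f \<in> Hom (Cb A) ?Z M" using Cb_zero_initial(1)[OF Z _ MO] by auto
    have "cone A f \<in> ?G"
      by (rule G.S_iso[OF cone_from_zero[OF MO f] M]) simp
    then have "ctgt f \<in> star (Db A) {Z. is_zero_obj (Db A) Z} ?G"
      using f Db_zero_obj[OF Z] by (intro star_cone) auto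
    then show "M \<in> gen_level (Db A) I 1"
      using f gen_incl[of "star (Db A) {Z. is_zero_obj (Db A) Z} ?G" "Db A"] by (auto simp: diamond_def)
  qed
  show ?thesis
  proof
    show "gen_level (Db A) I 2 \<subseteq> Obj (Db A)"
      using sum_closed_Obj by (auto simp: numeral_2_eq_2 diamond_def gen_def star_def)
  next
    show "Obj (Db A) \<subseteq> gen_level (Db A) I 2"
    proof
      fix X assume "X \<in> Obj (Db A)"
      then have X: "X \<in> Obj (Cb A)" by (simp add: Db_Obj)
      let ?f = "cocyc_incl X"
      have f: "?f \<in> Arr (Cb A)" "ctgt ?f = X" by (rule cocyc_incl_Arr[OF X]) (simp add: cocyc_incl_def)
      have "csrc ?f \<in> ?G" using zero_diff f(1) by (auto simp: Cb_Arr cocyc_incl_def)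
      moreover have "cone A ?f \<in> ?G"
      proof (rule sum_closed_isomorphic[OF category_Db G zero_diff[OF zero_diff_coim_Obj[OF X]]])
        show "isomorphic (Db A) (zero_diff (\<lambda>n. Cod A (coim X n))) (cone A ?f)"
          using Db_quasi_iso[OF cone_to_coim_quasi_iso[OF X]] category.isomorphic_sym[OF category_Db]
          by (auto simp: cone_to_coim_def)
      qed
      ultimately have "X \<in> star (Db A) (gen_level (Db A) I 1) ?G"
        using star_cone[OF f(1), of "gen_level (Db A) I 1" ?G] level1 unfolding f(2) by blast
      then have "X \<in> diamond (Db A) (gen_level (Db A) I 1) ?G"
        unfolding diamond_def by (rule subsetD[OF gen_incl])
      then show "X \<in> gen_level (Db A) I 2" by (simp add: numeral_2_eq_2)
    qed
  qed
qed

end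

theorem mainTheorem1:
  fixes A :: "('o, 'm, 'x) preadd_cat_scheme"
  assumes "abelian_category A"
  shows "Obj (Db A) = gen_level (Db A) (stalk A ` Obj A) 2 \<and>
         ((\<exists>M \<in> Obj A. Obj A = add_closure A M) \<longrightarrow> tri_dim (Db A) \<le> 1)"
proof -
  interpret abelian_category A by (rule assms)
  have stalk_Obj: "stalk A X \<in> Obj (Db A)" if "X \<in> Obj A" for X
    using stalk_at_Obj[OF that, of 0] by (simp add: stalk_eq_stalk_at Db_Obj)
  show ?thesis
  proof (intro conjI impI)
    show "Obj (Db A) = gen_level (Db A) (stalk A ` Obj A) 2"
      by (rule Db_eq_gen_level_2[OF _ gen_incl]) (use stalk_Obj in auto)
  next
    assume "\<exists>M \<in> Obj A. Obj A = add_closure A M"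
    then obtain M where M: "M \<in> Obj A" "Obj A = add_closure A M" by blast
    have I: "{stalk A M} \<subseteq> Obj (Db A)" using stalk_Obj[OF M(1)] by simp
    interpret G: sum_closed_in_Db A "gen (Db A) {stalk A M}"
      by unfold_locales (rule gen_sum_closed[OF sum_closed_Obj I])
    have "stalk A ` Obj A \<subseteq> gen (Db A) {stalk A M}"
      using G.S_stalk_add_closure[OF M(1)] gen_incl[of "{stalk A M}" "Db A"] M(2) by blast
    then have "Obj (Db A) = gen_level (Db A) {stalk A M} (1 + 1)"
      using Db_eq_gen_level_2[OF I] by (simp add: numeral_2_eq_2)
    then have "enat 1 \<in> {enat d | d. \<exists>M \<in> Obj (Db A). Obj (Db A) = gen_level (Db A) {M} (d + 1)}"
      using stalk_Obj[OF M(1)] by blast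
    then show "tri_dim (Db A) \<le> 1"
      unfolding tri_dim_def one_enat_def by (rule Inf_lower)
  qed
qed

end
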